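(* Let $N$ be a connected non-orientable surface (possibly with punctures) with negative Euler characteristic, let $X$ be a complete hyperbolic metric on $N$, and let $\alpha,\beta\in\hat\pi$ be essential free homotopy classes. Suppose that $\alpha(X)$ and $\beta(X)$ intersect transversely at a point $P$ and that $|\alpha_P^m\beta_P|$ is a puncture loop for some non-zero integer $m$. Then every non-zero integer $m$ for which $|\alpha_P^m\beta_P|$ is a puncture loop is odd, and there are at most two such integers. Moreover, if there are exactly two such integers, they are consecutive odd integers.
   Context: $\hat\pi$ is the set of free homotopy classes of oriented closed curves (loops) on $N$. A closed curve is a puncture loop if it is freely homotopic to a loop that winds around a puncture one or more times; a closed curve that is neither a puncture loop nor a trivial (null-homotopic) loop is essential. These terms are also used for free homotopy classes. For an essential class $\alpha$, $\alpha(X)$ denotes its closed geodesic representative with respect to $X$, traversed in the direction of $\alpha$. At a transverse intersection point $P$ of $\alpha(X)$ and $\beta(X)$ (a crossing of a branch of $\alpha(X)$ through $P$ with a branch of $\beta(X)$ through $P$), $\alpha_P,\beta_P\in\pi_1(N,P)$ are the based loops obtained by traversing $\alpha(X)$, respectively $\beta(X)$, once starting at $P$. $\alpha_P^m$ is the $m$-th power in $\pi_1(N,P)$, and $|\gamma|\in\hat\pi$ is the free homotopy class of a based loop $\gamma$. *)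

theory Defs
  imports "HOL-Analysis.Analysis" "HOL-Homology.Homology"
begin

section \<open>Surfaces with punctures\<close>

text \<open>
  A surface with punctures is \<open>N = S - F\<close> with \<open>S\<close> a closed surface and \<open>F\<close> a finite subset of \<open>S\<close>.
  Surfaces are subsets of an arbitrary Hausdorff type, with the subspace topology.
\<close>

definition closed_surface :: "'a::t2_space set \<Rightarrow> bool" where
  "closed_surface S \<longleftrightarrow> compact S \<and>
     (\<forall>x\<in>S. \<exists>U. openin (top_of_set S) U \<and> x \<in> U \<and> U homeomorphic ball (0::complex) 1)"

text \<open>
  An orientation is a choice of generators of the local homology groups
  \<open>H\<^sub>2(N, N - {x}) \<cong> \<int>\<close> that is locally induced by a single class in \<open>H\<^sub>2(N, N - U)\<close>.
\<close>

definition surface_orientation :: "'a::topological_space set \<Rightarrow> ('a \<Rightarrow> 'a chain set) \<Rightarrow> bool" where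
  "surface_orientation N \<omega> \<longleftrightarrow>
     (\<forall>x\<in>N. \<omega> x \<in> carrier (relative_homology_group 2 (top_of_set N) (N - {x})) \<and>
            subgroup_generated (relative_homology_group 2 (top_of_set N) (N - {x})) {\<omega> x}
              = relative_homology_group 2 (top_of_set N) (N - {x})) \<and>
     (\<forall>x\<in>N. \<exists>U c. openin (top_of_set N) U \<and> x \<in> U \<and>
            c \<in> carrier (relative_homology_group 2 (top_of_set N) (N - U)) \<and>
            (\<forall>y\<in>U. hom_induced 2 (top_of_set N) (N - U) (top_of_set N) (N - {y}) id c = \<omega> y))"

definition orientable_surface :: "'a::topological_space set \<Rightarrow> bool" where
  "orientable_surface N \<longleftrightarrow> (\<exists>\<omega>. surface_orientation N \<omega>)"

text \<open>The rank of an abelian group: the largest size of a \<open>\<int>\<close>-linearly independent subset.\<close>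

definition int_independent :: "('g, 'r) monoid_scheme \<Rightarrow> 'g set \<Rightarrow> bool" where
  "int_independent G B \<longleftrightarrow> B \<subseteq> carrier G \<and> finite B \<and>
     (\<forall>k :: 'g \<Rightarrow> int.
        finprod G (\<lambda>x. x [^]\<^bsub>G\<^esub> k x) B = \<one>\<^bsub>G\<^esub> \<longrightarrow> (\<forall>x\<in>B. k x = 0))"

definition abelian_rank :: "('g, 'r) monoid_scheme \<Rightarrow> nat" where
  "abelian_rank G = Sup {card B | B. int_independent G B}"

definition betti_number :: "nat \<Rightarrow> 'a topology \<Rightarrow> nat" where
  "betti_number n T = abelian_rank (homology_group (int n) T)"

definition euler_characteristic :: "'a topology \<Rightarrow> int" where
  "euler_characteristic T = (\<Sum>n | betti_number n T \<noteq> 0. (-1) ^ n * int (betti_number n T))"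

section \<open>Complete hyperbolic metrics\<close>

text \<open>The distance of the upper half plane model of the hyperbolic plane.\<close>

definition hyp_dist :: "complex \<Rightarrow> complex \<Rightarrow> real" where
  "hyp_dist z w = arcosh (1 + (dist z w)\<^sup>2 / (2 * Im z * Im w))"

definition hyperbolic_chart :: "'a metric \<Rightarrow> 'a \<Rightarrow> real \<Rightarrow> ('a \<Rightarrow> complex) \<Rightarrow> bool" where
  "hyperbolic_chart X p r \<phi> \<longleftrightarrow> p \<in> mspace X \<and> r > 0 \<and>
     \<phi> ` {x \<in> mspace X. mdist X p x < r} = {w. Im w > 0 \<and> hyp_dist (\<phi> p) w < r} \<and>
     (\<forall>x \<in> mspace X. \<forall>y \<in> mspace X. mdist X p x < r \<longrightarrow> mdist X p y < r \<longrightarrow>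
        hyp_dist (\<phi> x) (\<phi> y) = mdist X x y)"

definition curve_length :: "'a metric \<Rightarrow> (real \<Rightarrow> 'a) \<Rightarrow> ereal" where
  "curve_length X \<gamma> =
     (SUP (n, u) \<in> {(n :: nat, u :: nat \<Rightarrow> real). mono u \<and> range u \<subseteq> {0..1}}.
        ereal (\<Sum>i<n. mdist X (\<gamma> (u i)) (\<gamma> (u (Suc i)))))"

text \<open>
  A hyperbolic metric is given by its distance function: the distance is the infimum of the lengths
  of connecting paths (so that it is determined by the local geometry), and it is locally isometric
  to the hyperbolic plane.  No finiteness of the area is required.
\<close>

definition hyperbolic_metric_on :: "'a::topological_space set \<Rightarrow> 'a metric \<Rightarrow> bool" where
  "hyperbolic_metric_on N X \<longleftrightarrow>
     mspace X = N \<and> mtopology_of X = top_of_set N \<and>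
     (\<forall>x\<in>N. \<forall>y\<in>N. ereal (mdist X x y) =
        (INF \<gamma> \<in> {\<gamma>. path \<gamma> \<and> path_image \<gamma> \<subseteq> N \<and> pathstart \<gamma> = x \<and> pathfinish \<gamma> = y}.
           curve_length X \<gamma>)) \<and>
     (\<forall>p\<in>N. \<exists>r \<phi>. hyperbolic_chart X p r \<phi>)"

definition complete_hyperbolic_metric_on :: "'a::topological_space set \<Rightarrow> 'a metric \<Rightarrow> bool" where
  "complete_hyperbolic_metric_on N X \<longleftrightarrow> hyperbolic_metric_on N X \<and> mcomplete_of X"

section \<open>Free homotopy classes and the fundamental group\<close>

definition free_class :: "'a::topological_space set \<Rightarrow> (real \<Rightarrow> 'a) \<Rightarrow> (real \<Rightarrow> 'a) set" where
  "free_class N \<gamma> = {\<delta>. homotopic_loops N \<gamma> \<delta>}"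

definition free_classes :: "'a::topological_space set \<Rightarrow> (real \<Rightarrow> 'a) set set" where
  "free_classes N =
     {free_class N \<gamma> | \<gamma>. path \<gamma> \<and> path_image \<gamma> \<subseteq> N \<and> pathfinish \<gamma> = pathstart \<gamma>}"

definition based_class :: "'a::topological_space set \<Rightarrow> (real \<Rightarrow> 'a) \<Rightarrow> (real \<Rightarrow> 'a) set" where
  "based_class N \<gamma> = {\<delta>. homotopic_paths N \<gamma> \<delta>}"

definition fundamental_group :: "'a::topological_space set \<Rightarrow> 'a \<Rightarrow> (real \<Rightarrow> 'a) set monoid" where
  "fundamental_group N p =
     \<lparr>carrier = {based_class N \<gamma> | \<gamma>. path \<gamma> \<and> path_image \<gamma> \<subseteq> N \<and> pathstart \<gamma> = p \<and> pathfinish \<gamma> = p},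
      mult = (\<lambda>A B. {\<delta>. \<exists>\<gamma>\<in>A. \<exists>\<eta>\<in>B. homotopic_paths N (\<gamma> +++ \<eta>) \<delta>}),
      one = based_class N (\<lambda>_. p)\<rparr>"

text \<open>The map \<open>g \<mapsto> |g|\<close> from a fundamental group to free homotopy classes.\<close>

definition unbased :: "'a::topological_space set \<Rightarrow> (real \<Rightarrow> 'a) set \<Rightarrow> (real \<Rightarrow> 'a) set" where
  "unbased N g = (\<Union>\<gamma>\<in>g. free_class N \<gamma>)"

lemma homotopic_paths_const:
  fixes g :: "real \<Rightarrow> 'a::topological_space"
  assumes "path g" "path_image g \<subseteq> S"
  shows "homotopic_paths S ((\<lambda>_. pathstart g) +++ g) g"
    and "homotopic_paths S (reversepath g +++ g) (\<lambda>_. pathfinish g)"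
proof -
  define i where "i = linepath (0::real) 1"
  have i: "path i" "path_image i \<subseteq> {0..1}" "pathstart i = 0" "pathfinish i = 1"
    by (auto simp: i_def closed_segment_eq_real_ivl)
  have gi: "g \<circ> i = g" "g \<circ> reversepath i = reversepath g"
    by (auto simp: i_def linepath_def reversepath_def fun_eq_iff)
  have gc: "g \<circ> linepath 0 0 = (\<lambda>_. pathstart g)" "g \<circ> linepath 1 1 = (\<lambda>_. pathfinish g)"
    by (auto simp: pathstart_def pathfinish_def linepath_refl fun_eq_iff)
  have image: "homotopic_paths S (g \<circ> h) (g \<circ> k)" if "homotopic_paths {0..1} h k" for h k
    using that assms
    by (intro homotopic_paths_continuous_image[of "{0..1}"]) (auto simp: path_def path_image_def)
  have "homotopic_paths {0..1} (linepath 0 0 +++ i) i"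
    using homotopic_paths_lid[OF i(1,2)] i(3) by simp
  from image[OF this] show "homotopic_paths S ((\<lambda>_. pathstart g) +++ g) g"
    by (simp add: path_compose_join gi gc)
  have "homotopic_paths {0..1} (reversepath i +++ i) (linepath 1 1)"
    using homotopic_paths_linv[OF i(1,2)] i(4) by simp
  from image[OF this] show "homotopic_paths S (reversepath g +++ g) (\<lambda>_. pathfinish g)"
    by (simp add: path_compose_join gi gc)
qed

lemma based_class_eq: "homotopic_paths N g h \<Longrightarrow> based_class N g = based_class N h"
  unfolding based_class_def using homotopic_paths_trans homotopic_paths_sym by blast

lemma fundamental_group_mult_based_class:
  assumes "path g" "path_image g \<subseteq> N" "path h" "path_image h \<subseteq> N" "pathfinish g = pathstart h"
  shows "based_class N g \<otimes>\<^bsub>fundamental_group N p\<^esub> based_class N h = based_class N (g +++ h)"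
proof -
  have "homotopic_paths N (g +++ h) d" if "homotopic_paths N g g'" "homotopic_paths N h h'"
    "homotopic_paths N (g' +++ h') d" for g' h' d
    using homotopic_paths_join [OF that(1,2) assms(5)] that(3) homotopic_paths_trans by blast
  then have "{d. \<exists>g'\<in>based_class N g. \<exists>h'\<in>based_class N h. homotopic_paths N (g' +++ h') d}
      \<subseteq> based_class N (g +++ h)"
    unfolding based_class_def by blast
  moreover have "g \<in> based_class N g" "h \<in> based_class N h"
    using assms by (simp_all add: based_class_def)
  then have "based_class N (g +++ h)
      \<subseteq> {d. \<exists>g'\<in>based_class N g. \<exists>h'\<in>based_class N h. homotopic_paths N (g' +++ h') d}"
    unfolding based_class_def[of N "g +++ h"] by blast
  ultimately have "{d. \<exists>g'\<in>based_class N g. \<exists>h'\<in>based_class N h. homotopic_paths N (g' +++ h') d}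
      = based_class N (g +++ h)"
    by (rule subset_antisym)
  then show ?thesis by (simp add: fundamental_group_def)
qed

lemma group_fundamental_group:
  assumes "p \<in> N"
  shows "group (fundamental_group N p)"
proof (rule groupI)
  let ?G = "fundamental_group N p"
  define L where "L = {g. path g \<and> path_image g \<subseteq> N \<and> pathstart g = p \<and> pathfinish g = p}"
  have L: "path g" "path_image g \<subseteq> N" "pathstart g = p" "pathfinish g = p" if "g \<in> L" for g
    using that by (auto simp: L_def)
  have car: "carrier ?G = based_class N ` L"
    by (auto simp: fundamental_group_def L_def)
  have one: "\<one>\<^bsub>?G\<^esub> = based_class N (\<lambda>_. p)"
    by (simp add: fundamental_group_def)
  have const: "(\<lambda>_. p) \<in> L"
    using assms by (auto simp: L_def path_def path_image_def pathstart_def pathfinish_def)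
  have join: "g +++ h \<in> L" if "g \<in> L" "h \<in> L" for g h
    using L[OF that(1)] L[OF that(2)] by (simp add: L_def subset_path_image_join)
  have rev: "reversepath g \<in> L" if "g \<in> L" for g
    using L[OF that] by (simp add: L_def)
  have mult: "based_class N g \<otimes>\<^bsub>?G\<^esub> based_class N h = based_class N (g +++ h)"
    if "g \<in> L" "h \<in> L" for g h
    using L[OF that(1)] L[OF that(2)] by (intro fundamental_group_mult_based_class) simp_all
  show "\<one>\<^bsub>?G\<^esub> \<in> carrier ?G"
    unfolding car one using const by (rule imageI)
  fix x assume "x \<in> carrier ?G"
  then obtain g where g: "x = based_class N g" "g \<in> L"
    unfolding car by (rule imageE)
  have "\<one>\<^bsub>?G\<^esub> \<otimes>\<^bsub>?G\<^esub> x = based_class N ((\<lambda>_. p) +++ g)"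
    using g const by (simp add: one mult)
  also have "\<dots> = x"
    using homotopic_paths_const(1)[OF L(1,2)[OF g(2)]] L(3)[OF g(2)] g(1)
    by (simp add: based_class_eq)
  finally show "\<one>\<^bsub>?G\<^esub> \<otimes>\<^bsub>?G\<^esub> x = x" .
  have "based_class N (reversepath g) \<otimes>\<^bsub>?G\<^esub> x = based_class N (reversepath g +++ g)"
    using g rev by (simp add: mult)
  also have "\<dots> = \<one>\<^bsub>?G\<^esub>"
    using homotopic_paths_const(2)[OF L(1,2)[OF g(2)]] L(4)[OF g(2)]
    by (simp add: one based_class_eq)
  finally show "\<exists>y\<in>carrier ?G. y \<otimes>\<^bsub>?G\<^esub> x = \<one>\<^bsub>?G\<^esub>"
    unfolding car by (rule bexI[OF _ imageI[OF rev[OF g(2)]]])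
  fix y assume "y \<in> carrier ?G"
  then obtain h where h: "y = based_class N h" "h \<in> L"
    unfolding car by (rule imageE)
  show "x \<otimes>\<^bsub>?G\<^esub> y \<in> carrier ?G"
    using mult[OF g(2) h(2)] join[OF g(2) h(2)] by (simp add: car g(1) h(1))
  fix z assume "z \<in> carrier ?G"
  then obtain k where k: "z = based_class N k" "k \<in> L"
    unfolding car by (rule imageE)
  have "homotopic_paths N (g +++ (h +++ k)) ((g +++ h) +++ k)"
    using L[OF g(2)] L[OF h(2)] L[OF k(2)] by (intro homotopic_paths_assoc) simp_all
  from based_class_eq[OF this] show "x \<otimes>\<^bsub>?G\<^esub> y \<otimes>\<^bsub>?G\<^esub> z = x \<otimes>\<^bsub>?G\<^esub> (y \<otimes>\<^bsub>?G\<^esub> z)"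
    using g h k join by (simp add: mult)
qed

lemma unbased_based_class:
  assumes "path g" "path_image g \<subseteq> N" "pathfinish g = pathstart g"
  shows "unbased N (based_class N g) = free_class N g"
proof -
  have "homotopic_loops N g h" if "homotopic_paths N g h" for h
    using that assms homotopic_paths_imp_homotopic_loops
      homotopic_paths_imp_pathfinish homotopic_paths_imp_pathstart by metis
  then have "free_class N h \<subseteq> free_class N g" if "h \<in> based_class N g" for h
    using that homotopic_loops_trans unfolding free_class_def based_class_def by blast
  moreover have "g \<in> based_class N g" using assms by (simp add: based_class_def)
  ultimately show ?thesis unfolding unbased_def by blast
qed

text \<open>
  The core of a punctured disc around a puncture, run through \<open>k \<noteq> 0\<close> times; the sign of \<open>k\<close> is the
  direction.
\<close>

definition puncture_loop :: "'a::t2_space set \<Rightarrow> 'a set \<Rightarrow> (real \<Rightarrow> 'a) \<Rightarrow> bool" where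
  "puncture_loop S F \<gamma> \<longleftrightarrow>
     (\<exists>p\<in>F. \<exists>U e e'. \<exists>k::int.
        openin (top_of_set S) U \<and> U \<inter> F = {p} \<and>
        homeomorphism (ball (0::complex) 1) U e e' \<and> e 0 = p \<and> k \<noteq> 0 \<and>
        homotopic_loops (S - F) \<gamma> (\<lambda>t. e (cis (2 * pi * of_int k * t) / 2)))"

definition trivial_loop :: "'a::topological_space set \<Rightarrow> (real \<Rightarrow> 'a) \<Rightarrow> bool" where
  "trivial_loop N \<gamma> \<longleftrightarrow> (\<exists>q. homotopic_loops N \<gamma> (\<lambda>_. q))"

definition puncture_class :: "'a::t2_space set \<Rightarrow> 'a set \<Rightarrow> (real \<Rightarrow> 'a) set \<Rightarrow> bool" where
  "puncture_class S F A \<longleftrightarrow> A \<in> free_classes (S - F) \<and> (\<exists>\<gamma>\<in>A. puncture_loop S F \<gamma>)"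

definition essential_class :: "'a::t2_space set \<Rightarrow> 'a set \<Rightarrow> (real \<Rightarrow> 'a) set \<Rightarrow> bool" where
  "essential_class S F A \<longleftrightarrow> A \<in> free_classes (S - F) \<and>
     (\<forall>\<gamma>\<in>A. \<not> puncture_loop S F \<gamma> \<and> \<not> trivial_loop (S - F) \<gamma>)"

section \<open>Closed geodesics and transverse intersections\<close>

text \<open>
  A closed geodesic is parametrised by \<open>\<real>\<close> at constant speed with period 1, one period being one
  traversal.  As homotopies of loops only involve the parameters in \<open>{0..1}\<close>, \<open>a \<in> A\<close> says that one
  traversal lies in the class \<open>A\<close>.
\<close>

definition closed_geodesic :: "'a metric \<Rightarrow> (real \<Rightarrow> 'a) \<Rightarrow> bool" where
  "closed_geodesic X a \<longleftrightarrow> range a \<subseteq> mspace X \<and> (\<forall>t. a (t + 1) = a t) \<and>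
     (\<exists>v>0. \<forall>t. \<exists>\<epsilon>>0. \<forall>s \<in> {t-\<epsilon><..<t+\<epsilon>}. \<forall>s' \<in> {t-\<epsilon><..<t+\<epsilon>}.
        mdist X (a s) (a s') = v * \<bar>s - s'\<bar>)"

definition geodesic_representative :: "'a metric \<Rightarrow> (real \<Rightarrow> 'a) set \<Rightarrow> (real \<Rightarrow> 'a) \<Rightarrow> bool" where
  "geodesic_representative X A a \<longleftrightarrow> closed_geodesic X a \<and> a \<in> A"

text \<open>
  The branch of \<open>a\<close> through parameter \<open>s\<close> crosses the branch of \<open>b\<close> through parameter \<open>t\<close>
  transversely: the tangent vectors, read in a hyperbolic chart, are linearly independent.
\<close>

definition transverse_at ::
    "'a metric \<Rightarrow> (real \<Rightarrow> 'a) \<Rightarrow> real \<Rightarrow> (real \<Rightarrow> 'a) \<Rightarrow> real \<Rightarrow> bool" where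
  "transverse_at X a s b t \<longleftrightarrow> a s = b t \<and>
     (\<exists>r \<phi> u v. hyperbolic_chart X (a s) r \<phi> \<and>
        ((\<lambda>x. \<phi> (a x)) has_vector_derivative u) (at s) \<and>
        ((\<lambda>x. \<phi> (b x)) has_vector_derivative v) (at t) \<and>
        u \<noteq> v \<and> independent {u, v})"

end

theory Submission
  imports Defs "HOL-Probability.Discrete_Topology"
begin

text \<open>Lift \<open>\<alpha>\<close> and \<open>\<beta>\<close> to deck transformations \<open>a\<close>, \<open>b\<close> of the upper half plane whose axes cross
  at a lift of \<open>P\<close>. If \<open>|\<alpha>\<^sub>P\<^sup>m \<beta>\<^sub>P|\<close> is a puncture loop, pushing it into the puncture gives an
  \<open>a\<^sup>m b\<close>-equivariant curve avoiding all lifts of the two geodesics, and a collar of the puncture shows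
  that \<open>a\<^sup>m b\<close> preserves orientation. If \<open>a\<^sup>m\<close> and \<open>b\<close> both preserved orientation, the equivariant curve
  would have to cross one of the two axes; hence both reverse it, and \<open>m\<close> is odd.

  Normalise so that \<open>a\<close> fixes \<open>0\<close> and \<open>\<infinity>\<close> with stretch factor \<open>\<lambda>\<close>. For odd \<open>m\<close> the fixed points of
  \<open>a\<^sup>m b\<close> are the roots of a quadratic polynomial with coefficients linear in \<open>\<kappa> = \<lambda>\<^sup>-\<^sup>m\<close>, and \<open>m\<close> is of
  one of two types according to the sign of \<open>\<kappa>|s| - |p|\<close>. The translates of the two axes under the
  powers of \<open>a\<^sup>m b\<close> form a chain joining its fixed points. For one type this chain would meet the
  equivariant curve of every larger puncture exponent, for the other that of every smaller one. So no
  odd integer lies strictly between two puncture exponents.\<close>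

section \<open>Isometries of the upper half plane\<close>

text \<open>The metric may have infinite area, so the deck transformation of a puncture can be
  hyperbolic (the puncture opens into a funnel) as well as parabolic. It is therefore never
  classified: a puncture exponent contributes only its orientation and the equivariant curve, which
  avoids the lifts because the two closed geodesics form a compact set disjoint from a small
  punctured disc. The chain, in contrast, is built for an arbitrary odd exponent. Deck
  transformations act freely, so the fixed points of such a product are real and its powers converge
  to one of them; hence the types apply to \<open>m + 2\<close> without its being a puncture
  exponent. The contradiction is one of signs. The quadratic form vanishing at the fixed points of
  the puncture element is positive on one axis and cannot change sign along a translate that the
  curve avoids. So it stays positive along the chain, yet it is negative at the limit point. The
  matrices of all odd exponents agree up to the factor \<kappa> in the lower row, and this last sign
  is that of a derivative in \<kappa>. Inversion in the unit circle exchanges the two types.\<close>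

definition UH :: "complex set" where
  "UH = {z. Im z > 0}"

lemma UH_iff: "z \<in> UH \<longleftrightarrow> Im z > 0"
  by (simp add: UH_def)

lemma open_UH: "open UH" and convex_UH: "convex UH"
  unfolding UH_def by (simp_all add: open_halfspace_Im_gt convex_halfspace_Im_gt)

definition mob :: "real \<Rightarrow> real \<Rightarrow> real \<Rightarrow> real \<Rightarrow> complex \<Rightarrow> complex" where
  "mob a b c d z = (of_real a * z + of_real b) / (of_real c * z + of_real d)"

text \<open>The reflection in the imaginary axis, the standard orientation-reversing
  isometry.\<close>

definition mirror :: "complex \<Rightarrow> complex" where
  "mirror z = - cnj z"

lemma Im_mirror [simp]: "Im (mirror z) = Im z" and Re_mirror [simp]: "Re (mirror z) = - Re z"
  and mirror_mirror [simp]: "mirror (mirror z) = z"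
  by (simp_all add: mirror_def)

lemma mirror_UH [simp]: "mirror z \<in> UH \<longleftrightarrow> z \<in> UH"
  by (simp add: UH_iff)

lemma mob_denom:
  assumes "a * d - b * c \<noteq> 0" "z \<in> UH"
  shows "of_real c * z + of_real d \<noteq> (0::complex)"
proof
  assume "of_real c * z + of_real d = (0::complex)"
  then have "c * Im z = 0" "c * Re z + d = 0"
    by (auto simp: complex_eq_iff)
  then show False using assms by (auto simp: UH_iff)
qed

lemma mob_diff:
  assumes "a * d - b * c \<noteq> 0" "z \<in> UH" "w \<in> UH"
  shows "mob a b c d z - mob a b c d w =
    of_real (a * d - b * c) * (z - w) / ((of_real c * z + of_real d) * (of_real c * w + of_real d))"
  using mob_denom[OF assms(1,2)] mob_denom[OF assms(1,3)]
  by (simp add: mob_def divide_simps) (simp add: algebra_simps)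

lemma Im_mob:
  assumes "a * d - b * c \<noteq> 0" "z \<in> UH"
  shows "Im (mob a b c d z) = (a * d - b * c) * Im z / (cmod (of_real c * z + of_real d))\<^sup>2"
  unfolding mob_def Im_divide cmod_power2 by (simp add: algebra_simps power2_eq_square)

lemma mob_UH:
  assumes "a * d - b * c > 0" "z \<in> UH"
  shows "mob a b c d z \<in> UH"
proof -
  have "Im (mob a b c d z) > 0"
    using Im_mob[of a d b c z] mob_denom[of a d b c z] assms
    by (simp add: UH_iff)
  then show ?thesis by (simp add: UH_iff)
qed

lemma mob_comp:
  assumes "a' * d' - b' * c' \<noteq> 0" "z \<in> UH"
  shows "mob a b c d (mob a' b' c' d' z) =
    mob (a * a' + b * c') (a * b' + b * d') (c * a' + d * c') (c * b' + d * d') z"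
proof -
  define D where "D = of_real c' * z + of_real d'"
  have D: "D \<noteq> 0" using mob_denom[OF assms] by (simp add: D_def)
  have m: "mob a' b' c' d' z = (of_real a' * z + of_real b') / D"
    by (simp add: mob_def D_def)
  have "mob a b c d (mob a' b' c' d' z) =
     (of_real a * (of_real a' * z + of_real b') + of_real b * D) /
     (of_real c * (of_real a' * z + of_real b') + of_real d * D)"
    unfolding m mob_def[of a] using D by (simp add: divide_simps)
  then show ?thesis by (simp add: mob_def D_def algebra_simps)
qed

lemma mirror_mob: "mirror (mob a b c d z) = mob a (- b) (- c) d (mirror z)"
proof -
  have "mirror (mob a b c d z) = - ((of_real a * cnj z + of_real b) / (of_real c * cnj z + of_real d))"
    by (simp add: mirror_def mob_def)
  also have "\<dots> = (- (of_real a * cnj z + of_real b)) / (of_real c * cnj z + of_real d)"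
    by (simp only: minus_divide_left)
  also have "\<dots> = mob a (- b) (- c) d (mirror z)"
    by (simp add: mob_def mirror_def)
  finally show ?thesis .
qed

text \<open>The orientation-preserving isometries. Membership constrains a map only on
  \<open>UH\<close>, so members are compared only there.\<close>

definition Isop :: "(complex \<Rightarrow> complex) set" where
  "Isop = {g. \<exists>a b c d. a * d - b * c = 1 \<and> (\<forall>z\<in>UH. g z = mob a b c d z)}"

definition Isom :: "(complex \<Rightarrow> complex) set" where
  "Isom = {g. g \<in> Isop \<or> (\<lambda>z. g (mirror z)) \<in> Isop}"

text \<open>Scaling the four coefficients leaves the map unchanged, so division by the root of the
  determinant normalises it; only positivity is left to check when a map is shown to lie in
  \<open>Isop\<close>.\<close>

lemma mob_normalise:
  assumes "a * d - b * c > 0" "\<And>z. z \<in> UH \<Longrightarrow> g z = mob a b c d z"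
  shows "g \<in> Isop"
proof -
  define t where "t = sqrt (a * d - b * c)"
  have t: "t > 0" "t * t = a * d - b * c" using assms by (auto simp: t_def)
  have "(a / t) * (d / t) - (b / t) * (c / t) = (a * d - b * c) / (t * t)"
    by (simp add: diff_divide_distrib)
  also have "\<dots> = 1" using t assms by simp
  finally have 1: "(a / t) * (d / t) - (b / t) * (c / t) = 1" .
  have "mob (a / t) (b / t) (c / t) (d / t) z = mob a b c d z" for z
  proof -
    have "mob (a / t) (b / t) (c / t) (d / t) z =
      ((of_real a * z + of_real b) / of_real t) / ((of_real c * z + of_real d) / of_real t)"
      by (simp add: mob_def add_divide_distrib)
    then show ?thesis using t by (simp add: mob_def)
  qed
  then show ?thesis using 1 assms(2) unfolding Isop_def mem_Collect_eq by metis
qed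

lemma IsopE:
  assumes "g \<in> Isop"
  obtains a b c d where "a * d - b * c = 1" "\<And>z. z \<in> UH \<Longrightarrow> g z = mob a b c d z"
  using assms unfolding Isop_def by blast

lemma Isop_UH: "g \<in> Isop \<Longrightarrow> z \<in> UH \<Longrightarrow> g z \<in> UH"
  by (elim IsopE) (simp add: mob_UH)

lemma Isop_comp:
  assumes "g \<in> Isop" "h \<in> Isop" shows "(\<lambda>z. g (h z)) \<in> Isop"
proof -
  obtain a b c d where g: "a * d - b * c = 1" "\<And>z. z \<in> UH \<Longrightarrow> g z = mob a b c d z"
    by (rule IsopE[OF assms(1)], rule that)
  obtain a' b' c' d' where h: "a' * d' - b' * c' = 1" "\<And>z. z \<in> UH \<Longrightarrow> h z = mob a' b' c' d' z"
    by (rule IsopE[OF assms(2)], rule that)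
  show ?thesis
  proof (rule mob_normalise)
    have "(a * a' + b * c') * (c * b' + d * d') - (a * b' + b * d') * (c * a' + d * c')
       = (a * d - b * c) * (a' * d' - b' * c')" by (simp add: algebra_simps)
    then show "(a * a' + b * c') * (c * b' + d * d') - (a * b' + b * d') * (c * a' + d * c') > 0"
      using g h by simp
    show "g (h z) = mob (a * a' + b * c') (a * b' + b * d') (c * a' + d * c') (c * b' + d * d') z"
      if "z \<in> UH" for z
      using that g h mob_UH[of a' d' b' c' z] mob_comp[of a' d' b' c' z a b c d] by simp
  qed
qed

lemma Isop_mirror: assumes "g \<in> Isop" shows "(\<lambda>z. mirror (g (mirror z))) \<in> Isop"
proof -
  obtain a b c d where g: "a * d - b * c = 1" "\<And>z. z \<in> UH \<Longrightarrow> g z = mob a b c d z"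
    by (rule IsopE[OF assms(1)], rule that)
  show ?thesis
    by (rule mob_normalise[of a d "-b" "-c"]) (use g in \<open>auto simp: mirror_mob\<close>)
qed

lemma Isop_cong: "g \<in> Isop \<Longrightarrow> (\<And>z. z \<in> UH \<Longrightarrow> h z = g z) \<Longrightarrow> h \<in> Isop"
  unfolding Isop_def by auto

lemma Isop_subset: "Isop \<subseteq> Isom"
  by (auto simp: Isom_def)

lemma id_Isop: "(\<lambda>z. z) \<in> Isop"
  by (rule mob_normalise[of 1 1 0 0]) (auto simp: mob_def)

lemma mirror_Isom: "mirror \<in> Isom"
  using id_Isop by (simp add: Isom_def)

lemma Isom_comp:
  assumes "g \<in> Isom" "h \<in> Isom" shows "(\<lambda>z. g (h z)) \<in> Isom"
proof -
  have r: "(\<lambda>z. mirror (h z)) \<in> Isop" if "(\<lambda>z. h (mirror z)) \<in> Isop"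
    using Isop_mirror[OF that] by simp
  have r': "(\<lambda>z. mirror (h (mirror z))) \<in> Isop" if "h \<in> Isop"
    using Isop_mirror[OF that] by simp
  consider "g \<in> Isop" "h \<in> Isop" | "g \<in> Isop" "(\<lambda>z. h (mirror z)) \<in> Isop"
    | "(\<lambda>z. g (mirror z)) \<in> Isop" "h \<in> Isop" | "(\<lambda>z. g (mirror z)) \<in> Isop" "(\<lambda>z. h (mirror z)) \<in> Isop"
    using assms by (auto simp: Isom_def)
  then show ?thesis
  proof cases
    case 1 then show ?thesis using Isop_comp by (auto simp: Isom_def)
  next
    case 2 then show ?thesis using Isop_comp[OF 2] by (auto simp: Isom_def)
  next
    case 3 then show ?thesis using Isop_comp[OF 3(1) r'[OF 3(2)]] by (auto simp: Isom_def)
  next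
    case 4 then show ?thesis using Isop_comp[OF 4(1) r[OF 4(2)]] by (auto simp: Isom_def)
  qed
qed

lemma Isom_cases:
  assumes "g \<in> Isom"
  obtains "g \<in> Isop" | h where "h \<in> Isop" "\<And>z. g z = h (mirror z)"
proof (cases "g \<in> Isop")
  case False
  then have "(\<lambda>z. g (mirror z)) \<in> Isop" using assms by (simp add: Isom_def)
  then show ?thesis using that(2) by force
qed (use that in blast)

lemma Isom_UH: "g \<in> Isom \<Longrightarrow> z \<in> UH \<Longrightarrow> g z \<in> UH"
  by (elim Isom_cases) (simp_all add: Isop_UH)

lemma Isop_inv:
  assumes "g \<in> Isop"
  obtains h where "h \<in> Isop" "\<And>z. z \<in> UH \<Longrightarrow> h (g z) = z" "\<And>z. z \<in> UH \<Longrightarrow> g (h z) = z"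
proof -
  obtain a b c d where g: "a * d - b * c = 1" "\<And>z. z \<in> UH \<Longrightarrow> g z = mob a b c d z"
    by (rule IsopE[OF assms(1)], rule that)
  define h where "h = mob d (-b) (-c) a"
  show ?thesis
  proof
    show "h \<in> Isop"
      by (rule mob_normalise[of d a "-b" "-c"]) (use g in \<open>auto simp: h_def mult.commute\<close>)
    have det: "d * a - b * c = 1" using g(1) by (simp add: mult.commute)
    have 1: "mob (d * a - b * c) 0 0 (a * d - b * c) z = z" for z
      using g(1) det by (simp add: mob_def)
    show "h (g z) = z" if "z \<in> UH" for z
      unfolding h_def g(2)[OF that] using mob_comp[of a d b c z d "-b" "-c" a] g(1) that 1[of z]
      by (simp add: mult.commute)
    show "g (h z) = z" if "z \<in> UH" for z
      using mob_UH[of d a "-b" "-c" z] mob_comp[of d a "-b" "-c" z a b c d] g that 1[of z]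
      by (simp add: h_def mult.commute)
  qed
qed

lemma Isom_inv:
  assumes "g \<in> Isom"
  obtains h where "h \<in> Isom" "\<And>z. z \<in> UH \<Longrightarrow> h (g z) = z" "\<And>z. z \<in> UH \<Longrightarrow> g (h z) = z"
  using assms
proof (cases rule: Isom_cases)
  case 1
  then show ?thesis using Isop_inv that Isop_subset by (metis subsetD)
next
  case (2 k)
  obtain l where l: "l \<in> Isop" "\<And>z. z \<in> UH \<Longrightarrow> l (k z) = z" "\<And>z. z \<in> UH \<Longrightarrow> k (l z) = z"
    by (rule Isop_inv[OF 2(1)], rule that)
  show ?thesis
  proof (rule that[of "\<lambda>z. mirror (l z)"])
    show "(\<lambda>z. mirror (l z)) \<in> Isom"
      using Isom_comp[OF mirror_Isom, of l] l Isop_subset by blast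
  qed (use l 2 in auto)
qed

text \<open>This is \<open>2 * (cosh d - 1)\<close> for the hyperbolic distance \<open>d\<close>.
  Being rational in the coordinates, it turns equality of distances into a polynomial
  identity.\<close>

definition hq :: "complex \<Rightarrow> complex \<Rightarrow> real" where
  "hq z w = (cmod (z - w))\<^sup>2 / (Im z * Im w)"

lemma hq_nonneg: "z \<in> UH \<Longrightarrow> w \<in> UH \<Longrightarrow> hq z w \<ge> 0"
  by (simp add: hq_def UH_iff)

lemma hq_eq_0_iff: "z \<in> UH \<Longrightarrow> w \<in> UH \<Longrightarrow> hq z w = 0 \<longleftrightarrow> z = w"
  by (auto simp: hq_def UH_iff)

lemma hyp_dist_hq: "hyp_dist z w = arcosh (1 + hq z w / 2)"
  by (simp add: hyp_dist_def hq_def dist_norm mult_ac)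

lemma hq_eq_iff:
  assumes "u \<in> UH" "z \<in> UH" "w \<in> UH"
  shows "hq u z = hq u w \<longleftrightarrow>
    ((Re u - Re z)\<^sup>2 + (Im u - Im z)\<^sup>2) * Im w = ((Re u - Re w)\<^sup>2 + (Im u - Im w)\<^sup>2) * Im z"
proof -
  have *: "A / (p * x) = B / (p * y) \<longleftrightarrow> A * y = B * x" if "p > 0" "x > 0" "y > 0" for A B p x y :: real
    using that by (simp add: frac_eq_eq)
  show ?thesis
    using assms unfolding hq_def cmod_power2 by (subst *) (auto simp: UH_iff)
qed

lemma cosh_hyp_dist:
  assumes "z \<in> UH" "w \<in> UH" shows "cosh (hyp_dist z w) = 1 + hq z w / 2"
  using hq_nonneg[OF assms] by (simp add: hyp_dist_hq)

lemma hyp_dist_nonneg: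
  assumes "z \<in> UH" "w \<in> UH" shows "hyp_dist z w \<ge> 0"
  using hq_nonneg[OF assms] by (simp add: hyp_dist_hq)

lemma hyp_dist_eq_iff:
  assumes "z \<in> UH" "w \<in> UH" "z' \<in> UH" "w' \<in> UH"
  shows "hyp_dist z w = hyp_dist z' w' \<longleftrightarrow> hq z w = hq z' w'"
proof
  assume "hyp_dist z w = hyp_dist z' w'"
  then have "1 + hq z w / 2 = 1 + hq z' w' / 2"
    using cosh_hyp_dist[OF assms(1,2)] cosh_hyp_dist[OF assms(3,4)] by simp
  then show "hq z w = hq z' w'" by simp
qed (simp add: hyp_dist_hq)

lemma hq_mob:
  assumes "a * d - b * c = 1" "z \<in> UH" "w \<in> UH"
  shows "hq (mob a b c d z) (mob a b c d w) = hq z w"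
proof -
  have n: "a * d - b * c \<noteq> 0" using assms by simp
  show ?thesis
    unfolding hq_def Im_mob[OF n assms(2)] Im_mob[OF n assms(3)] mob_diff[OF n assms(2,3)]
    using mob_denom[OF n assms(2)] mob_denom[OF n assms(3)] assms(1)
    by (simp add: norm_divide norm_mult power_divide power_mult_distrib)
qed

lemma hq_mirror: "hq (mirror z) (mirror w) = hq z w"
proof -
  have "mirror z - mirror w = - cnj (z - w)" by (simp add: mirror_def)
  then have "cmod (mirror z - mirror w) = cmod (z - w)" by (simp only: norm_minus_cancel complex_mod_cnj)
  then show ?thesis by (simp add: hq_def)
qed

lemma hq_Isop: "g \<in> Isop \<Longrightarrow> z \<in> UH \<Longrightarrow> w \<in> UH \<Longrightarrow> hq (g z) (g w) = hq z w"
  by (elim IsopE) (simp add: hq_mob)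

lemma hq_Isom: "g \<in> Isom \<Longrightarrow> z \<in> UH \<Longrightarrow> w \<in> UH \<Longrightarrow> hq (g z) (g w) = hq z w"
  by (elim Isom_cases) (simp_all add: hq_Isop hq_mirror)

lemma hyp_dist_Isom: "g \<in> Isom \<Longrightarrow> z \<in> UH \<Longrightarrow> w \<in> UH \<Longrightarrow> hyp_dist (g z) (g w) = hyp_dist z w"
  by (simp add: hyp_dist_eq_iff Isom_UH hq_Isom)

lemma continuous_on_Isom: assumes "g \<in> Isom" shows "continuous_on UH g"
proof -
  have *: "continuous_on UH h" if hI: "h \<in> Isop" for h
  proof -
    obtain a b c d where g: "a * d - b * c = 1" "\<And>z. z \<in> UH \<Longrightarrow> h z = mob a b c d z"
      by (rule IsopE[OF hI], rule that)
    have "continuous_on UH (mob a b c d)"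
      unfolding mob_def using mob_denom[of a d b c] g(1) by (intro continuous_intros) auto
    then show ?thesis using g(2) by (simp cong: continuous_on_cong)
  qed
  show ?thesis using assms
  proof (cases rule: Isom_cases)
    case (2 h)
    have "continuous_on UH (\<lambda>z. h (mirror z))"
      by (rule continuous_on_compose2[OF *[OF 2(1)]])
        (auto simp: mirror_def UH_iff intro!: continuous_intros)
    then show ?thesis using 2(2) by (simp cong: continuous_on_cong)
  qed (use * in blast)
qed

text \<open>With denominators cleared by \<open>hq_eq_iff\<close>, differences of the equations at
  points around \<open>u0\<close> isolate first the imaginary and then the real part.\<close>

lemma hq_determines:
  assumes "open D" "u0 \<in> D" "D \<subseteq> UH" "z \<in> UH" "w \<in> UH" "\<And>u. u \<in> D \<Longrightarrow> hq u z = hq u w"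
  shows "z = w"
proof -
  obtain e where e: "e > 0" "cball u0 e \<subseteq> D"
    using assms(1,2) open_contains_cball by blast
  define x y where "x = Re u0" and "y = Im u0"
  have eq: "((Re u - Re z)\<^sup>2 + (Im u - Im z)\<^sup>2) * Im w = ((Re u - Re w)\<^sup>2 + (Im u - Im w)\<^sup>2) * Im z"
    if "u \<in> D" for u
  proof -
    have "Im u > 0" "Im z > 0" "Im w > 0" using that assms by (auto simp: UH_iff)
    then show ?thesis using assms(6)[OF that] hq_eq_iff[of u z w] by (simp add: UH_iff)
  qed
  have 0: "u0 \<in> D" "u0 + of_real e \<in> D" "u0 - of_real e \<in> D" "u0 + \<i> * of_real e \<in> D"
     using e by (auto simp: subset_iff dist_norm norm_mult)
  have e0: "((x - Re z)\<^sup>2 + (y - Im z)\<^sup>2) * Im w = ((x - Re w)\<^sup>2 + (y - Im w)\<^sup>2) * Im z"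
    "((x + e - Re z)\<^sup>2 + (y - Im z)\<^sup>2) * Im w = ((x + e - Re w)\<^sup>2 + (y - Im w)\<^sup>2) * Im z"
    "((x - e - Re z)\<^sup>2 + (y - Im z)\<^sup>2) * Im w = ((x - e - Re w)\<^sup>2 + (y - Im w)\<^sup>2) * Im z"
    "((x - Re z)\<^sup>2 + (y + e - Im z)\<^sup>2) * Im w = ((x - Re w)\<^sup>2 + (y + e - Im w)\<^sup>2) * Im z"
    using eq[OF 0(1)] eq[OF 0(2)] eq[OF 0(3)] eq[OF 0(4)] by (simp_all add: x_def y_def)
  \<comment> \<open>The second difference in the horizontal direction: only the coefficient of the
    squared real part survives.\<close>
  have "2 * e\<^sup>2 * (Im w - Im z) =
    (((x + e - Re z)\<^sup>2 + (y - Im z)\<^sup>2) * Im w - ((x + e - Re w)\<^sup>2 + (y - Im w)\<^sup>2) * Im z)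
    + (((x - e - Re z)\<^sup>2 + (y - Im z)\<^sup>2) * Im w - ((x - e - Re w)\<^sup>2 + (y - Im w)\<^sup>2) * Im z)
    - 2 * (((x - Re z)\<^sup>2 + (y - Im z)\<^sup>2) * Im w - ((x - Re w)\<^sup>2 + (y - Im w)\<^sup>2) * Im z)"
    by (simp add: power2_eq_square algebra_simps)
  also have "\<dots> = 0" using e0(1-3) by simp
  finally have im: "Im z = Im w" using e(1) by simp
  have z: "Im w > 0" using assms by (simp add: UH_iff)
  from e0(1,2) im z have "(x + e - Re z)\<^sup>2 - (x - Re z)\<^sup>2 = (x + e - Re w)\<^sup>2 - (x - Re w)\<^sup>2" by simp
  then have "e * Re z = e * Re w" by (auto simp: power2_eq_square algebra_simps)
  then show ?thesis using im e(1) by (auto simp: complex_eq_iff)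
qed

lemma iy_UH [simp]: "\<i> * of_real (exp t) \<in> UH"
  by (simp add: UH_iff)

text \<open>Circles centred at two points of the imaginary axis are symmetric under
  \<open>mirror\<close>; if they share a point of the axis they touch there and have no other point
  in common.\<close>

lemma geodesic_point_unique:
  assumes "w \<in> UH" "a \<noteq> b"
    and "hq (\<i> * of_real (exp a)) w = hq (\<i> * of_real (exp a)) (\<i> * of_real (exp c))"
    and "hq (\<i> * of_real (exp b)) w = hq (\<i> * of_real (exp b)) (\<i> * of_real (exp c))"
  shows "w = \<i> * of_real (exp c)"
proof -
  define x y A B C where "x = Re w" "y = Im w" "A = exp a" "B = exp b" "C = exp c"
  have p: "y > 0" "A > 0" "B > 0" "C > 0" "A \<noteq> B"
    using assms by (auto simp: x_y_A_B_C_def UH_iff)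
  have 1: "(x\<^sup>2 + (A - y)\<^sup>2) * C = (A - C)\<^sup>2 * y" "(x\<^sup>2 + (B - y)\<^sup>2) * C = (B - C)\<^sup>2 * y"
    using assms(3,4) hq_eq_iff[OF iy_UH assms(1) iy_UH, of a c] hq_eq_iff[OF iy_UH assms(1) iy_UH, of b c]
    by (simp_all add: x_y_A_B_C_def)
  have "((x\<^sup>2 + (A - y)\<^sup>2) * C - (x\<^sup>2 + (B - y)\<^sup>2) * C) - ((A - C)\<^sup>2 * y - (B - C)\<^sup>2 * y)
      = (A - B) * (A + B) * (C - y)"
    by (simp add: power2_eq_square algebra_simps)
  then have "(A - B) * (A + B) * (C - y) = 0" using 1 by simp
  moreover have "A + B > 0" using p by linarith
  ultimately have y: "y = C" using p by auto
  then have "x = 0" using 1 p by (auto simp: power2_commute)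
  with y show ?thesis by (simp add: complex_eq_iff x_y_A_B_C_def)
qed

lemma hq_axis: "hq (\<i> * of_real (exp a)) (\<i> * of_real (exp b)) = 2 * (cosh (a - b) - 1)"
proof -
  have "cmod (\<i> * of_real (exp a) - \<i> * of_real (exp b)) = \<bar>exp a - exp b\<bar>"
  proof -
    have "\<i> * of_real (exp a) - \<i> * of_real (exp b) = \<i> * complex_of_real (exp a - exp b)"
      by (simp add: algebra_simps)
    then show ?thesis by (simp only: norm_mult norm_ii norm_of_real) simp
  qed
  then have "hq (\<i> * of_real (exp a)) (\<i> * of_real (exp b)) = (exp a - exp b)\<^sup>2 / (exp a * exp b)"
    by (simp add: hq_def)
  also have "\<dots> = exp a / exp b + exp b / exp a - 2"
    by (simp add: field_simps power2_eq_square)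
  also have "\<dots> = 2 * (cosh (a - b) - 1)"
    by (simp add: cosh_def exp_diff exp_minus field_simps)
  finally show ?thesis .
qed

lemma hyp_dist_axis: "hyp_dist (\<i> * of_real (exp a)) (\<i> * of_real (exp b)) = \<bar>a - b\<bar>"
proof -
  have "cosh (hyp_dist (\<i> * of_real (exp a)) (\<i> * of_real (exp b))) = cosh (a - b)"
    by (simp add: cosh_hyp_dist hq_axis field_simps)
  moreover have "hyp_dist (\<i> * of_real (exp a)) (\<i> * of_real (exp b)) \<ge> 0"
    by (simp add: hyp_dist_nonneg)
  moreover have "cosh (a - b) = cosh \<bar>a - b\<bar>" by simp
  ultimately show ?thesis
    by (metis abs_ge_zero cosh_real_nonneg_le_iff order_antisym order_refl)
qed

text \<open>A similarity takes \<open>z\<close> to \<open>\<i>\<close>, a rotation about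
  \<open>\<i>\<close> takes the image of \<open>w\<close> to the imaginary axis, and a half turn
  puts it above \<open>\<i>\<close> if needed. Its height follows from the invariance of the
  distance.\<close>

lemma Isop_to_axis:
  assumes "z \<in> UH" "w \<in> UH"
  obtains g where "g \<in> Isop" "g z = \<i>" "g w = \<i> * of_real (exp (hyp_dist z w))"
proof -
  define g1 where "g1 = mob 1 (- Re z) 0 (Im z)"
  have g1: "g1 \<in> Isop"
    by (rule mob_normalise[of 1 "Im z" "- Re z" 0]) (use assms in \<open>auto simp: g1_def UH_iff\<close>)
  have g1z: "g1 z = \<i>" using assms(1)
    by (simp add: g1_def mob_def UH_iff complex_eq_iff Re_divide Im_divide power2_eq_square)
  define w1 where "w1 = g1 w"
  have w1: "w1 \<in> UH" using g1 assms by (simp add: w1_def Isop_UH)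
  have "\<exists>g2\<in>Isop. g2 \<i> = \<i> \<and> Re (g2 w1) = 0"
  proof -
    \<comment> \<open>The numerator of the real part of \<open>w1\<close> after the rotation with
      parameter \<open>t\<close>. At \<open>pi / 2\<close>, the half turn about \<open>\<i>\<close>,
      it has changed sign, so it vanishes in between.\<close>
    define f where "f = (\<lambda>t. (1 - (cmod w1)\<^sup>2) * (sin t * cos t) + Re w1 * ((cos t)\<^sup>2 - (sin t)\<^sup>2))"
    have f: "f 0 = Re w1" "f (pi / 2) = - Re w1" by (simp_all add: f_def)
    have cf: "continuous_on UNIV f" unfolding f_def by (intro continuous_intros)
    have "\<exists>t. f t = 0"
    proof (cases "Re w1 \<ge> 0")
      case True
      then show ?thesis using IVT2'[of f "pi/2" 0 0] f cf continuous_on_subset by fastforce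
    next
      case False
      then show ?thesis using IVT'[of f 0 0 "pi/2"] f cf continuous_on_subset by fastforce
    qed
    then obtain t where t: "f t = 0" by blast
    define g2 where "g2 = mob (cos t) (sin t) (- sin t) (cos t)"
    have 1: "cos t * cos t - sin t * (- sin t) = 1" using sin_cos_squared_add3[of t] by simp
    have "g2 \<in> Isop" by (rule mob_normalise[of "cos t" "cos t" "sin t" "- sin t"]) (use 1 in \<open>auto simp: g2_def\<close>)
    moreover have "g2 \<i> = \<i>"
    proof -
      have "of_real (- sin t) * \<i> + of_real (cos t) \<noteq> (0::complex)"
        using mob_denom[OF _ , of "cos t" "cos t" "sin t" "- sin t" "\<i>"] 1 by (auto simp: UH_iff)
      then show ?thesis by (simp add: g2_def mob_def divide_simps) (simp add: algebra_simps)
    qed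
    moreover have "Re (g2 w1) = 0"
    proof -
      define x y where "x = Re w1" "y = Im w1"
      have "(cos t * x + sin t) * (cos t - sin t * x) - cos t * y * (sin t * y) = f t"
        unfolding f_def cmod_power2 by (simp add: x_y_def power2_eq_square algebra_simps)
      then have "(cos t * x + sin t) * (- sin t * x + cos t) + cos t * y * (- sin t * y) = 0"
        using t by simp
      then show ?thesis unfolding g2_def mob_def Re_divide by (simp add: x_y_def)
    qed
    ultimately show ?thesis by blast
  qed
  then obtain g2 where g2: "g2 \<in> Isop" "g2 \<i> = \<i>" "Re (g2 w1) = 0" by blast
  define s where "s = ln (Im (g2 w1))"
  have gw: "g2 w1 = \<i> * of_real (exp s)"
    using g2 Isop_UH[OF g2(1) w1] by (simp add: s_def UH_iff complex_eq_iff)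
  have "hyp_dist (g2 (g1 z)) (g2 (g1 w)) = hyp_dist z w"
    using g1 g2 assms hyp_dist_Isom[OF subsetD[OF Isop_subset Isop_comp[OF g2(1) g1]]] by simp
  then have s: "\<bar>s\<bar> = hyp_dist z w"
    using hyp_dist_axis[of 0 s] by (simp add: g1z g2 gw flip: w1_def)
  show ?thesis
  proof (cases "s \<ge> 0")
    case True
    show ?thesis
      by (rule that[OF Isop_comp[OF g2(1) g1]]) (use g1z g2 gw s True in \<open>simp_all flip: w1_def\<close>)
  next
    case False
    \<comment> \<open>The half turn about \<open>\<i>\<close>, for the case that the image lies
      below \<open>\<i>\<close>.\<close>
    define g3 where "g3 = mob 0 (-1) 1 0"
    have g3: "g3 \<in> Isop" by (rule mob_normalise[of 0 0 "-1" 1]) (auto simp: g3_def)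
    have "g3 \<i> = \<i>" "g3 (\<i> * of_real (exp s)) = \<i> * of_real (exp (- s))"
      by (simp_all add: g3_def mob_def exp_minus exp_of_real divide_simps flip: of_real_exp)
    then show ?thesis
      by (intro that[OF Isop_comp[OF g3 Isop_comp[OF g2(1) g1]]]) (use g1z g2 gw s False in \<open>simp_all flip: w1_def\<close>)
  qed
qed

lemma fix_axis_points:
  assumes "z \<in> UH" "w \<in> UH" "a \<noteq> b"
    and "hq (\<i> * of_real (exp a)) w = hq (\<i> * of_real (exp a)) z"
    and "hq (\<i> * of_real (exp b)) w = hq (\<i> * of_real (exp b)) z"
  shows "w = z \<or> w = mirror z"
proof -
  define A B where "A = exp a" "B = exp b"
  have p: "Im z > 0" "Im w > 0" "A > 0" "B > 0" "A \<noteq> B"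
    using assms by (auto simp: A_B_def UH_iff)
  have 1: "((Re w)\<^sup>2 + (A - Im w)\<^sup>2) * Im z = ((Re z)\<^sup>2 + (A - Im z)\<^sup>2) * Im w"
    "((Re w)\<^sup>2 + (B - Im w)\<^sup>2) * Im z = ((Re z)\<^sup>2 + (B - Im z)\<^sup>2) * Im w"
    using assms(4,5) hq_eq_iff[OF iy_UH assms(2,1), of a] hq_eq_iff[OF iy_UH assms(2,1), of b]
    by (simp_all add: A_B_def)
  have "(((Re w)\<^sup>2 + (A - Im w)\<^sup>2) * Im z - ((Re w)\<^sup>2 + (B - Im w)\<^sup>2) * Im z)
     - (((Re z)\<^sup>2 + (A - Im z)\<^sup>2) * Im w - ((Re z)\<^sup>2 + (B - Im z)\<^sup>2) * Im w)
      = (A - B) * (A + B) * (Im z - Im w)"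
    by (simp add: power2_eq_square algebra_simps)
  then have "(A - B) * (A + B) * (Im z - Im w) = 0" using 1 by simp
  moreover have "A + B > 0" using p by linarith
  ultimately have y: "Im w = Im z" using p by auto
  then have "(Re w)\<^sup>2 = (Re z)\<^sup>2" using 1(1) p by auto
  then have "Re w = Re z \<or> Re w = - Re z" by (simp add: power2_eq_iff)
  then show ?thesis using y by (auto simp: complex_eq_iff)
qed

text \<open>Carry two points of \<open>D\<close>, and likewise their images, to the axis. Every
  other point is then known up to \<open>mirror\<close> by \<open>fix_axis_points\<close>. That one
  choice serves all of \<open>D\<close> is decided by distances and not by continuity, so
  \<open>D\<close> need not be connected.\<close>

lemma isometry_extends:
  assumes D: "open D" "D \<noteq> {}" "D \<subseteq> UH" "f ` D \<subseteq> UH"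
    and f: "\<And>z w. z \<in> D \<Longrightarrow> w \<in> D \<Longrightarrow> hyp_dist (f z) (f w) = hyp_dist z w"
  obtains g where "g \<in> Isom" "\<And>z. z \<in> D \<Longrightarrow> f z = g z"
proof -
  obtain z0 where z0: "z0 \<in> D" using D by blast
  obtain e where e: "e > 0" "cball z0 e \<subseteq> D" using D z0 open_contains_cball by blast
  define z1 where "z1 = z0 + of_real e"
  have z1: "z1 \<in> D" "z1 \<noteq> z0" using e by (auto simp: z1_def subset_iff dist_norm)
  define l where "l = hyp_dist z0 z1"
  have U: "z0 \<in> UH" "z1 \<in> UH" "f z0 \<in> UH" "f z1 \<in> UH" using z0 z1 D by auto
  have l: "l \<noteq> 0"
  proof
    assume "l = 0"
    then have "hq z0 z1 = 0" using cosh_hyp_dist[of z0 z1] U by (simp add: l_def)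
    then show False using hq_eq_0_iff U z1 by metis
  qed
  obtain g where g: "g \<in> Isop" "g z0 = \<i>" "g z1 = \<i> * of_real (exp l)"
    using Isop_to_axis[OF U(1,2)] l_def by metis
  obtain k where k: "k \<in> Isop" "k (f z0) = \<i>" "k (f z1) = \<i> * of_real (exp l)"
    using Isop_to_axis[OF U(3,4)] f[OF z0 z1(1)] l_def by metis
  obtain ki where ki: "ki \<in> Isop" "\<And>z. z \<in> UH \<Longrightarrow> ki (k z) = z" "\<And>z. z \<in> UH \<Longrightarrow> k (ki z) = z"
    by (rule Isop_inv[OF k(1)], rule that)
  note sub = subsetD[OF Isop_subset]
  have hdf: "hq (k (f u)) (k (f v)) = hq (g u) (g v)" if "u \<in> D" "v \<in> D" for u v
  proof -
    have "hq (f u) (f v) = hq u v" using f[OF that] that D hyp_dist_eq_iff by (metis image_subset_iff subsetD)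
    moreover have "u \<in> UH" "v \<in> UH" "f u \<in> UH" "f v \<in> UH" using that D by (auto simp: image_subset_iff)
    ultimately show ?thesis using hq_Isop[OF k(1), of "f u" "f v"] hq_Isop[OF g(1), of u v] by simp
  qed
  have alt: "k (f u) = g u \<or> k (f u) = mirror (g u)" if "u \<in> D" for u
  proof (rule fix_axis_points[where a = 0 and b = l])
    show "g u \<in> UH" "k (f u) \<in> UH" using that D g k Isop_UH by (auto simp: image_subset_iff)
    show "hq (\<i> * of_real (exp 0)) (k (f u)) = hq (\<i> * of_real (exp 0)) (g u)"
      using hdf[OF z0 that] g k by simp
    show "hq (\<i> * of_real (exp l)) (k (f u)) = hq (\<i> * of_real (exp l)) (g u)"
      using hdf[OF z1(1) that] g k by simp
  qed (use l in auto)
  \<comment> \<open>If one point is kept and another is reflected, equality of distances forces one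
    of them onto the axis, where the two choices coincide.\<close>
  have incompat: "Re (g u) = 0 \<or> Re (g v) = 0"
    if uv: "u \<in> D" "v \<in> D" and "k (f u) = g u" "k (f v) = mirror (g v)" for u v
  proof -
    have UV: "Im (g u) > 0" "Im (g v) > 0" using uv D Isop_UH[OF g(1)] by (auto simp: UH_iff)
    have "hq (g u) (mirror (g v)) = hq (g u) (g v)" using hdf[OF uv] that by simp
    then have "(Re (g u) + Re (g v))\<^sup>2 = (Re (g u) - Re (g v))\<^sup>2"
      using UV by (simp add: hq_def cmod_power2)
    then have "4 * Re (g u) * Re (g v) = 0" by (simp add: power2_eq_square algebra_simps)
    then show ?thesis by simp
  qed
  consider "\<forall>u\<in>D. k (f u) = g u" | u where "u \<in> D" "k (f u) \<noteq> g u" by blast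
  then show ?thesis
  proof cases
    case 1
    show ?thesis
    proof (rule that[OF Isom_comp[OF sub[OF ki(1)] sub[OF g(1)]]])
      show "f z = ki (g z)" if "z \<in> D" for z using 1 ki(2)[of "f z"] D that by (auto simp: image_subset_iff)
    qed
  next
    case (2 u)
    then have u: "k (f u) = mirror (g u)" using alt by blast
    then have ru: "Re (g u) \<noteq> 0" using 2 by (auto simp: complex_eq_iff)
    have "k (f v) = mirror (g v)" if "v \<in> D" for v
    proof (rule ccontr)
      assume n: "k (f v) \<noteq> mirror (g v)"
      then have "k (f v) = g v" using alt that by blast
      then have "Re (g v) = 0" using incompat[OF that 2(1) _ u] ru by blast
      then have "mirror (g v) = g v" by (simp add: complex_eq_iff)
      then show False using n alt[OF that] by auto
    qed
    then show ?thesis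
      using ki(2) D by (intro that[OF Isom_comp[OF sub[OF ki(1)] Isom_comp[OF mirror_Isom sub[OF g(1)]]]])
        (metis image_subset_iff)
  qed
qed

text \<open>An isometry that fixes an open set pointwise preserves all distances to it, so
  \<open>hq_determines\<close> makes it fix every point; this is applied to \<open>g\<close>
  followed by an inverse of \<open>h\<close>.\<close>

lemma Isom_eq:
  assumes "g \<in> Isom" "h \<in> Isom" "open D" "D \<noteq> {}" "D \<subseteq> UH" "\<And>z. z \<in> D \<Longrightarrow> g z = h z" "z \<in> UH"
  shows "g z = h z"
proof -
  obtain h' where h': "h' \<in> Isom" "\<And>z. z \<in> UH \<Longrightarrow> h' (h z) = z" "\<And>z. z \<in> UH \<Longrightarrow> h (h' z) = z"
    by (rule Isom_inv[OF assms(2)], rule that)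
  obtain u0 where u0: "u0 \<in> D" using assms by blast
  have "h' (g z) = z"
  proof (rule hq_determines[OF assms(3) u0 assms(5)])
    show "h' (g z) \<in> UH" "z \<in> UH" using assms h' Isom_UH by auto
    fix u assume u: "u \<in> D"
    then have "h' (g u) = u" using assms h' by auto
    then show "hq u (h' (g z)) = hq u z"
      using hq_Isom[OF Isom_comp[OF h'(1) assms(1)], of u z] u assms by auto
  qed
  then show ?thesis using h'(3) Isom_UH assms by metis
qed

text \<open>Serves to identify the deck transformation of a closed geodesic up to a reflection in
  its axis.\<close>

lemma Isom_fix_axis:
  assumes "g \<in> Isom" "a \<noteq> b" "g (\<i> * of_real (exp a)) = \<i> * of_real (exp a)"
    "g (\<i> * of_real (exp b)) = \<i> * of_real (exp b)"
  shows "(\<forall>z\<in>UH. g z = z) \<or> (\<forall>z\<in>UH. g z = mirror z)"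
proof -
  have alt: "g z = z \<or> g z = mirror z" if "z \<in> UH" for z
    by (rule fix_axis_points[OF that _ assms(2)])
       (use that assms Isom_UH hq_Isom[OF assms(1) iy_UH that] in metis)+
  define D where "D = UH \<inter> {z. Re z > 0}"
  have D: "open D" "D \<noteq> {}" "D \<subseteq> UH"
  proof -
    show "open D" unfolding D_def by (intro open_Int open_UH open_halfspace_Re_gt)
    have "Complex 1 1 \<in> D" by (simp add: D_def UH_iff)
    then show "D \<noteq> {}" by blast
  qed (auto simp: D_def)
  have "(\<forall>z\<in>D. g z = z) \<or> (\<forall>z\<in>D. g z = mirror z)"
  proof (rule ccontr)
    assume "\<not> ?thesis"
    then obtain u v where uv: "u \<in> D" "v \<in> D" "g u \<noteq> u" "g v \<noteq> mirror v" by blast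
    then have 1: "g u = mirror u" "g v = v" using alt D by blast+
    have "hq (mirror u) v = hq u v" using hq_Isom[OF assms(1), of u v] uv D 1 by auto
    then have "(- Re u - Re v)\<^sup>2 = (Re u - Re v)\<^sup>2"
      using uv by (simp add: hq_def cmod_power2 D_def UH_iff)
    then have "Re u * Re v = 0" by (simp add: power2_eq_square algebra_simps)
    then show False using uv by (simp add: D_def)
  qed
  then show ?thesis
    using Isom_eq[OF assms(1) subsetD[OF Isop_subset id_Isop] D] Isom_eq[OF assms(1) mirror_Isom D]
    by blast
qed

section \<open>Fixed points of real fractional linear maps and crossing axes\<close>

lemma Isop_funpow: "g \<in> Isop \<Longrightarrow> (g ^^ n) \<in> Isop"
proof (induction n)
  case 0 then show ?case using id_Isop by (simp add: id_def)
next
  case (Suc n) then show ?case using Isop_comp[of g "g ^^ n"] by (simp add: comp_def)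
qed

text \<open>The real zeros of this form are the fixed points of \<open>mob p q r s\<close>; when there are two, its zero
  set is the axis.\<close>

definition fixform :: "real \<Rightarrow> real \<Rightarrow> real \<Rightarrow> real \<Rightarrow> complex \<Rightarrow> real" where
  "fixform p q r s z = r * (cmod z)\<^sup>2 + (s - p) * Re z - q"

lemma mob_sub_fixed:
  assumes "p * s - q * r \<noteq> 0" "r * x\<^sup>2 + (s - p) * x - q = 0" "z \<in> UH"
  shows "mob p q r s z - of_real x = of_real (p - r * x) * (z - of_real x) / (of_real r * z + of_real s)"
proof -
  have "of_real q = of_real r * (of_real x)\<^sup>2 + (of_real s - of_real p) * (of_real x :: complex)"
    using arg_cong[OF assms(2), of complex_of_real] by simp
  then show ?thesis
    using mob_denom[OF assms(1,3)]
    by (simp add: mob_def divide_simps) (simp add: algebra_simps power2_eq_square)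
qed

text \<open>\<open>r * x + s\<close> is the eigenvalue of the eigenvector \<open>(x, 1)\<close> and
  \<open>p - r * x\<close> is the other eigenvalue, since their sum is the trace; the product is the
  determinant.\<close>

lemma fixed_point_eigenvalue:
  fixes p q r s x :: real
  assumes "r * x\<^sup>2 + (s - p) * x - q = 0"
  shows "(p - r * x) * (r * x + s) = p * s - q * r"
proof -
  have "(p - r * x) * (r * x + s) - (p * s - q * r) = - r * (r * x\<^sup>2 + (s - p) * x - q)"
    by (simp add: algebra_simps power2_eq_square)
  then show ?thesis using assms by simp
qed

lemma UH_ne_real: "z \<in> UH \<Longrightarrow> z - of_real x \<noteq> 0"
  by (auto simp: UH_iff)

text \<open>In the coordinate that sends the fixed points to 0 and infinity, the map is
  multiplication by the ratio of the eigenvalues.\<close>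

lemma mob_ratio:
  assumes d: "p * s - q * r > 0" and x: "r * x\<^sup>2 + (s - p) * x - q = 0"
    and y: "r * y\<^sup>2 + (s - p) * y - q = 0" and z: "z \<in> UH"
  shows "(mob p q r s z - of_real x) / (mob p q r s z - of_real y) =
    of_real ((r * y + s) / (r * x + s)) * ((z - of_real x) / (z - of_real y))"
proof -
  have d0: "p * s - q * r \<noteq> 0" using d by simp
  have ex: "p - r * x = (p * s - q * r) / (r * x + s)" "r * x + s \<noteq> 0"
    and ey: "p - r * y = (p * s - q * r) / (r * y + s)" "r * y + s \<noteq> 0"
    using fixed_point_eigenvalue[OF x] fixed_point_eigenvalue[OF y] d0 by (auto simp: eq_divide_eq)
  have "(mob p q r s z - of_real x) / (mob p q r s z - of_real y) =
    of_real (p - r * x) / of_real (p - r * y) * ((z - of_real x) / (z - of_real y))"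
    unfolding mob_sub_fixed[OF d0 x z] mob_sub_fixed[OF d0 y z]
    using mob_denom[OF d0 z] by simp
  also have "of_real (p - r * x) / of_real (p - r * y) = (of_real ((p - r * x) / (p - r * y)) :: complex)"
    by simp
  also have "(p - r * x) / (p - r * y) = (r * y + s) / (r * x + s)"
    unfolding ex(1) ey(1) using d0 by simp
  finally show ?thesis .
qed

lemma ratio_tendsto:
  fixes u :: "nat \<Rightarrow> complex"
  assumes "0 < \<nu>" "\<nu> < 1" "x \<noteq> y" "\<And>n. u n \<in> UH"
    and "\<And>n. (u (Suc n) - of_real x) / (u (Suc n) - of_real y) = of_real \<nu> * ((u n - of_real x) / (u n - of_real y))"
  shows "u \<longlonglongrightarrow> of_real x"
proof -
  define w where "w n = (u n - of_real x) / (u n - of_real y)" for n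
  have Sw: "w (Suc n) = of_real \<nu> * w n" for n
    unfolding w_def by (rule assms(5))
  have w: "w n = of_real (\<nu> ^ n) * w 0" for n
    by (induction n) (simp_all add: Sw mult.assoc)
  have u: "u n = (of_real x - of_real y * w n) / (1 - w n)" for n
  proof -
    have ne: "u n - of_real y \<noteq> 0" using UH_ne_real assms(4) by blast
    have "1 - w n = of_real (x - y) / (u n - of_real y)"
      using ne by (simp add: w_def field_simps)
    moreover have "of_real x - of_real y * w n = of_real (x - y) * u n / (u n - of_real y)"
      using ne by (simp add: w_def field_simps)
    ultimately show ?thesis using ne assms(3) by simp
  qed
  have "(\<lambda>n. \<nu> ^ n) \<longlonglongrightarrow> 0" using assms by (intro LIMSEQ_realpow_zero) auto
  then have "(\<lambda>n. of_real (\<nu> ^ n) * w 0) \<longlonglongrightarrow> of_real 0 * w 0"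
    by (intro tendsto_mult tendsto_of_real tendsto_const)
  then have "w \<longlonglongrightarrow> of_real 0 * w 0" by (simp only: w[symmetric])
  then have "w \<longlonglongrightarrow> 0" by simp
  then have "(\<lambda>n. (of_real x - of_real y * w n) / (1 - w n)) \<longlonglongrightarrow> (of_real x - of_real y * 0) / (1 - 0)"
    by (intro tendsto_intros) auto
  then show ?thesis by (simp flip: u)
qed

text \<open>The roots are labelled so that \<open>x\<close> attracts: the multiplier from
  \<open>mob_ratio\<close> is below 1 unless the roots coincide. It is positive because the two
  eigenvalues have the positive determinant as product.\<close>

lemma real_fixed_points:
  fixes p q r s :: real
  assumes r: "r \<noteq> 0" and D: "(p - s)\<^sup>2 + 4 * q * r \<ge> 0" and d: "p * s - q * r > 0"
  obtains x y where "r * x\<^sup>2 + (s - p) * x - q = 0" "r * y\<^sup>2 + (s - p) * y - q = 0"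
    "(r * x + s) * (r * y + s) = p * s - q * r" "r * (x * y) = - q"
    "0 < (r * y + s) / (r * x + s)" "x \<noteq> y \<Longrightarrow> (r * y + s) / (r * x + s) < 1"
proof -
  define D where "D = (p - s)\<^sup>2 + 4 * q * r"
  define u v where "u = (p - s + sqrt D) / (2 * r)" and "v = (p - s - sqrt D) / (2 * r)"
  have D0: "D \<ge> 0" using D by (simp add: D_def)
  have e: "2 * r * u = p - s + sqrt D" "2 * r * v = p - s - sqrt D"
    using r by (auto simp: u_def v_def)
  have root: "r * x\<^sup>2 + (s - p) * x - q = 0" if "(2 * r * x - (p - s))\<^sup>2 = D" for x
  proof -
    have "4 * r * (r * x\<^sup>2 + (s - p) * x - q) = (2 * r * x - (p - s))\<^sup>2 - D"
      by (simp add: D_def power2_eq_square algebra_simps)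
    then show ?thesis using that r by simp
  qed
  have u: "r * u\<^sup>2 + (s - p) * u - q = 0" and v: "r * v\<^sup>2 + (s - p) * v - q = 0"
    using e D0 by (intro root; simp)+
  have "4 * r * (r * (u * v)) = (2 * r * u) * (2 * r * v)" by (simp add: algebra_simps)
  also have "\<dots> = (p - s)\<^sup>2 - D" unfolding e using D0 by (simp add: algebra_simps power2_eq_square)
  also have "\<dots> = 4 * r * (- q)" by (simp add: D_def)
  finally have uv: "r * (u * v) = - q" by (rule mult_left_cancel[THEN iffD1, rotated]) (use r in simp)
  have uv': "r * (u + v) = p - s" using e by (simp add: algebra_simps)
  have "(r * u + s) * (r * v + s) = r * (r * (u * v)) + s * (r * (u + v)) + s * s"
    by (simp add: algebra_simps)
  also have "\<dots> = p * s - q * r"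
    unfolding uv uv' by (simp add: algebra_simps)
  finally have t: "(r * u + s) * (r * v + s) = p * s - q * r" .
  then have "0 < (r * u + s) * (r * v + s)" using d by simp
  then have pos: "0 < (r * v + s) / (r * u + s)" "0 < (r * u + s) / (r * v + s)"
    unfolding zero_less_divide_iff zero_less_mult_iff by blast+
  show ?thesis
  proof (cases "(r * v + s) / (r * u + s) < 1 \<or> u = v")
    case True
    then show ?thesis using that[OF u v t uv pos(1)] by blast
  next
    case False
    have "r * u + s \<noteq> r * v + s" using False r by simp
    then have "(r * v + s) / (r * u + s) \<noteq> 1" using pos(1) by auto
    then have gt: "(r * v + s) / (r * u + s) > 1" using False by linarith
    have "(r * u + s) / (r * v + s) = 1 / ((r * v + s) / (r * u + s))" by simp
    then have "(r * u + s) / (r * v + s) < 1" using gt pos(1) by (simp only: divide_less_eq_1) auto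
    then show ?thesis using that[OF v u _ _ pos(2)] t uv by (simp add: mult.commute)
  qed
qed

text \<open>\<open>q * r > 0\<close> makes the product \<open>- q / r\<close> of the real fixed
  points negative, so they lie on opposite sides of the imaginary axis; the orbit tends to one of
  them forwards and to the other backwards.\<close>

lemma orbit_crosses_axis:
  fixes z :: "int \<Rightarrow> complex"
  assumes d: "p * s - q * r > 0" and qr: "q * r > 0"
    and z: "\<And>n. z n \<in> UH" "\<And>n. z (n + 1) = mob p q r s (z n)"
  shows "\<not> (\<forall>n. Re (z n) > 0)" "\<not> (\<forall>n. Re (z n) < 0)"
proof -
  have r: "r \<noteq> 0" using qr by auto
  have D: "(p - s)\<^sup>2 + 4 * q * r \<ge> 0" using qr by (simp add: mult.assoc)
  obtain x y where x: "r * x\<^sup>2 + (s - p) * x - q = 0" and y: "r * y\<^sup>2 + (s - p) * y - q = 0"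
    and prod: "r * (x * y) = - q" and nu: "0 < (r * y + s) / (r * x + s)" "x \<noteq> y \<Longrightarrow> (r * y + s) / (r * x + s) < 1"
    by (rule real_fixed_points[OF r D d], rule that)
  have "r * r * (x * y) < 0" using prod qr by (simp add: mult.commute mult.left_commute)
  then have xy: "x * y < 0" using r by (simp add: mult_less_0_iff)
  then have ne: "x \<noteq> y" by (auto simp: mult_less_0_iff)
  define \<nu> where "\<nu> = (r * y + s) / (r * x + s)"
  have nu': "0 < \<nu>" "\<nu> < 1" using nu ne by (auto simp: \<nu>_def)
  have R: "(z (n + 1) - of_real x) / (z (n + 1) - of_real y) = of_real \<nu> * ((z n - of_real x) / (z n - of_real y))" for n
    unfolding z(2) \<nu>_def by (rule mob_ratio[OF d x y z(1)])
  have lx: "(\<lambda>n. z (int n)) \<longlonglongrightarrow> of_real x"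
    by (rule ratio_tendsto[OF nu' ne]) (use z(1) R[of "int _"] in \<open>simp_all only: of_nat_Suc add.commute[of 1]\<close>)
  \<comment> \<open>Read backwards, the recursion contracts the reciprocal ratio, so the two fixed
    points exchange roles.\<close>
  have ly: "(\<lambda>n. z (- int n)) \<longlonglongrightarrow> of_real y"
  proof (rule ratio_tendsto[OF nu' ne[symmetric]])
    fix n
    have "(z (- int n) - of_real x) / (z (- int n) - of_real y) =
      of_real \<nu> * ((z (- int (Suc n)) - of_real x) / (z (- int (Suc n)) - of_real y))"
      using R[of "- int (Suc n)"] by simp
    then show "(z (- int (Suc n)) - of_real y) / (z (- int (Suc n)) - of_real x) =
      of_real \<nu> * ((z (- int n) - of_real y) / (z (- int n) - of_real x))"
      using nu'(1) UH_ne_real[OF z(1)] by (simp add: divide_simps mult_ac)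
  qed (rule z(1))
  have L: "(\<lambda>n. Re (z (int n))) \<longlonglongrightarrow> x" "(\<lambda>n. Re (z (- int n))) \<longlonglongrightarrow> y"
    using tendsto_Re[OF lx] tendsto_Re[OF ly] by auto
  show "\<not> (\<forall>n. Re (z n) > 0)"
  proof
    assume "\<forall>n. Re (z n) > 0"
    then have "x \<ge> 0" "y \<ge> 0" using LIMSEQ_le_const[OF L(1), of 0] LIMSEQ_le_const[OF L(2), of 0] less_imp_le by blast+
    then show False using xy by (simp add: mult_less_0_iff)
  qed
  show "\<not> (\<forall>n. Re (z n) < 0)"
  proof
    assume "\<forall>n. Re (z n) < 0"
    then have "x \<le> 0" "y \<le> 0" using LIMSEQ_le_const2[OF L(1), of 0] LIMSEQ_le_const2[OF L(2), of 0] less_imp_le by blast+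
    then show False using xy by (simp add: mult_less_0_iff)
  qed
qed

text \<open>If the form changed sign along the image of the imaginary axis under \<open>h\<close>,
  this geodesic would separate the two fixed points. In the coordinate given by \<open>h\<close>
  that is the situation of \<open>orbit_crosses_axis\<close>, and the connected equivariant curve
  would have to cross the geodesic.\<close>

lemma fixform_along:
  assumes d: "p * s - q * r > 0" and h: "h \<in> Isop"
    and \<delta>: "continuous_on UNIV \<delta>" "\<And>x::real. \<delta> x \<in> UH" "\<And>x. \<delta> (x + 1) = mob p q r s (\<delta> x)"
    and avoid: "\<And>x y. y > 0 \<Longrightarrow> \<delta> x \<noteq> h (\<i> * of_real y)"
    and y1: "y1 > 0" "fixform p q r s (h (\<i> * of_real y1)) > 0" and y2: "y2 > 0"
  shows "fixform p q r s (h (\<i> * of_real y2)) > 0"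
proof (rule ccontr)
  assume neg: "\<not> ?thesis"
  obtain a b c e where abce: "a * e - b * c = 1" "\<And>z. z \<in> UH \<Longrightarrow> h z = mob a b c e z"
    by (rule IsopE[OF h], rule that)
  define h' where "h' = mob e (-b) (-c) a"
  \<comment> \<open>The entries of the matrix of \<open>mob p q r s\<close> conjugated by
    \<open>h\<close>.\<close>
  define p' q' r' s' where "p' = e * (p * a + q * c) - b * (r * a + s * c)"
    and "q' = e * (p * b + q * e) - b * (r * b + s * e)"
    and "r' = - c * (p * a + q * c) + a * (r * a + s * c)"
    and "s' = - c * (p * b + q * e) + a * (r * b + s * e)"
  have abce0: "a * e - b * c \<noteq> 0" using abce by simp
  have eabc: "e * a - (- b) * (- c) = 1" using abce by (simp add: mult.commute)
  have d': "p' * s' - q' * r' > 0"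
  proof -
    have "p' * s' - q' * r' = (a * e - b * c) * (a * e - b * c) * (p * s - q * r)"
      by (simp add: p'_def q'_def r'_def s'_def algebra_simps)
    then show ?thesis using abce d by simp
  qed
  \<comment> \<open>Under the coordinate change the form is multiplied by the squared modulus of the
    denominator of \<open>h\<close>, which at \<open>\<i> * of_real y\<close> is this sum of
    squares.\<close>
  have F: "fixform p q r s (h (\<i> * of_real y)) * ((c * y)\<^sup>2 + e\<^sup>2) = r' * y\<^sup>2 - q'" if y: "y > 0" for y
  proof -
    define N where "N = (c * y)\<^sup>2 + e\<^sup>2"
    have "N \<noteq> 0" using abce y by (auto simp: N_def sum_power2_eq_zero_iff)
    have iy: "\<i> * of_real y \<in> UH" using y by (simp add: UH_iff)
    have hm: "h (\<i> * of_real y) = mob a b c e (\<i> * of_real y)" by (rule abce(2)[OF iy])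
    have "Re (h (\<i> * of_real y)) = (a * c * y\<^sup>2 + b * e) / N"
      unfolding hm mob_def Re_divide by (simp add: N_def power2_eq_square algebra_simps)
    then have Re: "Re (h (\<i> * of_real y)) * N = a * c * y\<^sup>2 + b * e" using \<open>N \<noteq> 0\<close> by simp
    have "(cmod (h (\<i> * of_real y)))\<^sup>2 = ((a * y)\<^sup>2 + b\<^sup>2) / N"
      unfolding hm mob_def norm_divide power_divide cmod_power2
      by (simp add: N_def add.commute)
    then have cm: "(cmod (h (\<i> * of_real y)))\<^sup>2 * N = (a * y)\<^sup>2 + b\<^sup>2" using \<open>N \<noteq> 0\<close> by simp
    have "fixform p q r s (h (\<i> * of_real y)) * N =
        r * ((cmod (h (\<i> * of_real y)))\<^sup>2 * N) + (s - p) * (Re (h (\<i> * of_real y)) * N) - q * N"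
      unfolding fixform_def by (simp add: algebra_simps)
    also have "\<dots> = r * ((a * y)\<^sup>2 + b\<^sup>2) + (s - p) * (a * c * y\<^sup>2 + b * e) - q * N"
      unfolding Re cm ..
    also have "\<dots> = r' * y\<^sup>2 - q'"
      by (simp add: N_def r'_def q'_def power2_eq_square algebra_simps)
    finally show ?thesis by (simp add: N_def)
  qed
  have N: "(c * y)\<^sup>2 + e\<^sup>2 > 0" if "y > 0" for y
    using abce that by (auto simp: sum_power2_gt_zero_iff)
  have A: "q' < r' * y1\<^sup>2" using mult_pos_pos[OF y1(2) N[OF y1(1)]] F[OF y1(1)] by simp
  have B: "r' * y2\<^sup>2 \<le> q'"
    using mult_nonpos_nonneg[of "fixform p q r s (h (\<i> * of_real y2))" "(c * y2)\<^sup>2 + e\<^sup>2"] F[OF y2] N[OF y2] neg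
    by simp
  \<comment> \<open>\<open>r' * y^2 - q'\<close> changes sign for positive \<open>y\<close>, so its
    root \<open>q' / r'\<close> in \<open>y^2\<close> is positive.\<close>
  have "q' * r' > 0"
  proof (cases "r' > 0")
    case True
    then have "0 < r' * y2\<^sup>2" using y2 by simp
    then show ?thesis using B True by simp
  next
    case False
    then have "r' * y1\<^sup>2 \<le> 0" by (simp add: mult_nonpos_nonneg)
    then have "q' < 0" using A by linarith
    moreover have "r' \<noteq> 0" using A B by auto
    ultimately show ?thesis using False by (simp add: mult_neg_neg)
  qed
  have h'UH: "h' z \<in> UH" if "z \<in> UH" for z
    using that mob_UH[of e a "-b" "-c" z] eabc by (simp add: h'_def)
  have hh': "h (h' z) = z" if "z \<in> UH" for z
    using mob_comp[of e a "-b" "-c" z a b c e] eabc abce that h'UH[OF that]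
    by (simp add: h'_def mob_def mult.commute)
  have conj: "h' (mob p q r s z) = mob p' q' r' s' (h' z)" if zU: "z \<in> UH" for z
  proof -
    define w where "w = h' z"
    have w: "w \<in> UH" "z = mob a b c e w" using zU h'UH hh' abce by (auto simp: w_def)
    have "mob p q r s z = mob (p * a + q * c) (p * b + q * e) (r * a + s * c) (r * b + s * e) w"
      unfolding w(2) by (rule mob_comp[OF abce0 w(1)])
    also have "h' \<dots> = mob p' q' r' s' w"
      unfolding h'_def
    proof (subst mob_comp[OF _ w(1)])
      have "(p * a + q * c) * (r * b + s * e) - (p * b + q * e) * (r * a + s * c) = (p * s - q * r) * (a * e - b * c)"
        by (simp add: algebra_simps)
      then show "(p * a + q * c) * (r * b + s * e) - (p * b + q * e) * (r * a + s * c) \<noteq> 0"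
        using d abce by simp
    qed (simp add: p'_def q'_def r'_def s'_def mult.commute)
    finally show ?thesis by (simp add: w_def)
  qed
  define f where "f x = Re (h' (\<delta> x))" for x
  have "h' \<in> Isop" by (rule mob_normalise[of e a "-b" "-c"]) (use eabc in \<open>auto simp: h'_def\<close>)
  then have "continuous_on UH h'" using continuous_on_Isom Isop_subset by blast
  then have "continuous_on UNIV (\<lambda>x. h' (\<delta> x))"
    using \<delta> by (intro continuous_on_compose2[OF _ \<delta>(1)]) auto
  then have cf: "continuous_on UNIV f"
    unfolding f_def by (intro continuous_intros)
  have f0: "f x \<noteq> 0" for x
  proof
    assume "f x = 0"
    then have "h' (\<delta> x) = \<i> * of_real (Im (h' (\<delta> x)))" by (simp add: f_def complex_eq_iff)
    then have "\<delta> x = h (\<i> * of_real (Im (h' (\<delta> x))))" using hh' \<delta>(2) by metis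
    then show False using avoid h'UH[OF \<delta>(2)] by (simp add: UH_iff)
  qed
  have con: "connected (range f)" using cf connected_continuous_image connected_UNIV by blast
  have "(\<forall>x. f x > 0) \<or> (\<forall>x. f x < 0)"
  proof (rule ccontr)
    assume "\<not> ?thesis"
    then obtain x y where "f x \<le> 0" "f y \<ge> 0" by (auto simp: not_less)
    then have "0 \<in> range f" using connected_contains_Icc[OF con, of "f x" "f y"] by auto
    then show False using f0 by (metis rangeE)
  qed
  moreover have z: "h' (\<delta> (of_int n)) \<in> UH"
     "h' (\<delta> (of_int (n + 1))) = mob p' q' r' s' (h' (\<delta> (of_int n)))" for n
    using \<delta> h'UH conj by auto
  ultimately show False
    using orbit_crosses_axis[OF d' \<open>q' * r' > 0\<close>, of "\<lambda>n. h' (\<delta> (of_int n))", OF z]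
    unfolding f_def by blast
qed

text \<open>A negative discriminant would give a fixed point in the half plane, so the fixed points
  are real. With two of them the iterates converge to the attracting one; with a double one,
  \<open>1 / (z - x)\<close> grows by the constant \<open>r / (r * x + s)\<close> at each
  step.\<close>

lemma no_fixed_point_limit:
  assumes d: "p * s - q * r > 0" and r: "r \<noteq> 0" and free: "\<And>z. z \<in> UH \<Longrightarrow> mob p q r s z \<noteq> z"
    and g: "\<And>z. z \<in> UH \<Longrightarrow> g z = mob p q r s z" and z: "z \<in> UH"
  obtains x where "r * x\<^sup>2 + (s - p) * x - q = 0" "(\<lambda>n. (g ^^ n) z) \<longlonglongrightarrow> of_real x"
proof -
  define D where "D = (p - s)\<^sup>2 + 4 * q * r"
  have D: "D \<ge> 0"
  proof (rule ccontr)
    assume "\<not> D \<ge> 0"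
    then have D: "D < 0" by simp
    \<comment> \<open>\<open>u\<close> and \<open>v\<close> are the real and imaginary part of the
      root in the upper half plane.\<close>
    define v where "v = sqrt (- D) / (2 * \<bar>r\<bar>)"
    define u where "u = (p - s) / (2 * r)"
    have v: "v > 0" "4 * r\<^sup>2 * v\<^sup>2 = - D" using D r by (auto simp: v_def power_divide power_mult_distrib)
    have ru: "2 * r * u = p - s" using r by (simp add: u_def)
    define w where "w = Complex u v"
    have w: "w \<in> UH" using v by (simp add: w_def UH_iff)
    have "4 * r * (r * (u\<^sup>2 - v\<^sup>2) + (s - p) * u - q) = (2 * r * u - (p - s))\<^sup>2 - 4 * r\<^sup>2 * v\<^sup>2 - D"
      by (simp add: D_def power2_eq_square algebra_simps)
    then have 1: "r * (u\<^sup>2 - v\<^sup>2) + (s - p) * u - q = 0" using r ru v by simp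
    have 2: "(2 * r * u + s - p) * v = 0" using ru by simp
    have "w * (of_real r * w + of_real s) = of_real p * w + of_real q"
      using 1 2 by (simp add: w_def complex_eq_iff power2_eq_square algebra_simps)
    then have "mob p q r s w = w"
      using mob_denom[of p s q r w] d w by (simp add: mob_def divide_eq_eq)
    then show False using free w by blast
  qed
  have U: "(g ^^ n) z \<in> UH" for n
    by (induction n) (use z g mob_UH[OF d] in auto)
  have St: "(g ^^ Suc n) z = mob p q r s ((g ^^ n) z)" for n using g[OF U] by simp
  obtain x y where x: "r * x\<^sup>2 + (s - p) * x - q = 0" and y: "r * y\<^sup>2 + (s - p) * y - q = 0"
    and prod: "(r * x + s) * (r * y + s) = p * s - q * r"
    and nu: "0 < (r * y + s) / (r * x + s)" "x \<noteq> y \<Longrightarrow> (r * y + s) / (r * x + s) < 1"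
    by (rule real_fixed_points[OF r D[unfolded D_def] d], rule that)
  show ?thesis
  proof (cases "x = y")
    case False
    have "(\<lambda>n. (g ^^ n) z) \<longlonglongrightarrow> of_real x"
      by (rule ratio_tendsto[OF nu(1) nu(2)[OF False] False U]) (unfold St, rule mob_ratio[OF d x y U])
    then show ?thesis using that x by blast
  next
    case True
    define t where "t = r * x + s"
    have tt: "t * t = p * s - q * r" using prod True by (simp add: t_def)
    have "(p - r * x) * t = p * s - q * r" unfolding t_def by (rule fixed_point_eigenvalue[OF x])
    moreover have t0: "t \<noteq> 0" using tt d by auto
    \<comment> \<open>The eigenvalues coincide in the parabolic case.\<close>
    ultimately have pt: "p - r * x = t" using tt by (metis mult_right_cancel)
    define u where "u n = (g ^^ n) z - of_real x" for n
    have u0: "u n \<noteq> 0" for n unfolding u_def by (rule UH_ne_real[OF U])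
    have Su: "1 / u (Suc n) = 1 / u n + of_real (r / t)" for n
    proof -
      have d0: "p * s - q * r \<noteq> 0" using d by simp
      have den: "of_real r * (g ^^ n) z + of_real s = of_real r * u n + of_real t"
        by (simp add: u_def t_def algebra_simps)
      then have den0: "of_real r * u n + of_real t \<noteq> 0" using mob_denom[OF d0 U] by metis
      have "u (Suc n) = of_real t * u n / (of_real r * u n + of_real t)"
        using mob_sub_fixed[OF d0 x U, of n] unfolding pt den by (simp add: u_def St del: funpow.simps)
      then have "1 / u (Suc n) = (of_real r * u n + of_real t) / (of_real t * u n)" by simp
      then show ?thesis using t0 u0[of n] by (simp add: field_simps)
    qed
    have un: "1 / u n = 1 / u 0 + of_real (r / t) * of_nat n" for n
      by (induction n) (simp_all add: Su algebra_simps del: of_real_divide)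
    have "filterlim (\<lambda>n. of_real (r / t) * (of_nat n :: complex)) at_infinity sequentially"
      by (rule tendsto_mult_filterlim_at_infinity[OF tendsto_const _ tendsto_of_nat]) (use r t0 in simp)
    then have "filterlim (\<lambda>n. 1 / u 0 + of_real (r / t) * of_nat n) at_infinity sequentially"
      by (rule tendsto_add_filterlim_at_infinity[OF tendsto_const])
    then have "(\<lambda>n. inverse (1 / u 0 + of_real (r / t) * of_nat n)) \<longlonglongrightarrow> 0"
      by (rule filterlim_compose[OF tendsto_inverse_0])
    then have "(\<lambda>n. inverse (1 / u n)) \<longlonglongrightarrow> 0" by (simp only: un[symmetric])
    then have "u \<longlonglongrightarrow> 0" by simp
    then have "(\<lambda>n. (g ^^ n) z) \<longlonglongrightarrow> of_real x" unfolding u_def by (rule LIM_zero_cancel)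
    then show ?thesis using that x by blast
  qed
qed

text \<open>Multiplied by \<open>q\<close> and written in \<open>y = q * x\<close>, the root
  equation becomes \<open>(k * y + p) * (y + s) = - 1\<close>, so the two factors have opposite
  signs, and the comparison of \<open>k * \<bar>s\<bar>\<close> with \<open>\<bar>p\<bar>\<close>
  determines the sign of \<open>y\<close>. The quantity in the conclusion is \<open>q\<close> times
  the derivative of the quadratic with respect to \<open>k\<close>, which is what matters when one
  exponent is replaced by another.\<close>

lemma type_S_root:
  fixes p q s k x :: real
  assumes "p * s = q\<^sup>2 - 1" "q \<noteq> 0" "k > 0" "k * \<bar>s\<bar> < \<bar>p\<bar>"
    and "k * q * x\<^sup>2 + (k * s + p) * x + q = 0"
  shows "q * x * (q * x + s) > 0"
proof -
  define y where "y = q * x"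
  have q2: "q\<^sup>2 > 0" using assms(2) by simp
  have "(k * y + p) * (y + s) + 1 = q * (k * q * x\<^sup>2 + (k * s + p) * x + q) + (p * s - (q\<^sup>2 - 1))"
    by (simp add: y_def power2_eq_square algebra_simps)
  then have e: "(k * y + p) * (y + s) = - 1" using assms by simp
  \<comment> \<open>The equation is unchanged when \<open>y\<close>, \<open>s\<close> and
    \<open>p\<close> all change sign, so only the case \<open>Y + S < 0\<close> has to be
    treated.\<close>
  have main: "Y * (Y + S) > 0"
    if Y: "Y + S < 0" "k * Y + P > 0" "k * \<bar>S\<bar> < \<bar>P\<bar>" "P * S > - 1" "(k * Y + P) * (Y + S) = - 1" for Y S P
  proof -
    have "k * Y + k * S < 0" using Y(1) assms(3) by (simp add: mult_pos_neg flip: distrib_left)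
    then have "k * S < P" using Y(2) by linarith
    then have P: "P > 0"
    proof (cases "P \<le> 0")
      case True
      have "- (k * \<bar>S\<bar>) \<le> k * S" using assms(3) by (cases "S \<ge> 0") auto
      then show ?thesis using True Y(3) \<open>k * S < P\<close> by linarith
    qed simp
    \<comment> \<open>Otherwise the expanded product is \<open>P * S\<close>, which exceeds -1, plus
      two nonnegative terms.\<close>
    have "Y < 0"
    proof (rule ccontr)
      assume "\<not> Y < 0"
      then have Y0: "Y \<ge> 0" by simp
      then have S: "S < 0" using Y(1) by linarith
      have "P + k * S > 0" using P S Y(3) by simp
      then have "0 \<le> Y * (P + k * S)" using Y0 by simp
      moreover have "0 \<le> k * (Y * Y)" using assms(3) by simp
      moreover have "(k * Y + P) * (Y + S) = k * (Y * Y) + Y * (P + k * S) + P * S"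
        by (simp add: algebra_simps)
      ultimately show False using Y(4,5) by linarith
    qed
    then show ?thesis using Y(1) by (simp add: mult_neg_neg)
  qed
  have "y * (y + s) > 0"
  proof (cases "y + s < 0")
    case True
    then have "k * y + p > 0" using e by (smt (verit) mult_nonpos_nonpos)
    then show ?thesis using main[of y s p] True e assms q2 by simp
  next
    case False
    then have ys: "y + s > 0" using e by (cases "y + s = 0") auto
    then have "k * y + p < 0" using e by (smt (verit) mult_nonneg_nonneg)
    then show ?thesis using main[of "-y" "-s" "-p"] ys e assms q2 by (simp add: algebra_simps)
  qed
  then show ?thesis by (simp add: y_def)
qed

text \<open>The interlaced translates of the axis of \<open>\<alpha>\<close> and of the axis of \<open>\<beta>\<close> under \<open>\<alpha>\<^sup>m \<beta>\<close> form a
  connected chain; it would have to cross the axis of the other peripheral element.\<close>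

lemma nested_peripheral_False:
  assumes ps: "p * s = q\<^sup>2 - 1" and q: "q \<noteq> 0"
    and k: "0 < k'" "k' < k" and S: "k * \<bar>s\<bar> < \<bar>p\<bar>"
    and g: "\<And>z. z \<in> UH \<Longrightarrow> g z = mob (- p) (- q) (k * q) (k * s) z"
    and free: "\<And>z. z \<in> UH \<Longrightarrow> g z \<noteq> z"
    and h: "h \<in> Isop" "h \<i> = \<i>"
    and link: "y0 > 0" "y0' > 0" "g (h (\<i> * of_real y0)) = \<i> * of_real y0'"
    and \<delta>: "continuous_on UNIV \<delta>" "\<And>x::real. \<delta> x \<in> UH"
       "\<And>x. \<delta> (x + 1) = mob (- p) (- q) (k' * q) (k' * s) (\<delta> x)"
    and avoid: "\<And>n x y. y > 0 \<Longrightarrow> \<delta> x \<noteq> (g ^^ n) (\<i> * of_real y)"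
       "\<And>n x y. y > 0 \<Longrightarrow> \<delta> x \<noteq> (g ^^ n) (h (\<i> * of_real y))"
  shows False
proof -
  have gI: "g \<in> Isop"
  proof (rule mob_normalise)
    have "(- p) * (k * s) - (- q) * (k * q) = k * (q\<^sup>2 - p * s)" by (simp add: algebra_simps power2_eq_square)
    then show "(- p) * (k * s) - (- q) * (k * q) > 0" using ps k by simp
  qed (rule g)
  note gn = Isop_funpow[OF gI]
  \<comment> \<open>All entries are multiplied by \<open>q\<close>. The map is the same, but now
    \<open>R > 0\<close> and \<open>Q < 0\<close> whatever the sign of \<open>q\<close>, so the form
    is positive on the imaginary axis.\<close>
  define P Q R T where "P = - p * q" and "Q = - q * q" and "R = k' * q * q" and "T = k' * s * q"
  have mobq: "mob (- p) (- q) (k' * q) (k' * s) z = mob P Q R T z" for z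
  proof -
    have "mob P Q R T z = (of_real q * (of_real (- p) * z + of_real (- q))) /
       (of_real q * (of_real (k' * q) * z + of_real (k' * s)))"
      by (simp add: mob_def P_def Q_def R_def T_def algebra_simps)
    then show ?thesis using q by (simp add: mob_def)
  qed
  have d: "P * T - Q * R > 0"
  proof -
    have "P * T - Q * R = k' * q\<^sup>2 * (q\<^sup>2 - p * s)"
      by (simp add: P_def Q_def R_def T_def power2_eq_square algebra_simps)
    then show ?thesis using ps k q by simp
  qed
  have \<delta>': "\<delta> (x + 1) = mob P Q R T (\<delta> x)" for x using \<delta>(3) mobq by simp
  note along = fixform_along[OF d _ \<delta>(1,2) \<delta>']
  define G where "G = fixform P Q R T"
  have chain: "\<forall>y>0. G ((g ^^ n) (\<i> * of_real y)) > 0" for n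
  proof (induction n)
    case 0
    have "q * q > 0" using q by (metis not_real_square_gt_zero)
    then have R: "R > 0" "Q < 0" using k by (auto simp: R_def Q_def mult.assoc)
    have "G (\<i> * of_real y) > 0" if "y > 0" for y
    proof -
      have "G (\<i> * of_real y) = R * y\<^sup>2 - Q" by (simp add: G_def fixform_def norm_mult)
      moreover have "R * y\<^sup>2 > 0" using that R by simp
      ultimately show ?thesis using R(2) by simp
    qed
    then show ?case by simp
  next
    case (Suc n)
    have comp: "(\<lambda>z. (g ^^ Suc n) (h z)) \<in> Isop" by (rule Isop_comp[OF gn h(1)])
    \<comment> \<open>By \<open>link\<close> this point of a translate of the \<beta>-axis lies on
      the previous translate of the \<alpha>-axis, where the form is already known to be
      positive.\<close>
    have "G ((g ^^ Suc n) (h (\<i> * of_real y0))) > 0"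
      using Suc link by (simp add: funpow_swap1)
    then have A: "fixform P Q R T ((g ^^ Suc n) (h (\<i> * of_real y0))) > 0" by (simp only: G_def)
    have "fixform P Q R T ((g ^^ Suc n) (h (\<i> * of_real 1))) > 0"
      by (rule along[OF comp _ link(1) A zero_less_one]) (rule avoid(2))
    \<comment> \<open>The two axes cross at \<open>\<i>\<close>, so the translate of the
      \<beta>-axis hands positivity on to the next translate of the \<alpha>-axis.\<close>
    then have B: "fixform P Q R T ((g ^^ Suc n) (\<i> * of_real 1)) > 0" using h(2) by simp
    show ?case
      unfolding G_def
    proof (intro allI impI)
      fix y :: real assume "y > 0"
      then show "fixform P Q R T ((g ^^ Suc n) (\<i> * of_real y)) > 0"
        by (rule along[OF gn _ zero_less_one B, rotated]) (rule avoid(1))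
    qed
  qed
  have det: "(- p) * (k * s) - (- q) * (k * q) > 0"
  proof -
    have "(- p) * (k * s) - (- q) * (k * q) = k * (q\<^sup>2 - p * s)" by (simp add: algebra_simps power2_eq_square)
    then show ?thesis using ps k by simp
  qed
  have kq: "k * q \<noteq> 0" using q k by simp
  have free': "mob (- p) (- q) (k * q) (k * s) z \<noteq> z" if "z \<in> UH" for z using free[OF that] g[OF that] by simp
  have iU: "\<i> \<in> UH" by (simp add: UH_iff)
  have "\<exists>x. k * q * x\<^sup>2 + (k * s - (- p)) * x - (- q) = 0 \<and> (\<lambda>n. (g ^^ n) \<i>) \<longlonglongrightarrow> of_real x"
  proof (rule no_fixed_point_limit[OF det kq, where g = g and z = \<i>])
    show "\<i> \<in> UH" by (rule iU)
    show "mob (- p) (- q) (k * q) (k * s) z \<noteq> z" "g z = mob (- p) (- q) (k * q) (k * s) z" if "z \<in> UH" for z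
      using free'[OF that] g[OF that] by auto
    fix x assume "k * q * x\<^sup>2 + (k * s - - p) * x - - q = 0" "(\<lambda>n. (g ^^ n) \<i>) \<longlonglongrightarrow> of_real x"
    then show "\<exists>x. k * q * x\<^sup>2 + (k * s - (- p)) * x - (- q) = 0 \<and> (\<lambda>n. (g ^^ n) \<i>) \<longlonglongrightarrow> of_real x"
      by (intro exI[of _ x] conjI)
  qed
  then obtain x where x: "k * q * x\<^sup>2 + (k * s - (- p)) * x - (- q) = 0" "(\<lambda>n. (g ^^ n) \<i>) \<longlonglongrightarrow> of_real x"
    by blast
  \<comment> \<open>Positivity along the chain passes to the limit as \<open>\<ge> 0\<close>, so a
    strictly negative value at the fixed point of \<open>g\<close> is a contradiction.\<close>
  have lim: "(\<lambda>n. G ((g ^^ n) \<i>)) \<longlonglongrightarrow> G (of_real x)"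
    unfolding G_def fixform_def by (intro tendsto_intros x(2))
  have "G ((g ^^ n) \<i>) \<ge> 0" for n using chain[of n, rule_format, of 1] by simp
  then have "G (of_real x) \<ge> 0" by (intro LIMSEQ_le_const[OF lim]) auto
  moreover have "G (of_real x) < 0"
  proof -
    have x': "k * q * x\<^sup>2 + (k * s + p) * x + q = 0" using x(1) by simp
    have pos: "q * x * (q * x + s) > 0" using k by (intro type_S_root[OF ps q _ S x']) auto
    have "G (of_real x) = q * (k' * q * x\<^sup>2 + (k' * s + p) * x + q)"
      by (simp add: G_def fixform_def P_def Q_def R_def T_def power2_eq_square algebra_simps)
    \<comment> \<open>The quadratic is linear in its parameter: the value for \<open>k'\<close> is
      the value for \<open>k\<close>, which vanishes at \<open>x\<close>, plus \<open>k' - k\<close>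
      times the derivative.\<close>
    also have "\<dots> = q * (k * q * x\<^sup>2 + (k * s + p) * x + q) + (k' - k) * (q * x * (q * x + s))"
      by (simp add: power2_eq_square algebra_simps)
    also have "\<dots> < 0" using x' pos k by (simp add: mult_neg_pos)
    finally show ?thesis .
  qed
  ultimately show False by simp
qed

text \<open>Here the off-diagonal entries have the positive product \<open>k * q^2\<close>, so the
  fixed points lie on opposite sides of the imaginary axis, and an equivariant curve has to cross
  it.\<close>

lemma crossing_translations_False:
  assumes q: "q \<noteq> 0" and ps: "p * s = q\<^sup>2 + 1" and k: "k > 0"
    and \<delta>: "continuous_on UNIV \<delta>" "\<And>x::real. \<delta> x \<in> UH"
       "\<And>x. \<delta> (x + 1) = mob p q (k * q) (k * s) (\<delta> x)"
    and avoid: "\<And>x y. y > 0 \<Longrightarrow> \<delta> x \<noteq> \<i> * of_real y"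
  shows False
proof -
  have d: "(q * p) * (k * s * q) - (q * q) * (k * q * q) > 0"
  proof -
    have "(q * p) * (k * s * q) - (q * q) * (k * q * q) = k * q\<^sup>2 * (p * s - q\<^sup>2)"
      by (simp add: power2_eq_square algebra_simps)
    then show ?thesis using ps k q by simp
  qed
  have mobq: "mob p q (k * q) (k * s) z = mob (q * p) (q * q) (k * q * q) (k * s * q) z" for z
  proof -
    have "mob (q * p) (q * q) (k * q * q) (k * s * q) z = (of_real q * (of_real p * z + of_real q)) /
       (of_real q * (of_real (k * q) * z + of_real (k * s)))"
      by (simp add: mob_def algebra_simps)
    then show ?thesis using q by (simp add: mob_def)
  qed
  have F: "fixform (q * p) (q * q) (k * q * q) (k * s * q) (\<i> * of_real y) = q\<^sup>2 * (k * y\<^sup>2 - 1)" for y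
    by (simp add: fixform_def norm_mult power2_eq_square algebra_simps)
  \<comment> \<open>On the imaginary axis the form is \<open>q^2 * (k * y^2 - 1)\<close>: positive
    at \<open>2 / sqrt k\<close>, zero at \<open>1 / sqrt k\<close>.\<close>
  have "fixform (q * p) (q * q) (k * q * q) (k * s * q) (\<i> * of_real (1 / sqrt k)) > 0"
  proof (rule fixform_along[OF d id_Isop \<delta>(1,2), where ?y1.0 = "2 / sqrt k"])
    show "\<delta> (x + 1) = mob (q * p) (q * q) (k * q * q) (k * s * q) (\<delta> x)" for x using \<delta>(3) mobq by simp
    show "fixform (q * p) (q * q) (k * q * q) (k * s * q) (\<i> * of_real (2 / sqrt k)) > 0"
      unfolding F using k q by (simp add: power_divide)
  qed (use k avoid in auto)
  then show False unfolding F using k by (simp add: power_divide)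
qed

section \<open>Surfaces locally isometric to the upper half plane\<close>

lemma Isom_preimage_ball:
  assumes "g \<in> Isom" "z \<in> UH" "g z \<in> ball w e"
  obtains d where "d > 0" "ball z d \<subseteq> UH \<inter> g -` ball w e"
proof -
  have "open (UH \<inter> g -` ball w e)"
    using continuous_on_Isom[OF assms(1)] continuous_open_preimage[OF _ open_UH open_ball] by blast
  then show ?thesis using that assms(2,3) open_contains_ball by blast
qed

section \<open>Comparison of hyperbolic and Euclidean distance\<close>

lemma cosh_ge_quadratic:
  fixes x :: real
  assumes "x \<ge> 0"
  shows "1 + x\<^sup>2 / 2 \<le> cosh x"
proof -
  have s: "x / 2 \<le> sinh (x / 2)"
    using real_le_x_sinh[of "x / 2"] assms by (simp add: sinh_field_def exp_minus)
  have "cosh x = 1 + 2 * (sinh (x / 2))\<^sup>2"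
    using cosh_double[of "x / 2"] cosh_square_eq[of "x / 2"] by simp
  moreover have "(x / 2)\<^sup>2 \<le> (sinh (x / 2))\<^sup>2" using s assms by (intro power_mono) auto
  ultimately show ?thesis by (simp add: power_divide)
qed

lemma hyp_dist_le:
  assumes "z \<in> UH" "w \<in> UH" "m > 0" "m \<le> Im z" "m \<le> Im w"
  shows "hyp_dist z w \<le> cmod (z - w) / m"
proof -
  have "1 + (hyp_dist z w)\<^sup>2 / 2 \<le> 1 + hq z w / 2"
    using cosh_ge_quadratic[OF hyp_dist_nonneg[OF assms(1,2)]] cosh_hyp_dist[OF assms(1,2)] by simp
  then have "(hyp_dist z w)\<^sup>2 \<le> hq z w" by simp
  also have "\<dots> \<le> (cmod (z - w))\<^sup>2 / (m * m)"
    unfolding hq_def using assms by (intro divide_left_mono mult_mono) (auto simp: UH_iff)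
  finally have "(hyp_dist z w)\<^sup>2 \<le> (cmod (z - w) / m)\<^sup>2" by (simp add: power2_eq_square)
  then show ?thesis using assms(3) by (auto intro: power2_le_imp_le)
qed

lemma hyp_dist_small:
  assumes "z \<in> UH" "e > 0"
  obtains d where "d > 0" "\<And>w. w \<in> UH \<Longrightarrow> hyp_dist z w < d \<Longrightarrow> cmod (z - w) < e"
proof -
  define y where "y = Im z"
  have y: "y > 0" using assms by (simp add: y_def UH_iff)
  \<comment> \<open>The least value of \<open>hq\<close> on the Euclidean circle of radius
    \<open>e\<close> about \<open>z\<close>, taken at its top; the same expression with a larger
    radius is larger.\<close>
  define c where "c = e\<^sup>2 / (y * (y + e))"
  have c: "c > 0" using y assms by (simp add: c_def)
  show ?thesis
  proof
    show "arcosh (1 + c / 2) > 0" using c arcosh_real_strict_mono[of 1 "1 + c / 2"] by simp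
    fix w assume w: "w \<in> UH" "hyp_dist z w < arcosh (1 + c / 2)"
    show "cmod (z - w) < e"
    proof (rule ccontr)
      assume "\<not> ?thesis"
      then have l: "e \<le> cmod (z - w)" by simp
      define l where "l = cmod (z - w)"
      have "Im w \<le> y + l" using abs_Im_le_cmod[of "z - w"] by (simp add: y_def l_def)
      moreover have "Im w > 0" using w by (simp add: UH_iff)
      ultimately have "l\<^sup>2 / (y * (y + l)) \<le> hq z w"
        unfolding hq_def y_def[symmetric] l_def[symmetric] using y by (intro divide_left_mono) auto
      moreover have "c \<le> l\<^sup>2 / (y * (y + l))"
      proof -
        have el: "e \<le> l" "0 < l" using l assms by (auto simp: l_def)
        have "e\<^sup>2 * (y + l) = e * (e * y) + e * e * l" by (simp add: power2_eq_square algebra_simps)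
        also have "\<dots> \<le> l * (l * y) + e * l * l" using el assms(2) y by (intro add_mono mult_mono) auto
        also have "\<dots> = l\<^sup>2 * (y + e)" by (simp add: power2_eq_square algebra_simps)
        finally have "e\<^sup>2 / (y + e) \<le> l\<^sup>2 / (y + l)" using y el assms(2) by (simp add: divide_le_eq le_divide_eq mult.commute)
        then have "e\<^sup>2 / (y + e) / y \<le> l\<^sup>2 / (y + l) / y" using y by (intro divide_right_mono) auto
        then show ?thesis by (simp add: c_def mult.commute)
      qed
      ultimately have "1 + c / 2 \<le> cosh (hyp_dist z w)" using cosh_hyp_dist[OF assms(1) w(1)] by simp
      moreover have "cosh (hyp_dist z w) < cosh (arcosh (1 + c / 2))"
        using w hyp_dist_nonneg[OF assms(1) w(1)] by (intro cosh_real_strict_mono) auto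
      ultimately show False using c by simp
    qed
  qed
qed

lemma hyp_dist_nhd:
  assumes "z \<in> UH" "r > 0"
  obtains e where "e > 0" "ball z e \<subseteq> UH" "\<And>w. w \<in> ball z e \<Longrightarrow> hyp_dist z w < r"
proof -
  \<comment> \<open>The first bound keeps heights above half of \<open>Im z\<close>; with that, the
    second bounds the distance by \<open>r\<close> through \<open>hyp_dist_le\<close>.\<close>
  define e where "e = min (Im z / 2) (r * Im z / 2)"
  have z: "Im z > 0" using assms by (simp add: UH_iff)
  have e: "e > 0" using z assms by (simp add: e_def)
  have im: "Im z / 2 \<le> Im w" if "w \<in> ball z e" for w
  proof -
    have "\<bar>Im (z - w)\<bar> < Im z / 2" using that abs_Im_le_cmod[of "z - w"] by (simp add: dist_norm e_def)
    then show ?thesis by (auto simp: abs_if split: if_splits)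
  qed
  show ?thesis
  proof
    show "e > 0" by fact
    show U: "ball z e \<subseteq> UH" using im z by (force simp: UH_iff)
    fix w assume w: "w \<in> ball z e"
    have "hyp_dist z w \<le> cmod (z - w) / (Im z / 2)"
      using im[OF w] z assms U w by (intro hyp_dist_le) auto
    also have "\<dots> < (r * Im z / 2) / (Im z / 2)"
      using w z by (intro divide_strict_right_mono) (auto simp: dist_norm e_def)
    also have "\<dots> = r" using z by simp
    finally show "hyp_dist z w < r" .
  qed
qed

text \<open>By \<open>Isom_eq\<close> two isometries that agree on a ball agree on
  \<open>UH\<close>, so the set on which \<open>f\<close> is locally \<open>g0\<close> is open and
  closed in \<open>W\<close>.\<close>

lemma Isom_locally_const:
  assumes W: "connected W" "W \<subseteq> UH" "z0 \<in> W"
    and loc: "\<And>z. z \<in> W \<Longrightarrow> \<exists>d>0. \<exists>g\<in>Isom. ball z d \<subseteq> W \<and> (\<forall>u\<in>ball z d. f u = g u)"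
  obtains g where "g \<in> Isom" "\<And>z. z \<in> W \<Longrightarrow> f z = g z"
proof -
  have oW: "open W" unfolding open_contains_ball using loc by blast
  obtain d0 g0 where d0: "d0 > 0" and g0: "g0 \<in> Isom" and b0: "ball z0 d0 \<subseteq> W" "\<And>u. u \<in> ball z0 d0 \<Longrightarrow> f u = g0 u"
    using loc[OF W(3)] by blast
  define A where "A = {z\<in>W. \<exists>d>0. \<forall>u\<in>ball z d. f u = g0 u}"
  have nb: "A \<inter> ball z d = {} \<or> ball z d \<subseteq> A"
    if zd: "d > 0" "g \<in> Isom" "ball z d \<subseteq> W" "\<forall>u\<in>ball z d. f u = g u" for z d g
  proof (cases "A \<inter> ball z d = {}")
    case False
    then obtain y e where y: "y \<in> ball z d" "e > 0" "\<forall>u\<in>ball y e. f u = g0 u" by (auto simp: A_def)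
    have eq: "g u = g0 u" if "u \<in> UH" for u
    proof (rule Isom_eq[OF zd(2) g0 _ _ _ _ that])
      show "open (ball z d \<inter> ball y e)" by auto
      show "ball z d \<inter> ball y e \<noteq> {}" using y by auto
      show "ball z d \<inter> ball y e \<subseteq> UH" using zd W by auto
      show "g u = g0 u" if "u \<in> ball z d \<inter> ball y e" for u using that zd y by force
    qed
    have "x \<in> A" if xb: "x \<in> ball z d" for x
    proof -
      obtain e' where e': "e' > 0" "ball x e' \<subseteq> ball z d" using xb by (meson open_ball open_contains_ball)
      then have "\<forall>u\<in>ball x e'. f u = g0 u" using zd eq W(2) by (metis subset_iff)
      then show ?thesis using e' xb zd by (auto simp: A_def)
    qed
    then show ?thesis by blast
  qed auto
  have "open A" unfolding open_contains_ball
  proof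
    fix z assume z: "z \<in> A"
    then have zW: "z \<in> W" by (simp add: A_def)
    obtain d g where "d > 0" "g \<in> Isom" "ball z d \<subseteq> W" "\<forall>u\<in>ball z d. f u = g u" using loc[OF zW] by blast
    then show "\<exists>e>0. ball z e \<subseteq> A" using nb[of d g z] z by (metis centre_in_ball disjoint_iff)
  qed
  moreover have "open (W - A)" unfolding open_contains_ball
  proof
    fix z assume z: "z \<in> W - A"
    then have zW: "z \<in> W" by simp
    obtain d g where d: "d > 0" "g \<in> Isom" "ball z d \<subseteq> W" "\<forall>u\<in>ball z d. f u = g u" using loc[OF zW] by blast
    then have "A \<inter> ball z d = {}" using nb[of d g z] z by (metis DiffD2 centre_in_ball subsetD)
    then show "\<exists>e>0. ball z e \<subseteq> W - A" using d by blast
  qed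
  moreover have "A \<subseteq> W" by (auto simp: A_def)
  moreover have "z0 \<in> A" using W d0 b0 by (auto simp: A_def)
  ultimately have "A = W" using connectedD[OF W(1), of A "W - A"] by blast
  then have "f z = g0 z" if "z \<in> W" for z using that unfolding A_def by force
  then show ?thesis using that g0 by blast
qed

text \<open>Stated for a subset of a metric space type, so that limits and completeness of the type
  class apply; the given surface enters through its image under an isometric embedding.\<close>

locale hyperbolic_surface =
  fixes N :: "'b::metric_space set"
  assumes complete: "complete N" and conn: "connected N"
    and charts: "\<And>p. p \<in> N \<Longrightarrow> \<exists>r>0. \<exists>\<phi>. \<phi> ` (N \<inter> ball p r) = {w\<in>UH. hyp_dist (\<phi> p) w < r} \<and>
        (\<forall>x\<in>N \<inter> ball p r. \<forall>y\<in>N \<inter> ball p r. hyp_dist (\<phi> x) (\<phi> y) = dist x y)"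
begin

text \<open>The chart is cut down to a Euclidean ball and inverted, so that \<open>\<psi>\<close>
  has a convex domain in \<open>UH\<close>; its image contains all points of the surface closer to
  \<open>p\<close> than \<open>r\<close>.\<close>

lemma chart_inverse:
  assumes "p \<in> N"
  obtains c e r \<psi> \<phi> where "e > 0" "r > 0" "ball c e \<subseteq> UH" "\<psi> c = p"
    "\<And>u. u \<in> ball c e \<Longrightarrow> \<psi> u \<in> N \<and> \<phi> (\<psi> u) = u"
    "\<And>u v. u \<in> ball c e \<Longrightarrow> v \<in> ball c e \<Longrightarrow> dist (\<psi> u) (\<psi> v) = hyp_dist u v"
    "\<And>x. x \<in> N \<Longrightarrow> dist p x < r \<Longrightarrow> \<phi> x \<in> ball c e \<and> \<psi> (\<phi> x) = x"
    "openin (top_of_set N) (\<psi> ` ball c e)"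
proof -
  obtain r \<phi> where r: "r > 0" and im: "\<phi> ` (N \<inter> ball p r) = {w\<in>UH. hyp_dist (\<phi> p) w < r}"
    and iso: "\<And>x y. x \<in> N \<inter> ball p r \<Longrightarrow> y \<in> N \<inter> ball p r \<Longrightarrow> hyp_dist (\<phi> x) (\<phi> y) = dist x y"
    using charts[OF assms] by blast
  define c where "c = \<phi> p"
  have p: "p \<in> N \<inter> ball p r" using assms r by auto
  have cU: "c \<in> UH" using im p by (auto simp: c_def)
  obtain e where e: "e > 0" "ball c e \<subseteq> UH" "\<And>w. w \<in> ball c e \<Longrightarrow> hyp_dist c w < r"
    using hyp_dist_nhd[OF cU r] by blast
  define B where "B = N \<inter> ball p r"
  have U: "\<phi> x \<in> UH" if "x \<in> B" for x using im that by (auto simp: B_def)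
  have inj: "inj_on \<phi> B"
  proof
    fix x y assume xy: "x \<in> B" "y \<in> B" "\<phi> x = \<phi> y"
    have "hyp_dist (\<phi> x) (\<phi> x) = 0" by (simp add: hyp_dist_def)
    then show "x = y" using iso[of x y] xy by (simp add: B_def)
  qed
  define \<psi> where "\<psi> = inv_into B \<phi>"
  have \<psi>: "\<psi> u \<in> B" "\<phi> (\<psi> u) = u" if "u \<in> ball c e" for u
  proof -
    have "u \<in> \<phi> ` B" using im e that by (auto simp: B_def c_def)
    then show "\<psi> u \<in> B" "\<phi> (\<psi> u) = u" by (auto simp: \<psi>_def inv_into_into f_inv_into_f)
  qed
  have \<psi>\<phi>: "\<psi> (\<phi> x) = x" if "x \<in> B" for x using inj that by (simp add: \<psi>_def)
  have near: "\<exists>d>0. \<forall>x\<in>N. dist x0 x < d \<longrightarrow> x \<in> B \<and> \<phi> x \<in> ball c e"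
    if x0: "x0 \<in> B" "\<phi> x0 \<in> ball c e" for x0
  proof -
    obtain e' where e': "e' > 0" "ball (\<phi> x0) e' \<subseteq> ball c e" using x0(2) by (meson open_ball open_contains_ball)
    obtain d1 where d1: "d1 > 0" "\<And>w. w \<in> UH \<Longrightarrow> hyp_dist (\<phi> x0) w < d1 \<Longrightarrow> cmod (\<phi> x0 - w) < e'"
      using hyp_dist_small[OF U[OF x0(1)] e'(1)] by blast
    obtain d2 where d2: "d2 > 0" "ball x0 d2 \<subseteq> ball p r"
      using x0(1) unfolding B_def by (meson IntD2 open_ball open_contains_ball)
    show ?thesis
    proof (intro exI[of _ "min d1 d2"] conjI ballI impI)
      fix x assume x: "x \<in> N" "dist x0 x < min d1 d2"
      then show xB: "x \<in> B" using d2 by (auto simp: B_def)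
      have "hyp_dist (\<phi> x0) (\<phi> x) < d1" using iso[of x0 x] x x0 xB by (simp add: B_def)
      then show "\<phi> x \<in> ball c e" using d1(2)[OF U[OF xB]] e'(2) by (auto simp: dist_norm)
    qed (use d1 d2 in auto)
  qed
  have pB: "p \<in> B" "\<phi> p \<in> ball c e" using p e by (auto simp: B_def c_def)
  obtain r' where r': "r' > 0" "\<And>x. x \<in> N \<Longrightarrow> dist p x < r' \<Longrightarrow> x \<in> B \<and> \<phi> x \<in> ball c e"
    using near[OF pB] by blast
  show ?thesis
  proof (rule that[of e r' c \<psi> \<phi>])
    show "\<psi> c = p" using \<psi>\<phi>[OF pB(1)] by (simp add: c_def)
    show "dist (\<psi> u) (\<psi> v) = hyp_dist u v" if "u \<in> ball c e" "v \<in> ball c e" for u v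
      using iso[of "\<psi> u" "\<psi> v"] \<psi>[OF that(1)] \<psi>[OF that(2)] by (simp add: B_def)
    show "\<phi> x \<in> ball c e \<and> \<psi> (\<phi> x) = x" if "x \<in> N" "dist p x < r'" for x
      using r'(2)[OF that] \<psi>\<phi> by blast
    show "openin (top_of_set N) (\<psi> ` ball c e)"
      unfolding openin_euclidean_subtopology_iff
    proof (intro conjI ballI)
      show "\<psi> ` ball c e \<subseteq> N" using \<psi> by (auto simp: B_def)
      fix x assume "x \<in> \<psi> ` ball c e"
      then have x: "x \<in> B" "\<phi> x \<in> ball c e" using \<psi> by auto
      obtain d where d: "d > 0" "\<forall>y\<in>N. dist x y < d \<longrightarrow> y \<in> B \<and> \<phi> y \<in> ball c e" using near[OF x] by blast
      then show "\<exists>d>0. \<forall>y\<in>N. dist y x < d \<longrightarrow> y \<in> \<psi> ` ball c e"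
        using \<psi>\<phi> by (metis dist_commute image_eqI)
    qed
  qed (use e r' \<psi> in \<open>auto simp: B_def\<close>)
qed

text \<open>A local isometry on \<open>W\<close>; as each point has a ball inside \<open>W\<close>,
  the set \<open>W\<close> is open.\<close>

definition locisom :: "(complex \<Rightarrow> 'b) \<Rightarrow> complex set \<Rightarrow> bool" where
  "locisom f W \<longleftrightarrow> W \<subseteq> UH \<and> (\<forall>z\<in>W. \<exists>e>0. ball z e \<subseteq> W \<and> f ` ball z e \<subseteq> N \<and>
     (\<forall>u\<in>ball z e. \<forall>v\<in>ball z e. dist (f u) (f v) = hyp_dist u v))"

lemma locisom_subset: "locisom f W \<Longrightarrow> W \<subseteq> UH"
  by (simp add: locisom_def)

lemma locisom_in: "locisom f W \<Longrightarrow> z \<in> W \<Longrightarrow> f z \<in> N"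
  unfolding locisom_def by (meson centre_in_ball image_subset_iff)

lemma locisom_open: "locisom f W \<Longrightarrow> open W"
  unfolding locisom_def open_contains_ball by blast

lemma locisomE:
  assumes "locisom f W" "z \<in> W"
  obtains e where "e > 0" "ball z e \<subseteq> W" "\<And>u. u \<in> ball z e \<Longrightarrow> f u \<in> N"
    "\<And>u v. u \<in> ball z e \<Longrightarrow> v \<in> ball z e \<Longrightarrow> dist (f u) (f v) = hyp_dist u v"
  using assms unfolding locisom_def by (metis image_subset_iff)

lemma locisomI:
  assumes "W \<subseteq> UH"
    and "\<And>z. z \<in> W \<Longrightarrow> \<exists>V f'. open V \<and> z \<in> V \<and> V \<subseteq> W \<and> locisom f' V \<and> (\<forall>u\<in>V. f u = f' u)"
  shows "locisom f W"
  unfolding locisom_def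
proof (intro conjI ballI)
  fix z assume zW: "z \<in> W"
  obtain V f' where V: "open V" "z \<in> V" "V \<subseteq> W" "locisom f' V" "\<forall>u\<in>V. f u = f' u"
    using assms(2)[OF zW] by (elim exE conjE)
  obtain e where e: "e > 0" "ball z e \<subseteq> V" "\<And>u. u \<in> ball z e \<Longrightarrow> f' u \<in> N"
    "\<And>u v. u \<in> ball z e \<Longrightarrow> v \<in> ball z e \<Longrightarrow> dist (f' u) (f' v) = hyp_dist u v"
    by (rule locisomE[OF V(4,2)], rule that)
  have eq: "f u = f' u" if "u \<in> ball z e" for u using that e V by auto
  show "\<exists>e>0. ball z e \<subseteq> W \<and> f ` ball z e \<subseteq> N \<and> (\<forall>u\<in>ball z e. \<forall>v\<in>ball z e. dist (f u) (f v) = hyp_dist u v)"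
    using e V(3) eq by (intro exI[of _ e]) auto
qed (use assms in auto)

lemma locisom_mono:
  assumes "locisom f W" "V \<subseteq> W" "open V"
  shows "locisom f V"
  unfolding locisom_def
proof (intro conjI ballI)
  fix z assume z: "z \<in> V"
  then obtain e where e: "e > 0" "ball z e \<subseteq> W" "\<And>u. u \<in> ball z e \<Longrightarrow> f u \<in> N"
    "\<And>u v. u \<in> ball z e \<Longrightarrow> v \<in> ball z e \<Longrightarrow> dist (f u) (f v) = hyp_dist u v"
    using locisomE[OF assms(1), of z] assms(2) by blast
  obtain d where d: "d > 0" "ball z d \<subseteq> V" using assms(3) z open_contains_ball by blast
  show "\<exists>e>0. ball z e \<subseteq> V \<and> f ` ball z e \<subseteq> N \<and> (\<forall>u\<in>ball z e. \<forall>v\<in>ball z e. dist (f u) (f v) = hyp_dist u v)"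
    using d e by (intro exI[of _ "min d e"]) auto
qed (use assms locisom_subset in auto)

lemma locisom_eq: "locisom f W \<Longrightarrow> (\<And>z. z \<in> W \<Longrightarrow> f' z = f z) \<Longrightarrow> locisom f' W"
  by (rule locisomI[OF locisom_subset]) (use locisom_open in blast)+

lemma isometric_locisom:
  assumes "open W" "W \<subseteq> UH" "\<And>u. u \<in> W \<Longrightarrow> f u \<in> N"
    "\<And>u v. u \<in> W \<Longrightarrow> v \<in> W \<Longrightarrow> dist (f u) (f v) = hyp_dist u v"
  shows "locisom f W"
  unfolding locisom_def
proof (intro conjI ballI)
  fix z assume "z \<in> W"
  then obtain e where "e > 0" "ball z e \<subseteq> W" using assms(1) open_contains_ball by blast
  then show "\<exists>e>0. ball z e \<subseteq> W \<and> f ` ball z e \<subseteq> N \<and> (\<forall>u\<in>ball z e. \<forall>v\<in>ball z e. dist (f u) (f v) = hyp_dist u v)"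
    using assms(3,4) by (intro exI[of _ e]) blast
qed fact

lemma locisom_continuous:
  assumes "locisom f W" shows "continuous_on W f"
proof (rule continuous_at_imp_continuous_on, rule ballI)
  fix z assume z: "z \<in> W"
  obtain e where e: "e > 0" "ball z e \<subseteq> W" "\<And>u. u \<in> ball z e \<Longrightarrow> f u \<in> N"
    "\<And>u v. u \<in> ball z e \<Longrightarrow> v \<in> ball z e \<Longrightarrow> dist (f u) (f v) = hyp_dist u v"
    by (rule locisomE[OF assms z], rule that)
  have zU: "z \<in> UH" using z assms locisom_subset by blast
  show "isCont f z" unfolding continuous_at_eps_delta
  proof (intro allI impI)
    fix r :: real assume "r > 0"
    then obtain d where d: "d > 0" "\<And>w. w \<in> ball z d \<Longrightarrow> hyp_dist z w < r"
      using hyp_dist_nhd[OF zU] by metis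
    show "\<exists>d>0. \<forall>x'. dist x' z < d \<longrightarrow> dist (f x') (f z) < r"
    proof (intro exI[of _ "min d e"] conjI allI impI)
      fix x assume x: "dist x z < min d e"
      then have "x \<in> ball z e" "z \<in> ball z e" "x \<in> ball z d" using e by (auto simp: dist_commute)
      then have "dist (f z) (f x) < r" using e(4)[of z x] d(2)[of x] by simp
      then show "dist (f x) (f z) < r" by (simp add: dist_commute)
    qed (use d e in auto)
  qed
qed

lemma locisom_comp:
  assumes "locisom f W" "g \<in> Isom"
  shows "locisom (\<lambda>z. f (g z)) {z\<in>UH. g z \<in> W}"
  unfolding locisom_def
proof (intro conjI ballI)
  fix z assume z: "z \<in> {z\<in>UH. g z \<in> W}"
  then obtain e where e: "e > 0" "ball (g z) e \<subseteq> W" "\<And>u. u \<in> ball (g z) e \<Longrightarrow> f u \<in> N"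
    "\<And>u v. u \<in> ball (g z) e \<Longrightarrow> v \<in> ball (g z) e \<Longrightarrow> dist (f u) (f v) = hyp_dist u v"
    using locisomE[OF assms(1), of "g z"] by blast
  have zg: "z \<in> UH" "g z \<in> ball (g z) e" using z e by auto
  obtain d where d: "d > 0" "ball z d \<subseteq> UH \<inter> g -` ball (g z) e"
    by (rule Isom_preimage_ball[OF assms(2) zg], rule that)
  have *: "u \<in> UH \<and> g u \<in> ball (g z) e" if "u \<in> ball z d" for u using that d by blast
  have "dist (f (g u)) (f (g v)) = hyp_dist u v" if "u \<in> ball z d" "v \<in> ball z d" for u v
    using *[OF that(1)] *[OF that(2)] e(4) hyp_dist_Isom[OF assms(2)] by simp
  then show "\<exists>e>0. ball z e \<subseteq> {z \<in> UH. g z \<in> W} \<and> (\<lambda>z. f (g z)) ` ball z e \<subseteq> N \<and>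
     (\<forall>u\<in>ball z e. \<forall>v\<in>ball z e. dist (f (g u)) (f (g v)) = hyp_dist u v)"
    using d * e by (intro exI[of _ d]) blast
qed auto

text \<open>Read in a chart about the common value, both maps are hyperbolic isometries by
  \<open>isometry_extends\<close>; \<open>g\<close> is the first of them followed by the inverse of
  the second.\<close>

lemma germ_comparison:
  assumes f: "locisom f W" "z \<in> W" and f': "locisom f' W'" "z' \<in> W'" and eq: "f z = f' z'"
  obtains g d where "g \<in> Isom" "d > 0" "g z = z'" "ball z d \<subseteq> W"
    "\<And>u. u \<in> ball z d \<Longrightarrow> g u \<in> W' \<and> f u = f' (g u)"
proof -
  have pN: "f z \<in> N" using f locisom_in by blast
  obtain c e r \<psi> \<phi> where e: "e > 0" "r > 0" "ball c e \<subseteq> UH" "\<psi> c = f z"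
    "\<And>u. u \<in> ball c e \<Longrightarrow> \<psi> u \<in> N \<and> \<phi> (\<psi> u) = u"
    "\<And>u v. u \<in> ball c e \<Longrightarrow> v \<in> ball c e \<Longrightarrow> dist (\<psi> u) (\<psi> v) = hyp_dist u v"
    "\<And>x. x \<in> N \<Longrightarrow> dist (f z) x < r \<Longrightarrow> \<phi> x \<in> ball c e \<and> \<psi> (\<phi> x) = x"
    by (rule chart_inverse[OF pN], rule that)
  have loc: "\<exists>g\<in>Isom. \<exists>d>0. ball y d \<subseteq> V \<and> (\<forall>u\<in>ball y d. \<phi> (h u) = g u \<and> h u = \<psi> (g u))
       \<and> (\<forall>u\<in>ball y d. \<forall>v\<in>ball y d. h u = h v \<longrightarrow> u = v)"
    if h: "locisom h V" "y \<in> V" "h y = f z" for h V y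
  proof -
    obtain d1 where d1: "d1 > 0" "ball y d1 \<subseteq> V" "\<And>u. u \<in> ball y d1 \<Longrightarrow> h u \<in> N"
      "\<And>u v. u \<in> ball y d1 \<Longrightarrow> v \<in> ball y d1 \<Longrightarrow> dist (h u) (h v) = hyp_dist u v"
      by (rule locisomE[OF h(1,2)], rule that)
    have yU: "y \<in> UH" using h locisom_subset by blast
    obtain d2 where d2: "d2 > 0" "ball y d2 \<subseteq> UH" "\<And>w. w \<in> ball y d2 \<Longrightarrow> hyp_dist y w < r"
      using hyp_dist_nhd[OF yU e(2)] by blast
    define B where "B = ball y (min d1 d2)"
    have B: "open B" "y \<in> B" "B \<subseteq> UH" "B \<subseteq> ball y d1" using d1 d2 by (auto simp: B_def)
    have hB: "\<phi> (h u) \<in> ball c e \<and> \<psi> (\<phi> (h u)) = h u" if "u \<in> B" for u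
    proof (rule e(7))
      show "h u \<in> N" using that B d1 by auto
      have "u \<in> ball y d1" "u \<in> ball y d2" "y \<in> ball y d1" using that d1 by (auto simp: B_def)
      then show "dist (f z) (h u) < r" using d1(4)[of y u] d2(3)[of u] h(3) by simp
    qed
    obtain g where g: "g \<in> Isom" "\<And>u. u \<in> B \<Longrightarrow> \<phi> (h u) = g u"
    proof (rule isometry_extends[OF B(1) _ B(3), of "\<lambda>u. \<phi> (h u)"])
      show "(\<lambda>u. \<phi> (h u)) ` B \<subseteq> UH" using hB e(3) by blast
      fix u v assume uv: "u \<in> B" "v \<in> B"
      then have "hyp_dist (\<phi> (h u)) (\<phi> (h v)) = dist (h u) (h v)" using hB e(6) by metis
      then show "hyp_dist (\<phi> (h u)) (\<phi> (h v)) = hyp_dist u v" using uv B d1(4) by (metis subsetD)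
    qed (use B in auto)
    have inj: "u = v" if "u \<in> B" "v \<in> B" "h u = h v" for u v
    proof -
      have "u \<in> ball y d1" "v \<in> ball y d1" using that B(4) by blast+
      then have "hyp_dist u v = 0" using d1(4)[of u v] that(3) by simp
      then have "hq u v = 0" using cosh_hyp_dist[of u v] that B by auto
      then show ?thesis using hq_eq_0_iff that B by blast
    qed
    show ?thesis
      using g hB d1 d2 inj by (intro bexI[of _ g] exI[of _ "min d1 d2"]) (auto simp: B_def)
  qed
  obtain g1 d1 where g1: "g1 \<in> Isom" and d1: "d1 > 0" "ball z d1 \<subseteq> W" "\<And>u. u \<in> ball z d1 \<Longrightarrow> \<phi> (f u) = g1 u \<and> f u = \<psi> (g1 u)"
    using loc[OF f refl] by blast
  obtain g2 d2 where g2: "g2 \<in> Isom" and d2: "d2 > 0" "ball z' d2 \<subseteq> W'" "\<And>u. u \<in> ball z' d2 \<Longrightarrow> \<phi> (f' u) = g2 u \<and> f' u = \<psi> (g2 u)"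
    using loc[OF f' eq[symmetric]] by blast
  obtain k where k: "k \<in> Isom" "\<And>z. z \<in> UH \<Longrightarrow> k (g2 z) = z" "\<And>z. z \<in> UH \<Longrightarrow> g2 (k z) = z"
    by (rule Isom_inv[OF g2], rule that)
  define g where "g = (\<lambda>u. k (g1 u))"
  have g: "g \<in> Isom" unfolding g_def by (rule Isom_comp[OF k(1) g1])
  have U: "z \<in> UH" "z' \<in> UH" using f f' locisom_subset by auto
  have "g1 z = g2 z'" using d1 d2 eq by (metis centre_in_ball)
  then have gz: "g z = z'" using k U by (simp add: g_def)
  have zg: "z \<in> UH" "g z \<in> ball z' d2" using U gz d2 by auto
  obtain d where d: "d > 0" "ball z d \<subseteq> UH \<inter> g -` ball z' d2"
    by (rule Isom_preimage_ball[OF g zg], rule that)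
  show ?thesis
  proof (rule that[OF g, of "min d d1"])
    fix u assume u: "u \<in> ball z (min d d1)"
    then have u': "u \<in> UH" "g u \<in> ball z' d2" "u \<in> ball z d1" using d by auto
    have "f' (g u) = \<psi> (g2 (g u))" using d2(3)[OF u'(2)] by blast
    also have "\<dots> = \<psi> (g1 u)" using k(3) Isom_UH[OF g1 u'(1)] by (simp add: g_def)
    also have "\<dots> = f u" using d1(3)[OF u'(3)] by simp
    finally show "g u \<in> W' \<and> f u = f' (g u)" using u' d2 by auto
  qed (use d d1 gz in auto)
qed

lemma locisom_inj:
  assumes "locisom f W" "z \<in> W"
  obtains d where "d > 0" "ball z d \<subseteq> W" "inj_on f (ball z d)"
proof -
  obtain e where e: "e > 0" "ball z e \<subseteq> W" "\<And>u. u \<in> ball z e \<Longrightarrow> f u \<in> N"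
    "\<And>u v. u \<in> ball z e \<Longrightarrow> v \<in> ball z e \<Longrightarrow> dist (f u) (f v) = hyp_dist u v"
    by (rule locisomE[OF assms], rule that)
  have "inj_on f (ball z e)"
  proof
    fix u v assume uv: "u \<in> ball z e" "v \<in> ball z e" "f u = f v"
    have U: "u \<in> UH" "v \<in> UH" using uv e(2) locisom_subset[OF assms(1)] by auto
    have "hyp_dist u v = 0" using e(4)[OF uv(1,2)] uv(3) by simp
    then show "u = v" using cosh_hyp_dist[OF U] hq_eq_0_iff[OF U] by simp
  qed
  then show ?thesis using that e by blast
qed

text \<open>The identity principle for local isometries: the interior of the set of agreement is
  open and closed in \<open>W\<close>.\<close>

lemma locisom_unique:
  assumes f: "locisom f W" and f': "locisom f' W" and W: "connected W"
    and z0: "z0 \<in> W" "d0 > 0" "\<And>u. u \<in> ball z0 d0 \<Longrightarrow> u \<in> W \<Longrightarrow> f u = f' u" and z: "z \<in> W"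
  shows "f z = f' z"
proof -
  have oW: "open W" using f locisom_open by blast
  have WU: "W \<subseteq> UH" using f locisom_subset by blast
  define A where "A = {z\<in>W. \<exists>d>0. \<forall>u\<in>ball z d. f u = f' u}"
  have "open A" unfolding open_contains_ball
  proof
    fix z assume "z \<in> A"
    then obtain d where d: "z \<in> W" "d > 0" "\<forall>u\<in>ball z d. f u = f' u" by (auto simp: A_def)
    obtain e where e: "e > 0" "ball z e \<subseteq> W" using oW d(1) open_contains_ball by blast
    have "x \<in> A" if x: "x \<in> ball z (min d e)" for x
    proof -
      obtain e' where "e' > 0" "ball x e' \<subseteq> ball z (min d e)" using x by (meson open_ball open_contains_ball)
      then show ?thesis using d e x by (fastforce simp: A_def)
    qed
    then show "\<exists>e>0. ball z e \<subseteq> A" using d e by (intro exI[of _ "min d e"]) auto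
  qed
  moreover have "open (W - A)" unfolding open_contains_ball
  proof
    fix z assume zWA: "z \<in> W - A"
    then have zW: "z \<in> W" by simp
    show "\<exists>e>0. ball z e \<subseteq> W - A"
    proof (cases "f z = f' z")
      case False
      have "continuous_on W (\<lambda>z. dist (f z) (f' z))"
        using locisom_continuous[OF f] locisom_continuous[OF f'] by (intro continuous_intros)
      then have "open (W \<inter> (\<lambda>z. dist (f z) (f' z)) -` {0<..})"
        using continuous_open_preimage[OF _ oW open_greaterThan] by blast
      moreover have "z \<in> W \<inter> (\<lambda>z. dist (f z) (f' z)) -` {0<..}" using zW False by auto
      ultimately obtain e where e: "e > 0" "ball z e \<subseteq> W \<inter> (\<lambda>z. dist (f z) (f' z)) -` {0<..}"
        using open_contains_ball by blast
      have "ball z e \<subseteq> W - A"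
      proof
        fix x assume x: "x \<in> ball z e"
        then have "x \<in> W" "f x \<noteq> f' x" using e by auto
        then show "x \<in> W - A" by (auto simp: A_def)
      qed
      then show ?thesis using e by blast
    next
      case True
      \<comment> \<open>Here \<open>f\<close> is \<open>f'\<close> after an isometry
        \<open>g\<close> that fixes \<open>z\<close>. If the maps agreed on some open set close to
        \<open>z\<close>, injectivity of \<open>f'\<close> would make \<open>g\<close> the identity
        there, hence everywhere, and \<open>z\<close> would belong to \<open>A\<close>.\<close>
      obtain g d where g: "g \<in> Isom" "d > 0" "g z = z" "ball z d \<subseteq> W"
        "\<And>u. u \<in> ball z d \<Longrightarrow> g u \<in> W \<and> f u = f' (g u)"
        by (rule germ_comparison[OF f zW f' zW True], rule that)
      obtain e where e: "e > 0" "ball z e \<subseteq> W" "inj_on f' (ball z e)"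
        by (rule locisom_inj[OF f' zW], rule that)
      have zU: "z \<in> UH" using WU zW by auto
      have zg: "z \<in> UH" "g z \<in> ball z e" using zU g e by auto
      obtain d' where d': "d' > 0" "ball z d' \<subseteq> UH \<inter> g -` ball z e"
        by (rule Isom_preimage_ball[OF g(1) zg], rule that)
      define t where "t = min d (min e d')"
      have t: "t > 0" "ball z t \<subseteq> ball z d" "ball z t \<subseteq> ball z e" "ball z t \<subseteq> ball z d'"
        using g e d' by (auto simp: t_def)
      have "ball z t \<inter> A = {}"
      proof (rule ccontr)
        assume "ball z t \<inter> A \<noteq> {}"
        then obtain y s where y: "y \<in> ball z t" "s > 0" "\<forall>u\<in>ball y s. f u = f' u" by (auto simp: A_def)
        have "g u = u" if "u \<in> UH" for u
        proof (rule Isom_eq[OF g(1) subsetD[OF Isop_subset id_Isop] _ _ _ _ that])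
          show "open (ball z t \<inter> ball y s)" by auto
          show "ball z t \<inter> ball y s \<noteq> {}" using y by auto
          show "ball z t \<inter> ball y s \<subseteq> UH" using t d' by auto
          fix u assume u: "u \<in> ball z t \<inter> ball y s"
          then have "f' (g u) = f' u" using g(5)[of u] y(3) t by auto
          moreover have "g u \<in> ball z e" "u \<in> ball z e" using u t d' by blast+
          ultimately show "g u = u" using e(3) by (meson inj_onD)
        qed
        then have "\<forall>u\<in>ball z d. f u = f' u" using g(4,5) WU by (metis subsetD)
        then show False using zWA g(2) by (auto simp: A_def)
      qed
      then show ?thesis using t e by (intro exI[of _ t]) auto
    qed
  qed
  moreover have "A \<subseteq> W" by (auto simp: A_def)
  moreover have "z0 \<in> A"
  proof -
    obtain e where e: "e > 0" "ball z0 e \<subseteq> W" using oW z0(1) open_contains_ball by blast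
    have "\<forall>u\<in>ball z0 (min d0 e). f u = f' u" using e z0(3) by auto
    then show ?thesis using z0 e unfolding A_def by (intro CollectI conjI exI[of _ "min d0 e"]) auto
  qed
  ultimately have "A = W"
    using connectedD[OF W, of A "W - A"] by blast
  then have "z \<in> A" using z by simp
  then obtain d where "d > 0" "\<forall>u\<in>ball z d. f u = f' u" by (auto simp: A_def)
  then show ?thesis by simp
qed

end

section \<open>Extension of local isometries to the whole half plane\<close>

context hyperbolic_surface
begin

text \<open>Short pieces of the segment from \<open>u\<close> to \<open>v\<close> satisfy the bound
  by the local isometry property and \<open>hyp_dist_le\<close>; the triangle inequality adds them
  up.\<close>

lemma locisom_lipschitz:
  assumes f: "locisom f K" and K: "convex K" "\<And>z. z \<in> K \<Longrightarrow> m \<le> Im z" and m: "m > 0" and uv: "u \<in> K" "v \<in> K"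
  shows "dist (f u) (f v) \<le> cmod (u - v) / m"
proof -
  define c where "c t = u + of_real t * (v - u)" for t :: real
  have cK: "c t \<in> K" if "0 \<le> t" "t \<le> 1" for t
  proof -
    have "c t = (1 - t) *\<^sub>R u + t *\<^sub>R v" by (simp add: c_def scaleR_conv_of_real algebra_simps)
    then show ?thesis using K(1) uv that by (simp add: convex_alt)
  qed
  have cd: "cmod (c a - c b) = \<bar>a - b\<bar> * cmod (u - v)" for a b
  proof -
    have "c a - c b = of_real (a - b) * (v - u)" by (simp add: c_def algebra_simps)
    then have "cmod (c a - c b) = \<bar>a - b\<bar> * cmod (v - u)" by (simp only: norm_mult norm_of_real)
    then show ?thesis by (simp add: norm_minus_commute)
  qed
  \<comment> \<open>The guards make \<open>P\<close> vacuous for intervals that leave the unit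
    interval, since \<open>Bolzano\<close> tests every short interval around a point.\<close>
  define P where "P a b \<longleftrightarrow> (0 \<le> a \<longrightarrow> b \<le> 1 \<longrightarrow> dist (f (c a)) (f (c b)) \<le> (b - a) * cmod (u - v) / m)" for a b
  have "P 0 1"
  proof (rule Bolzano)
    show "(0::real) \<le> 1" by simp
  next
    fix a b d assume *: "P a b" "P b d" "a \<le> b" "b \<le> d"
    show "P a d" unfolding P_def
    proof (intro impI)
      assume "0 \<le> a" "d \<le> 1"
      then have "dist (f (c a)) (f (c b)) \<le> (b - a) * cmod (u - v) / m"
         "dist (f (c b)) (f (c d)) \<le> (d - b) * cmod (u - v) / m" using * by (auto simp: P_def)
      then have "dist (f (c a)) (f (c d)) \<le> (b - a) * cmod (u - v) / m + (d - b) * cmod (u - v) / m"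
        using dist_triangle[of "f (c a)" "f (c d)" "f (c b)"] by linarith
      also have "\<dots> = (d - a) * cmod (u - v) / m" by (simp add: add_divide_distrib[symmetric] algebra_simps)
      finally show "dist (f (c a)) (f (c d)) \<le> (d - a) * cmod (u - v) / m" .
    qed
  next
    fix x :: real assume x: "0 \<le> x" "x \<le> 1"
    obtain e where e: "e > 0" "ball (c x) e \<subseteq> K" "\<And>u. u \<in> ball (c x) e \<Longrightarrow> f u \<in> N"
      "\<And>u v. u \<in> ball (c x) e \<Longrightarrow> v \<in> ball (c x) e \<Longrightarrow> dist (f u) (f v) = hyp_dist u v"
      by (rule locisomE[OF f cK[OF x]], rule that)
    define d where "d = e / (cmod (u - v) + 1)"
    have d: "d > 0" using e by (simp add: d_def add_nonneg_pos)
    have near: "c a \<in> ball (c x) e" if "\<bar>x - a\<bar> < d" for a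
    proof -
      have "\<bar>x - a\<bar> * cmod (u - v) \<le> \<bar>x - a\<bar> * (cmod (u - v) + 1)" by (intro mult_left_mono) auto
      also have "\<dots> < d * (cmod (u - v) + 1)" using that by (intro mult_strict_right_mono) (auto simp: add_nonneg_pos)
      also have "\<dots> = e"
      proof -
        have "cmod (u - v) + 1 \<noteq> 0" using norm_ge_zero[of "u - v"] by linarith
        then show ?thesis by (simp add: d_def)
      qed
      finally show ?thesis by (simp add: dist_norm cd)
    qed
    show "\<exists>d>0. \<forall>a b. a \<le> x \<and> x \<le> b \<and> b - a < d \<longrightarrow> P a b"
    proof (intro exI[of _ d] conjI allI impI d)
      fix a b assume ab: "a \<le> x \<and> x \<le> b \<and> b - a < d"
      show "P a b" unfolding P_def
      proof (intro impI)
        assume "0 \<le> a" "b \<le> 1"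
        then have k: "c a \<in> K" "c b \<in> K" using ab x by (auto intro!: cK)
        have "dist (f (c a)) (f (c b)) = hyp_dist (c a) (c b)"
          using ab by (intro e(4) near) auto
        also have "\<dots> \<le> cmod (c a - c b) / m"
          using k K(2) m locisom_subset[OF f] by (intro hyp_dist_le) auto
        also have "\<dots> = (b - a) * cmod (u - v) / m" using ab by (simp add: cd)
        finally show "dist (f (c a)) (f (c b)) \<le> (b - a) * cmod (u - v) / m" .
      qed
    qed
  qed
  then show ?thesis by (simp add: P_def c_def)
qed

text \<open>Completeness of the surface enters here: by the Lipschitz bound the images of a sequence
  tending to \<open>w\<close> converge. In a chart about their limit \<open>f\<close> is a single
  isometry \<open>g\<close>, because the part of \<open>K\<close> near \<open>w\<close> is convex
  and so connected, and \<open>g\<close> is defined at \<open>w\<close> as well.\<close>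

lemma extension_at_limit_point:
  assumes K: "convex K" and w: "w \<in> closure K" "w \<in> UH" and f: "locisom f K"
    and m: "m > 0" "\<And>z. z \<in> K \<Longrightarrow> m \<le> Im z"
  shows "\<exists>r>0. \<exists>F. locisom F (ball w r) \<and> (\<forall>u\<in>ball w r \<inter> K. F u = f u)"
proof -
  have lip: "dist (f u) (f v) \<le> cmod (u - v) / m" if "u \<in> K" "v \<in> K" for u v
    by (rule locisom_lipschitz[OF f K _ m(1) that]) (rule m(2))
  have KU: "K \<subseteq> UH" using locisom_subset[OF f] .
  obtain zs where zs: "\<And>n. zs n \<in> K" "zs \<longlonglongrightarrow> w" using w(1) closure_sequential by blast
  have "Cauchy (\<lambda>n. f (zs n))"
    unfolding Cauchy_def
  proof (intro allI impI)
    fix e :: real assume e: "e > 0"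
    have "Cauchy zs" using zs(2) LIMSEQ_imp_Cauchy by blast
    moreover have "e * m > 0" using e m(1) by simp
    ultimately obtain M where M: "\<forall>i\<ge>M. \<forall>j\<ge>M. dist (zs i) (zs j) < e * m"
      using metric_CauchyD by blast
    have "dist (f (zs i)) (f (zs j)) < e" if "i \<ge> M" "j \<ge> M" for i j
    proof -
      have "cmod (zs i - zs j) / m < e" using M that m(1) by (simp add: dist_norm divide_less_eq)
      then show ?thesis using lip[OF zs(1) zs(1), of i j] by linarith
    qed
    then show "\<exists>M. \<forall>i\<ge>M. \<forall>j\<ge>M. dist (f (zs i)) (f (zs j)) < e" by blast
  qed
  moreover have "\<forall>n. f (zs n) \<in> N" using zs(1) locisom_in[OF f] by blast
  ultimately obtain y where y: "y \<in> N" "(\<lambda>n. f (zs n)) \<longlonglongrightarrow> y"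
    using complete[unfolded complete_def, rule_format, of "\<lambda>n. f (zs n)"] by blast
  obtain c e r \<psi> \<phi> where e: "e > 0" "r > 0" "ball c e \<subseteq> UH" "\<psi> c = y"
    "\<And>u. u \<in> ball c e \<Longrightarrow> \<psi> u \<in> N \<and> \<phi> (\<psi> u) = u"
    "\<And>u v. u \<in> ball c e \<Longrightarrow> v \<in> ball c e \<Longrightarrow> dist (\<psi> u) (\<psi> v) = hyp_dist u v"
    "\<And>x. x \<in> N \<Longrightarrow> dist y x < r \<Longrightarrow> \<phi> x \<in> ball c e \<and> \<psi> (\<phi> x) = x"
    by (rule chart_inverse[OF y(1)], rule that)
  have dy: "dist y (f u) \<le> cmod (w - u) / m" if "u \<in> K" for u
  proof (rule LIMSEQ_le)
    show "(\<lambda>n. dist (f (zs n)) (f u)) \<longlonglongrightarrow> dist y (f u)" by (intro tendsto_intros y)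
    show "(\<lambda>n. cmod (zs n - u) / m) \<longlonglongrightarrow> cmod (w - u) / m" using m by (intro tendsto_intros zs) auto
    show "\<exists>N. \<forall>n\<ge>N. dist (f (zs n)) (f u) \<le> cmod (zs n - u) / m" using lip[OF zs(1) that] by blast
  qed
  define r1 where "r1 = m * r"
  have r1: "r1 > 0" using m e by (simp add: r1_def)
  define V where "V = ball w r1 \<inter> K"
  have oV: "open V" unfolding V_def using locisom_open[OF f] by auto
  have VU: "V \<subseteq> UH" using KU by (auto simp: V_def)
  have h: "\<phi> (f u) \<in> ball c e \<and> \<psi> (\<phi> (f u)) = f u" if "u \<in> V" for u
  proof (rule e(7))
    show "f u \<in> N" using that locisom_in[OF f] by (auto simp: V_def)
    have "dist y (f u) \<le> cmod (w - u) / m" using dy that by (auto simp: V_def)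
    also have "\<dots> < r" using that m by (simp add: V_def dist_norm r1_def divide_less_eq mult.commute)
    finally show "dist y (f u) < r" .
  qed
  have "connected V" unfolding V_def using K by (intro convex_connected convex_Int) auto
  moreover obtain v0 where v0: "v0 \<in> V"
    using w(1) r1 closure_approachable[of w K] by (auto simp: V_def dist_commute)
  moreover have "\<exists>d>0. \<exists>g\<in>Isom. ball z d \<subseteq> V \<and> (\<forall>u\<in>ball z d. \<phi> (f u) = g u)" if z: "z \<in> V" for z
  proof -
    have zK: "z \<in> K" using z by (simp add: V_def)
    obtain d1 where d1: "d1 > 0" "ball z d1 \<subseteq> K" "\<And>u. u \<in> ball z d1 \<Longrightarrow> f u \<in> N"
      "\<And>u v. u \<in> ball z d1 \<Longrightarrow> v \<in> ball z d1 \<Longrightarrow> dist (f u) (f v) = hyp_dist u v"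
      by (rule locisomE[OF f zK], rule that)
    obtain d2 where d2: "d2 > 0" "ball z d2 \<subseteq> V" using oV z open_contains_ball by blast
    define B where "B = ball z (min d1 d2)"
    have B: "open B" "B \<noteq> {}" "B \<subseteq> V" "B \<subseteq> ball z d1" using d1 d2 by (auto simp: B_def)
    obtain g where g: "g \<in> Isom" "\<And>u. u \<in> B \<Longrightarrow> \<phi> (f u) = g u"
    proof (rule isometry_extends[OF B(1,2), of "\<lambda>u. \<phi> (f u)"])
      show "B \<subseteq> UH" using B(3) VU by blast
      show "(\<lambda>u. \<phi> (f u)) ` B \<subseteq> UH" using h e(3) B(3) by blast
      fix u v assume uv: "u \<in> B" "v \<in> B"
      then have "hyp_dist (\<phi> (f u)) (\<phi> (f v)) = dist (f u) (f v)" using h e(6) B(3) by (metis subsetD)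
      then show "hyp_dist (\<phi> (f u)) (\<phi> (f v)) = hyp_dist u v" using uv B(4) d1(4) by (metis subsetD)
    qed (rule that)
    then show ?thesis using d1 d2 B(3) by (intro exI[of _ "min d1 d2"]) (auto simp: B_def)
  qed
  ultimately obtain g where g: "g \<in> Isom" "\<And>z. z \<in> V \<Longrightarrow> \<phi> (f z) = g z"
    using Isom_locally_const[of V v0 "\<lambda>u. \<phi> (f u)"] VU that by blast
  have "eventually (\<lambda>n. dist (zs n) w < r1) sequentially" using zs(2) r1 by (rule tendstoD)
  then have ev: "eventually (\<lambda>n. zs n \<in> V) sequentially"
    by eventually_elim (use zs(1) in \<open>auto simp: V_def dist_commute\<close>)
  have cU: "c \<in> UH" using e by auto
  have "(\<lambda>n. \<phi> (f (zs n))) \<longlonglongrightarrow> c"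
  proof (rule tendstoI)
    fix \<epsilon> :: real assume "\<epsilon> > 0"
    then obtain d where d: "d > 0" "\<And>w. w \<in> UH \<Longrightarrow> hyp_dist c w < d \<Longrightarrow> cmod (c - w) < \<epsilon>"
      using hyp_dist_small[OF cU] by metis
    have "eventually (\<lambda>n. dist (f (zs n)) y < d) sequentially" using y(2) d(1) by (rule tendstoD)
    with ev show "eventually (\<lambda>n. dist (\<phi> (f (zs n))) c < \<epsilon>) sequentially"
    proof eventually_elim
      case (elim n)
      have h': "\<phi> (f (zs n)) \<in> ball c e" "\<psi> (\<phi> (f (zs n))) = f (zs n)" using h[OF elim(1)] by auto
      have "hyp_dist c (\<phi> (f (zs n))) = dist y (f (zs n))"
        using e(6)[of c "\<phi> (f (zs n))"] h' e(1,4) by simp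
      then have "cmod (c - \<phi> (f (zs n))) < \<epsilon>" using d(2) elim(2) h'(1) e(3) by (auto simp: dist_commute)
      then show ?case by (simp add: dist_norm norm_minus_commute)
    qed
  qed
  moreover have "eventually (\<lambda>n. \<phi> (f (zs n)) = g (zs n)) sequentially"
    using ev by eventually_elim (rule g(2))
  ultimately have "(\<lambda>n. g (zs n)) \<longlonglongrightarrow> c" by (simp add: tendsto_cong)
  moreover have "(\<lambda>n. g (zs n)) \<longlonglongrightarrow> g w"
  proof -
    have "isCont g w" using continuous_on_Isom[OF g(1)] w(2) open_UH by (simp add: continuous_on_eq_continuous_at)
    then show ?thesis using zs(2) isCont_tendsto_compose by blast
  qed
  \<comment> \<open>\<open>g\<close> sends \<open>w\<close> to the centre of the chart, so it sends
    a whole ball about \<open>w\<close> into the domain of \<open>\<psi>\<close>.\<close>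
  ultimately have gw: "g w = c" using LIMSEQ_unique by blast
  have zg: "w \<in> UH" "g w \<in> ball c e" using w(2) gw e by auto
  obtain r2 where r2: "r2 > 0" "ball w r2 \<subseteq> UH \<inter> g -` ball c e"
    by (rule Isom_preimage_ball[OF g(1) zg], rule that)
  define r' where "r' = min r1 r2"
  have gr: "u \<in> UH" "g u \<in> ball c e" if "u \<in> ball w r'" for u
    using that r2(2) by (auto simp: r'_def subset_iff)
  have "locisom (\<lambda>u. \<psi> (g u)) (ball w r')"
  proof (rule isometric_locisom)
    show "ball w r' \<subseteq> UH" using gr by blast
    show "\<psi> (g u) \<in> N" if "u \<in> ball w r'" for u using gr[OF that] e(5) by blast
    show "dist (\<psi> (g u)) (\<psi> (g v)) = hyp_dist u v" if "u \<in> ball w r'" "v \<in> ball w r'" for u v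
      using gr[OF that(1)] gr[OF that(2)] e(6) hyp_dist_Isom[OF g(1)] by simp
  qed simp
  moreover have "\<forall>u\<in>ball w r' \<inter> K. \<psi> (g u) = f u"
  proof
    fix u assume "u \<in> ball w r' \<inter> K"
    then have "u \<in> V" by (auto simp: V_def r'_def)
    then show "\<psi> (g u) = f u" using g(2) h by metis
  qed
  moreover have "r' > 0" using r1 r2 by (simp add: r'_def)
  ultimately show ?thesis by blast
qed

text \<open>A Lebesgue number for the compact closure gives one radius for all local extensions, and
  they agree on overlaps.\<close>

lemma extension_nhd:
  assumes K: "convex K" "bounded K" "closure K \<subseteq> UH" and f: "locisom f K"
  obtains \<eta> F where "\<eta> > 0" "locisom F (\<Union>w\<in>K. ball w \<eta>)" "\<And>z. z \<in> K \<Longrightarrow> F z = f z"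
proof (cases "K = {}")
  case True
  then show ?thesis using that[of 1 f] by (simp add: locisom_def)
next
  case False
  have comp: "compact (closure K)" using K(2) by (simp add: compact_closure)
  have "continuous_on (closure K) Im" by (intro continuous_intros)
  moreover have "closure K \<noteq> {}" using False by simp
  ultimately obtain z0 where z0: "z0 \<in> closure K" "\<forall>z\<in>closure K. Im z0 \<le> Im z"
    using continuous_attains_inf[OF comp] by blast
  have m: "Im z0 > 0" using z0(1) K(3) by (auto simp: UH_iff)
  have oK: "open K" using locisom_open[OF f] .
  have ext: "\<exists>r>0. \<exists>F. locisom F (ball w r) \<and> (\<forall>u\<in>ball w r \<inter> K. F u = f u)" if w: "w \<in> closure K" for w
  proof (rule extension_at_limit_point[OF K(1) w _ f m])
    show "w \<in> UH" using w K(3) by blast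
    show "Im z0 \<le> Im z" if "z \<in> K" for z using z0(2) that closure_subset by fast
  qed
  define \<G> where "\<G> = {ball w r | w r. \<exists>F. locisom F (ball w r) \<and> (\<forall>u\<in>ball w r \<inter> K. F u = f u)}"
  have cover: "closure K \<subseteq> \<Union>\<G>"
  proof
    fix w assume "w \<in> closure K"
    then obtain r F where "r > 0" "locisom F (ball w r)" "\<forall>u\<in>ball w r \<inter> K. F u = f u" using ext by blast
    then have "ball w r \<in> \<G>" "w \<in> ball w r" by (auto simp: \<G>_def)
    then show "w \<in> \<Union>\<G>" by blast
  qed
  have "\<exists>\<eta>>0. \<forall>x\<in>closure K. \<exists>G\<in>\<G>. ball x \<eta> \<subseteq> G"
  proof (rule Heine_Borel_lemma[OF comp cover])
    show "open G" if "G \<in> \<G>" for G using that by (auto simp: \<G>_def)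
    fix \<eta> :: real assume "\<eta> > 0" "\<And>x. x \<in> closure K \<Longrightarrow> \<exists>G\<in>\<G>. ball x \<eta> \<subseteq> G"
    then show "\<exists>\<eta>>0. \<forall>x\<in>closure K. \<exists>G\<in>\<G>. ball x \<eta> \<subseteq> G" by blast
  qed
  then obtain \<eta> where \<eta>: "\<eta> > 0" "\<forall>x\<in>closure K. \<exists>G\<in>\<G>. ball x \<eta> \<subseteq> G" by blast
  have "\<exists>F. locisom F (ball w \<eta>) \<and> (\<forall>u\<in>ball w \<eta> \<inter> K. F u = f u)" if wK: "w \<in> K" for w
  proof -
    have "w \<in> closure K" using wK closure_subset by blast
    then obtain G where G: "G \<in> \<G>" "ball w \<eta> \<subseteq> G" using \<eta>(2) by blast
    then obtain F where "locisom F G" "\<forall>u\<in>G \<inter> K. F u = f u" unfolding \<G>_def by blast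
    then show ?thesis using locisom_mono[of F G "ball w \<eta>"] G(2) by blast
  qed
  then obtain H where "\<forall>w\<in>K. locisom (H w) (ball w \<eta>) \<and> (\<forall>u\<in>ball w \<eta> \<inter> K. H w u = f u)"
    using bchoice[of K "\<lambda>w F. locisom F (ball w \<eta>) \<and> (\<forall>u\<in>ball w \<eta> \<inter> K. F u = f u)"] by blast
  then have H: "\<And>w. w \<in> K \<Longrightarrow> locisom (H w) (ball w \<eta>)" "\<And>w u. w \<in> K \<Longrightarrow> u \<in> ball w \<eta> \<inter> K \<Longrightarrow> H w u = f u"
    by blast+
  have cons: "H w z = H w' z" if w: "w \<in> K" "w' \<in> K" and z: "z \<in> ball w \<eta>" "z \<in> ball w' \<eta>" for w w' z
  proof -
    define I where "I = ball w \<eta> \<inter> ball w' \<eta>"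
    \<comment> \<open>The midpoint lies in both balls and, by convexity, in \<open>K\<close>. Near
      it both extensions equal \<open>f\<close>, and uniqueness spreads this over the
      overlap.\<close>
    define q where "q = midpoint w w'"
    have "dist w w' < 2 * \<eta>" using z dist_triangle_less_add[of w z \<eta> w' \<eta>] by (simp add: dist_commute)
    then have qI: "q \<in> I" by (simp add: I_def q_def dist_midpoint)
    have qK: "q \<in> K" unfolding q_def
      using K(1) w midpoint_in_closed_segment unfolding convex_contains_segment by blast
    obtain d where d: "d > 0" "ball q d \<subseteq> K" using oK qK open_contains_ball by blast
    have "open I" by (auto simp: I_def)
    show ?thesis
    proof (rule locisom_unique[of "H w" I "H w'" q d])
      show "locisom (H w) I" "locisom (H w') I"
        using locisom_mono[OF H(1)] w \<open>open I\<close> by (auto simp: I_def)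
      show "connected I" unfolding I_def by (intro convex_connected convex_Int) auto
      show "q \<in> I" "z \<in> I" using qI z by (auto simp: I_def)
      show "d > 0" by fact
      show "H w u = H w' u" if "u \<in> ball q d" "u \<in> I" for u
        using that d H(2)[OF w(1), of u] H(2)[OF w(2), of u] by (auto simp: I_def)
    qed
  qed
  define F where "F z = H (SOME w. w \<in> K \<and> z \<in> ball w \<eta>) z" for z
  have F: "F z = H w z" if "w \<in> K" "z \<in> ball w \<eta>" for w z
  proof -
    have "(SOME w. w \<in> K \<and> z \<in> ball w \<eta>) \<in> K \<and> z \<in> ball (SOME w. w \<in> K \<and> z \<in> ball w \<eta>) \<eta>"
      by (rule someI[of "\<lambda>w. w \<in> K \<and> z \<in> ball w \<eta>" w]) (use that in auto)
    then show ?thesis unfolding F_def using cons that by blast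
  qed
  show ?thesis
  proof (rule that[OF \<eta>(1)])
    show "locisom F (\<Union>w\<in>K. ball w \<eta>)"
    proof (rule locisomI)
      show "(\<Union>w\<in>K. ball w \<eta>) \<subseteq> UH" using H(1) locisom_subset by blast
      fix z assume "z \<in> (\<Union>w\<in>K. ball w \<eta>)"
      then obtain w where w: "w \<in> K" "z \<in> ball w \<eta>" by blast
      show "\<exists>V f'. open V \<and> z \<in> V \<and> V \<subseteq> (\<Union>w\<in>K. ball w \<eta>) \<and> locisom f' V \<and> (\<forall>u\<in>V. F u = f' u)"
        using w H(1) F by (intro exI[of _ "ball w \<eta>"] exI[of _ "H w"]) auto
    qed
    show "F z = f z" if "z \<in> K" for z using F[OF that, of z] H(2)[OF that, of z] that \<eta>(1) by simp
  qed
qed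

text \<open>An exhaustion of \<open>UH\<close> by convex sets with compact closure in
  \<open>UH\<close>; the height is measured logarithmically so that the boundary line is never
  reached.\<close>

definition rect :: "real \<Rightarrow> complex set" where
  "rect R = {z\<in>UH. \<bar>Re z\<bar> < R \<and> \<bar>ln (Im z)\<bar> < R}"

lemma rect_eq: "rect R = {z. Re z < R} \<inter> {z. Re z > - R} \<inter> {z. Im z < exp R} \<inter> {z. Im z > exp (- R)}"
proof -
  have "Im z > 0 \<and> \<bar>ln (Im z)\<bar> < R \<longleftrightarrow> Im z < exp R \<and> Im z > exp (- R)" for z
  proof (cases "Im z > 0")
    case True
    then have "ln (Im z) < R \<longleftrightarrow> Im z < exp R" "- R < ln (Im z) \<longleftrightarrow> exp (- R) < Im z"
      by (metis exp_less_cancel_iff exp_ln)+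
    then show ?thesis using True by (auto simp: abs_less_iff)
  next
    case False
    then show ?thesis by (meson exp_gt_zero less_trans)
  qed
  then show ?thesis by (auto simp: rect_def UH_iff abs_less_iff)
qed

lemma open_rect: "open (rect R)"
  unfolding rect_eq by (intro open_Int open_halfspace_Re_lt open_halfspace_Re_gt open_halfspace_Im_lt open_halfspace_Im_gt)

lemma convex_rect: "convex (rect R)"
  unfolding rect_eq by (intro convex_Int convex_halfspace_Re_lt convex_halfspace_Re_gt convex_halfspace_Im_lt convex_halfspace_Im_gt)

lemma rect_mono: "R \<le> R' \<Longrightarrow> rect R \<subseteq> rect R'"
  by (auto simp: rect_def)

lemma rect_subset: "rect R \<subseteq> UH"
  by (auto simp: rect_def)

lemma i_in_rect: "R > 0 \<Longrightarrow> \<i> \<in> rect R"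
  by (simp add: rect_def UH_iff)

lemma closure_rect: "closure (rect R) \<subseteq> UH"
proof -
  have "closure (rect R) \<subseteq> {z. Im z \<ge> exp (- R)}"
    by (rule closure_minimal) (auto simp: rect_eq intro: closed_halfspace_Im_ge)
  also have "\<dots> \<subseteq> UH"
  proof
    fix z assume "z \<in> {z. Im z \<ge> exp (- R)}"
    then have "exp (- R) \<le> Im z" by simp
    then show "z \<in> UH" unfolding UH_iff using exp_gt_zero[of "- R"] by linarith
  qed
  finally show ?thesis .
qed

lemma bounded_rect: "bounded (rect R)"
proof (rule boundedI)
  fix z assume "z \<in> rect R"
  then have "z \<in> UH" "\<bar>Re z\<bar> < R" and "Im z < exp R" using rect_eq[of R] by (auto simp: rect_def)
  then have "\<bar>Re z\<bar> \<le> R" "\<bar>Im z\<bar> \<le> exp R" by (auto simp: UH_iff)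
  then show "cmod z \<le> R + exp R" using cmod_le[of z] by linarith
qed

lemma rect_nhd:
  assumes "s > 0" "\<eta> > 0"
  obtains s' where "s' > s" "rect s' \<subseteq> (\<Union>w\<in>rect s. ball w \<eta>)"
proof -
  \<comment> \<open>A horizontal shift of at most \<open>\<theta>\<close> and a vertical one of at
    most \<open>exp (s + 1) * \<theta>\<close> stay below \<open>\<eta>\<close> together; heights in
    the enlarged rectangle are below \<open>exp (s + 1)\<close>.\<close>
  define \<theta> where "\<theta> = min 1 (\<eta> / (2 * (1 + exp (s + 1))))"
  have p: "1 + exp (s + 1) > 0" by (simp add: add_pos_pos)
  have \<theta>: "\<theta> > 0" "\<theta> \<le> 1" using assms p by (auto simp: \<theta>_def)
  have "\<theta> \<le> \<eta> / (2 * (1 + exp (s + 1)))" by (simp add: \<theta>_def)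
  then have "\<theta> * (2 * (1 + exp (s + 1))) \<le> \<eta>" using p by (subst (asm) pos_le_divide_eq) auto
  then have \<theta>\<eta>: "\<theta> * (1 + exp (s + 1)) < \<eta>" using assms(2) by linarith
  define s' where "s' = s + \<theta>"
  have s': "s' > 0" "s' > s" "s' \<le> s + 1" using \<theta> assms by (auto simp: s'_def)
  define t where "t = s / s'"
  have t: "0 < t" "t < 1" "t * s' = s" using s' assms by (auto simp: t_def)
  have ts: "(1 - t) * s' = \<theta>" using t(3) by (simp add: algebra_simps s'_def)
  show ?thesis
  proof (rule that[OF s'(2)], rule subsetI)
    fix z assume z: "z \<in> rect s'"
    define l where "l = ln (Im z)"
    have z': "Im z = exp l" "\<bar>l\<bar> < s'" "\<bar>Re z\<bar> < s'" using z by (auto simp: rect_def l_def UH_iff)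
    \<comment> \<open>\<open>z\<close> contracted by the factor \<open>t\<close> towards
      \<open>\<i>\<close> in the coordinates given by the real part and the logarithm of the
      height.\<close>
    define w where "w = Complex (t * Re z) (exp (t * l))"
    have w: "w \<in> rect s"
    proof -
      have "t * \<bar>Re z\<bar> < t * s'" "t * \<bar>l\<bar> < t * s'" using t z' by auto
      then show ?thesis using t by (simp add: rect_def w_def UH_iff abs_mult)
    qed
    have "\<bar>Re (z - w)\<bar> = (1 - t) * \<bar>Re z\<bar>"
    proof -
      have "Re (z - w) = (1 - t) * Re z" by (simp add: w_def algebra_simps)
      then show ?thesis using t by (simp add: abs_mult)
    qed
    also have "\<dots> \<le> \<theta>" unfolding ts[symmetric] using t z' by (intro mult_left_mono) auto
    finally have r: "\<bar>Re (z - w)\<bar> \<le> \<theta>" .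
    have ed: "exp a - exp b \<le> exp (s + 1) * (a - b)" if "b \<le> a" "a \<le> s + 1" for a b :: real
    proof -
      have "exp a - exp b = exp a * (1 - exp (b - a))" by (simp add: algebra_simps exp_diff)
      also have "\<dots> \<le> exp a * (a - b)" using exp_ge_add_one_self[of "b - a"] by (intro mult_left_mono) (auto simp: algebra_simps)
      also have "\<dots> \<le> exp (s + 1) * (a - b)" using that by (intro mult_right_mono) auto
      finally show ?thesis .
    qed
    have tl: "\<bar>l - t * l\<bar> \<le> \<theta>"
    proof -
      have "l - t * l = (1 - t) * l" by (simp add: algebra_simps)
      then have "\<bar>l - t * l\<bar> = (1 - t) * \<bar>l\<bar>" using t by (simp add: abs_mult)
      also have "\<dots> \<le> \<theta>" unfolding ts[symmetric] using t z' by (intro mult_left_mono) auto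
      finally show ?thesis .
    qed
    have ls: "l \<le> s + 1" "t * l \<le> s + 1"
    proof -
      show "l \<le> s + 1" using z' s' by linarith
      have "t * l \<le> t * s'" using t z' by (intro mult_left_mono) auto
      then show "t * l \<le> s + 1" using t by linarith
    qed
    have "\<bar>exp l - exp (t * l)\<bar> \<le> exp (s + 1) * \<bar>l - t * l\<bar>"
    proof (cases "t * l \<le> l")
      case True
      then have "exp (t * l) \<le> exp l" by simp
      then show ?thesis using ed[OF True ls(1)] True by simp
    next
      case False
      then have "exp l \<le> exp (t * l)" by simp
      then show ?thesis using ed[of l "t * l"] False ls(2) by simp
    qed
    also have "\<dots> \<le> exp (s + 1) * \<theta>" using tl by (intro mult_left_mono) auto
    finally have i: "\<bar>Im (z - w)\<bar> \<le> exp (s + 1) * \<theta>" by (simp add: w_def z'(1))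
    have "cmod (z - w) \<le> \<theta> + exp (s + 1) * \<theta>" using cmod_le[of "z - w"] r i by linarith
    also have "\<dots> < \<eta>" using \<theta>\<eta> by (simp add: algebra_simps)
    finally have "z \<in> ball w \<eta>" by (simp add: dist_norm norm_minus_commute)
    then show "z \<in> (\<Union>w\<in>rect s. ball w \<eta>)" using w by blast
  qed
qed

text \<open>The rectangles are nested and connected, and all extensions agree with \<open>f0\<close>
  near \<open>\<i>\<close>; so two of them agree on the smaller rectangle, and they glue.\<close>

lemma locisom_chain:
  assumes R0: "R0 > 0" and f0: "locisom f0 (rect R0)" and T: "T \<subseteq> {R0..}" "R0 \<in> T"
    and ext: "\<And>R. R \<in> T \<Longrightarrow> \<exists>f. locisom f (rect R) \<and> (\<forall>z\<in>rect R0. f z = f0 z)"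
  obtains F where "locisom F (\<Union>R\<in>T. rect R)" "\<And>z. z \<in> rect R0 \<Longrightarrow> F z = f0 z"
proof -
  have "\<forall>R\<in>T. \<exists>f. locisom f (rect R) \<and> (\<forall>z\<in>rect R0. f z = f0 z)" using ext by blast
  then obtain H where "\<forall>R\<in>T. locisom (H R) (rect R) \<and> (\<forall>z\<in>rect R0. H R z = f0 z)"
    using bchoice[of T "\<lambda>R f. locisom f (rect R) \<and> (\<forall>z\<in>rect R0. f z = f0 z)"] by blast
  then have H: "\<And>R. R \<in> T \<Longrightarrow> locisom (H R) (rect R)" "\<And>R z. R \<in> T \<Longrightarrow> z \<in> rect R0 \<Longrightarrow> H R z = f0 z"
    by blast+
  obtain d where d: "d > 0" "ball \<i> d \<subseteq> rect R0"
    using open_rect i_in_rect[OF R0] open_contains_ball by blast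
  have le: "H R z = H R' z" if "R \<in> T" "R' \<in> T" "R \<le> R'" "z \<in> rect R" for R R' z
  proof (rule locisom_unique[of "H R" "rect R" "H R'" \<i> d])
    show "locisom (H R) (rect R)" using H that by blast
    show "locisom (H R') (rect R)" using locisom_mono[OF H(1)[OF that(2)] rect_mono[OF that(3)] open_rect] .
    show "connected (rect R)" using convex_rect convex_connected by blast
    show "\<i> \<in> rect R" using T R0 that(1) by (intro i_in_rect) auto
    show "H R u = H R' u" if "u \<in> ball \<i> d" for u using that d H(2) \<open>R \<in> T\<close> \<open>R' \<in> T\<close> by auto
  qed (use d that in auto)
  have cons: "H R z = H R' z" if "R \<in> T" "R' \<in> T" "z \<in> rect R" "z \<in> rect R'" for R R' z
  proof (cases "R \<le> R'")
    case True
    show ?thesis by (rule le[OF that(1,2) True that(3)])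
  next
    case False
    then have "R' \<le> R" by simp
    show ?thesis by (rule le[OF that(2,1) \<open>R' \<le> R\<close> that(4), symmetric])
  qed
  define F where "F z = H (SOME R. R \<in> T \<and> z \<in> rect R) z" for z
  have F: "F z = H R z" if "R \<in> T" "z \<in> rect R" for R z
  proof -
    have "(SOME R. R \<in> T \<and> z \<in> rect R) \<in> T \<and> z \<in> rect (SOME R. R \<in> T \<and> z \<in> rect R)"
      by (rule someI[of "\<lambda>R. R \<in> T \<and> z \<in> rect R" R]) (use that in auto)
    then show ?thesis unfolding F_def using cons that by blast
  qed
  show ?thesis
  proof (rule that)
    show "locisom F (\<Union>R\<in>T. rect R)"
    proof (rule locisomI)
      show "(\<Union>R\<in>T. rect R) \<subseteq> UH" using rect_subset by blast
      fix z assume "z \<in> (\<Union>R\<in>T. rect R)"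
      then obtain R where "R \<in> T" "z \<in> rect R" by blast
      then show "\<exists>V f'. open V \<and> z \<in> V \<and> V \<subseteq> (\<Union>R\<in>T. rect R) \<and> locisom f' V \<and> (\<forall>u\<in>V. F u = f' u)"
        using H(1) F open_rect by (intro exI[of _ "rect R"] exI[of _ "H R"]) auto
    qed
    show "F z = f0 z" if "z \<in> rect R0" for z using F[OF T(2) that] H(2)[OF T(2) that] by simp
  qed
qed

text \<open>If the sizes that can be reached were bounded, the extensions would glue to one on the
  rectangle of supremal size, and \<open>extension_nhd\<close> with \<open>rect_nhd\<close> would go
  beyond it.\<close>

lemma extension_UH:
  assumes R0: "R0 > 0" and f0: "locisom f0 (rect R0)"
  obtains F where "locisom F UH" "\<And>z. z \<in> rect R0 \<Longrightarrow> F z = f0 z"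
proof -
  define T where "T = {R. R \<ge> R0 \<and> (\<exists>f. locisom f (rect R) \<and> (\<forall>z\<in>rect R0. f z = f0 z))}"
  have T: "T \<subseteq> {R0..}" "R0 \<in> T" using f0 by (auto simp: T_def)
  have ext: "\<exists>f. locisom f (rect R) \<and> (\<forall>z\<in>rect R0. f z = f0 z)" if "R \<in> T" for R
    using that by (simp add: T_def)
  have down: "R \<in> T" if R: "R' \<in> T" "R0 \<le> R" "R \<le> R'" for R R'
    using ext[OF R(1)] locisom_mono[OF _ rect_mono[OF R(3)] open_rect] R(2) by (auto simp: T_def)
  obtain F where F: "locisom F (\<Union>R\<in>T. rect R)" "\<And>z. z \<in> rect R0 \<Longrightarrow> F z = f0 z"
    by (rule locisom_chain[OF R0 f0 T], rule ext, assumption, rule that)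
  have all: "R1 \<in> T" if R1: "R1 \<ge> R0" for R1
  proof (rule ccontr)
    assume n: "R1 \<notin> T"
    have bdd: "bdd_above T" by (rule bdd_aboveI[of _ R1]) (use down n R1 in force)
    define s where "s = Sup T"
    have s: "s \<ge> R0" "s > 0" using cSup_upper[OF T(2) bdd] R0 by (auto simp: s_def)
    \<comment> \<open>The inequalities that define \<open>rect\<close> are strict, so each point
      already lies in a rectangle below the supremum.\<close>
    have "rect s \<subseteq> (\<Union>R\<in>T. rect R)"
    proof
      fix z assume z: "z \<in> rect s"
      then have "max \<bar>Re z\<bar> \<bar>ln (Im z)\<bar> < Sup T" by (simp add: rect_def s_def)
      then obtain R where "R \<in> T" "max \<bar>Re z\<bar> \<bar>ln (Im z)\<bar> < R" using less_cSupD[of T] T(2) by blast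
      then show "z \<in> (\<Union>R\<in>T. rect R)" using z by (auto simp: rect_def)
    qed
    then have Fs: "locisom F (rect s)" using locisom_mono[OF F(1)] open_rect by blast
    obtain \<eta> G where G: "\<eta> > 0" "locisom G (\<Union>w\<in>rect s. ball w \<eta>)" "\<And>z. z \<in> rect s \<Longrightarrow> G z = F z"
      by (rule extension_nhd[OF convex_rect bounded_rect closure_rect Fs], rule that)
    obtain s' where s': "s' > s" "rect s' \<subseteq> (\<Union>w\<in>rect s. ball w \<eta>)"
      by (rule rect_nhd[OF s(2) G(1)], rule that)
    have "locisom G (rect s')" using locisom_mono[OF G(2) s'(2) open_rect] .
    moreover have "\<forall>z\<in>rect R0. G z = f0 z" using G(3) F(2) rect_mono[OF s(1)] by auto
    ultimately have "s' \<in> T" using s s' by (auto simp: T_def)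
    then show False using cSup_upper[OF _ bdd, of s'] s' by (simp add: s_def)
  qed
  have "UH \<subseteq> (\<Union>R\<in>T. rect R)"
  proof
    fix z assume z: "z \<in> UH"
    define R where "R = max R0 (max \<bar>Re z\<bar> \<bar>ln (Im z)\<bar> + 1)"
    have "R \<in> T" by (rule all) (simp add: R_def)
    moreover have "z \<in> rect R" using z by (auto simp: rect_def R_def)
    ultimately show "z \<in> (\<Union>R\<in>T. rect R)" by blast
  qed
  then have "locisom F UH" using locisom_mono[OF F(1)] open_UH by blast
  then show ?thesis using F(2) that by blast
qed

lemma extension_from_i:
  assumes "locisom f W" "\<i> \<in> W"
  obtains F d where "locisom F UH" "d > 0" "ball \<i> d \<subseteq> W" "\<And>z. z \<in> ball \<i> d \<Longrightarrow> F z = f z"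
proof -
  obtain e where e: "e > 0" "ball \<i> e \<subseteq> W" using locisom_open[OF assms(1)] assms(2) open_contains_ball by blast
  have iU: "\<i> \<in> UH" by (simp add: UH_iff)
  have "\<exists>R>0. rect R \<subseteq> ball \<i> e"
  proof -
    \<comment> \<open>Points of the rectangle lie within \<open>3 * R\<close> of
      \<open>\<i>\<close>, so an eighth of \<open>e\<close> is small enough.\<close>
    define R where "R = min 1 (e / 8)"
    have R: "R > 0" "R \<le> 1" "R \<le> e / 8" using e by (auto simp: R_def)
    have "z \<in> ball \<i> e" if z: "z \<in> rect R" for z
    proof -
      have re: "\<bar>Re z\<bar> < R" and im: "Im z < exp R" "exp (- R) < Im z" using z by (auto simp: rect_def) (use z rect_eq in auto)
      have "exp R \<le> 1 + R + R\<^sup>2" using exp_bound[of R] R by simp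
      moreover have "R\<^sup>2 \<le> R" using R by (simp add: power2_eq_square mult_left_le_one_le)
      ultimately have "Im z - 1 \<le> 2 * R" using im by linarith
      moreover have "1 - R \<le> exp (- R)" using exp_ge_add_one_self[of "- R"] by simp
      ultimately have "\<bar>Im (z - \<i>)\<bar> \<le> 2 * R" using im R by (auto simp: abs_le_iff)
      then have "cmod (z - \<i>) \<le> 3 * R" using cmod_le[of "z - \<i>"] re by simp
      then show ?thesis using R e by (simp add: dist_norm norm_minus_commute)
    qed
    then show ?thesis using R by blast
  qed
  then obtain R where R: "R > 0" "rect R \<subseteq> ball \<i> e" by blast
  have f: "locisom f (rect R)" using locisom_mono[OF assms(1)] R(2) e(2) open_rect by blast
  obtain F where F: "locisom F UH" "\<And>z. z \<in> rect R \<Longrightarrow> F z = f z"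
    by (rule extension_UH[OF R(1) f], rule that)
  obtain d where "d > 0" "ball \<i> d \<subseteq> rect R" using open_rect i_in_rect[OF R(1)] open_contains_ball by blast
  then show ?thesis using that[OF F(1), of d] F(2) R e by blast
qed

text \<open>The isometry that compares the germs of \<open>F\<close> at the two points is compatible
  with \<open>F\<close> near \<open>z\<close>, hence on all of \<open>UH\<close> by
  uniqueness.\<close>

lemma deck_transformation:
  assumes F: "locisom F UH" and z: "z \<in> UH" "z' \<in> UH" "F z = F z'"
  obtains g where "g \<in> Isom" "g z = z'" "\<And>u. u \<in> UH \<Longrightarrow> F (g u) = F u"
proof -
  obtain g d where g: "g \<in> Isom" "d > 0" "g z = z'" "ball z d \<subseteq> UH"
    "\<And>u. u \<in> ball z d \<Longrightarrow> g u \<in> UH \<and> F u = F (g u)"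
    by (rule germ_comparison[OF F z(1) F z(2) z(3)], rule that)
  have "{u\<in>UH. g u \<in> UH} = UH" using Isom_UH[OF g(1)] by blast
  then have Fg: "locisom (\<lambda>u. F (g u)) UH" using locisom_comp[OF F g(1)] by simp
  have "F (g u) = F u" if "u \<in> UH" for u
    by (rule locisom_unique[OF Fg F _ z(1) g(2) _ that]) (use g(5) convex_UH convex_connected in auto)
  then show ?thesis using that g by blast
qed

text \<open>Local injectivity of \<open>F\<close> at the fixed point makes \<open>g\<close> the
  identity near it, and \<open>Isom_eq\<close> does the rest.\<close>

lemma deck_fixed_point:
  assumes F: "locisom F UH" and g: "g \<in> Isom" "\<And>u. u \<in> UH \<Longrightarrow> F (g u) = F u" and z: "z \<in> UH" "g z = z" and w: "w \<in> UH"
  shows "g w = w"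
proof -
  obtain e where e: "e > 0" "ball z e \<subseteq> UH" "inj_on F (ball z e)" by (rule locisom_inj[OF F z(1)], rule that)
  have zg: "z \<in> UH" "g z \<in> ball z e" using z e by auto
  obtain d where d: "d > 0" "ball z d \<subseteq> UH \<inter> g -` ball z e"
    by (rule Isom_preimage_ball[OF g(1) zg], rule that)
  show ?thesis
  proof (rule Isom_eq[OF g(1) subsetD[OF Isop_subset id_Isop] _ _ _ _ w])
    show "open (ball z (min d e))" "ball z (min d e) \<noteq> {}" "ball z (min d e) \<subseteq> UH" using d e by auto
    fix u assume "u \<in> ball z (min d e)"
    then have "u \<in> ball z e" "g u \<in> ball z e" "u \<in> UH" using d by auto
    then show "g u = u" using g(2) e(3) by (meson inj_onD)
  qed
qed

text \<open>\<open>g\<close> is a branch of \<open>\<psi>\<close> inverted after \<open>F\<close>,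
  given near \<open>z\<close> by germ comparison. The part of \<open>UH\<close> that
  \<open>g\<close> sends into \<open>D\<close> is connected, so the identity spreads over this whole
  sheet.\<close>

lemma sheet:
  assumes F: "locisom F UH" and D: "locisom \<psi> D" "connected D" and z: "z \<in> UH" "F z \<in> \<psi> ` D"
  obtains g where "g \<in> Isom" "g z \<in> D" "\<And>u. u \<in> UH \<Longrightarrow> g u \<in> D \<Longrightarrow> F u = \<psi> (g u)"
proof -
  obtain z' where z': "z' \<in> D" "F z = \<psi> z'" using z(2) by blast
  obtain g d where g: "g \<in> Isom" "d > 0" "g z = z'" "ball z d \<subseteq> UH"
    "\<And>u. u \<in> ball z d \<Longrightarrow> g u \<in> D \<and> F u = \<psi> (g u)"
    by (rule germ_comparison[OF F z(1) D(1) z'], rule that)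
  define W where "W = {u\<in>UH. g u \<in> D}"
  obtain h where h: "h \<in> Isom" "\<And>z. z \<in> UH \<Longrightarrow> h (g z) = z" "\<And>z. z \<in> UH \<Longrightarrow> g (h z) = z"
    by (rule Isom_inv[OF g(1)], rule that)
  have DU: "D \<subseteq> UH" using locisom_subset[OF D(1)] .
  have "W = h ` D"
  proof
    show "W \<subseteq> h ` D" using h(2) unfolding W_def by (metis (mono_tags, lifting) imageI mem_Collect_eq subsetI)
    show "h ` D \<subseteq> W" using h DU Isom_UH[OF h(1)] by (auto simp: W_def)
  qed
  then have "connected W"
    using connected_continuous_image[OF continuous_on_subset[OF continuous_on_Isom[OF h(1)] DU] D(2)] by simp
  have W: "locisom (\<lambda>u. \<psi> (g u)) W" using locisom_comp[OF D(1) g(1)] by (simp add: W_def)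
  have FW: "locisom F W" using locisom_mono[OF F] locisom_open[OF W] by (auto simp: W_def)
  have "F u = \<psi> (g u)" if "u \<in> UH" "g u \<in> D" for u
    by (rule locisom_unique[OF FW W \<open>connected W\<close>, of z d]) (use that z z' g in \<open>auto simp: W_def\<close>)
  then show ?thesis using that g z' by blast
qed

text \<open>Chart images are evenly covered: the sheets are the preimages of the chart domain under
  the isometries that compare \<open>F\<close> with the chart. \<open>F\<close> is onto because its
  image is open and closed in the connected surface.\<close>

lemma locisom_covering:
  assumes F: "locisom F UH"
  shows "covering_space UH F N"
proof -
  have chart: "\<exists>D \<psi>. locisom \<psi> D \<and> connected D \<and> inj_on \<psi> D \<and> (\<exists>\<phi>. homeomorphism D (\<psi> ` D) \<psi> \<phi>) \<and> p \<in> \<psi> ` D \<and> openin (top_of_set N) (\<psi> ` D)"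
    if p: "p \<in> N" for p
  proof -
    obtain c e r \<psi> \<phi> where e: "e > 0" "r > 0" "ball c e \<subseteq> UH" "\<psi> c = p"
      "\<And>u. u \<in> ball c e \<Longrightarrow> \<psi> u \<in> N \<and> \<phi> (\<psi> u) = u"
      "\<And>u v. u \<in> ball c e \<Longrightarrow> v \<in> ball c e \<Longrightarrow> dist (\<psi> u) (\<psi> v) = hyp_dist u v"
      "\<And>x. x \<in> N \<Longrightarrow> dist p x < r \<Longrightarrow> \<phi> x \<in> ball c e \<and> \<psi> (\<phi> x) = x"
      "openin (top_of_set N) (\<psi> ` ball c e)"
      by (rule chart_inverse[OF p], rule that)
    have li: "locisom \<psi> (ball c e)" by (rule isometric_locisom) (use e in auto)
    have inj: "inj_on \<psi> (ball c e)" using e(5) by (metis inj_onI)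
    have "continuous_on (\<psi> ` ball c e) \<phi>"
      unfolding continuous_on_iff
    proof (intro ballI allI impI)
      fix x \<epsilon> assume x: "x \<in> \<psi> ` ball c e" and \<epsilon>: "(\<epsilon>::real) > 0"
      then obtain u where u: "u \<in> ball c e" "x = \<psi> u" by blast
      have uU: "u \<in> UH" using u e by blast
      obtain d where d: "d > 0" "\<And>w. w \<in> UH \<Longrightarrow> hyp_dist u w < d \<Longrightarrow> cmod (u - w) < \<epsilon>"
        using hyp_dist_small[OF uU \<epsilon>] by metis
      show "\<exists>d>0. \<forall>x'\<in>\<psi> ` ball c e. dist x' x < d \<longrightarrow> dist (\<phi> x') (\<phi> x) < \<epsilon>"
      proof (intro exI[of _ d] conjI ballI impI d(1))
        fix x' assume "x' \<in> \<psi> ` ball c e" "dist x' x < d"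
        then obtain w where w: "w \<in> ball c e" "x' = \<psi> w" "dist (\<psi> w) (\<psi> u) < d" using u by blast
        then have "hyp_dist u w < d" using e(6)[OF u(1) w(1)] by (simp add: dist_commute)
        then have "cmod (u - w) < \<epsilon>" using d(2) w e by blast
        then show "dist (\<phi> x') (\<phi> x) < \<epsilon>" using e(5) u w by (simp add: dist_norm norm_minus_commute)
      qed
    qed
    moreover have im: "\<phi> ` \<psi> ` ball c e = ball c e"
    proof -
      have "\<phi> ` \<psi> ` ball c e = (\<lambda>u. u) ` ball c e" unfolding image_image using e(5) by (intro image_cong) auto
      then show ?thesis by simp
    qed
    ultimately have "homeomorphism (ball c e) (\<psi> ` ball c e) \<psi> \<phi>"
      using locisom_continuous[OF li] e(5) im by (auto simp: homeomorphism_def)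
    then show ?thesis using li inj e by (intro exI[of _ "ball c e"] exI[of _ \<psi>]) auto
  qed
  have contF: "continuous_on UH F" by (rule locisom_continuous[OF F])
  have FN: "F ` UH \<subseteq> N" using locisom_in[OF F] by blast
  \<comment> \<open>A chart image that meets the image of \<open>F\<close> lies in it: the inverse
    of the isometry from \<open>sheet\<close> supplies preimages. Openness and closedness of the
    image both follow from this.\<close>
  have full: "\<psi> ` D \<subseteq> F ` UH" if D: "locisom \<psi> D" "connected D" and z: "z \<in> UH" "F z \<in> \<psi> ` D" for \<psi> D z
  proof
    fix x assume "x \<in> \<psi> ` D"
    then obtain u where u: "u \<in> D" "x = \<psi> u" by blast
    obtain g where g: "g \<in> Isom" "g z \<in> D" "\<And>u. u \<in> UH \<Longrightarrow> g u \<in> D \<Longrightarrow> F u = \<psi> (g u)"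
      by (rule sheet[OF F D z], rule that)
    obtain h where h: "h \<in> Isom" "\<And>z. z \<in> UH \<Longrightarrow> h (g z) = z" "\<And>z. z \<in> UH \<Longrightarrow> g (h z) = z"
      by (rule Isom_inv[OF g(1)], rule that)
    have uU: "u \<in> UH" using u locisom_subset[OF D(1)] by blast
    then have "F (h u) = x" using g(3)[of "h u"] h Isom_UH[OF h(1) uU] u by simp
    then show "x \<in> F ` UH" using Isom_UH[OF h(1) uU] by blast
  qed
  have "openin (top_of_set N) (F ` UH)"
    unfolding openin_subopen[of _ "F ` UH"]
  proof
    fix x assume x: "x \<in> F ` UH"
    then obtain z where z: "z \<in> UH" "x = F z" by blast
    have xN: "x \<in> N" using x FN by blast
    obtain D \<psi> where D: "locisom \<psi> D" "connected D" "x \<in> \<psi> ` D" "openin (top_of_set N) (\<psi> ` D)" using chart[OF xN] by blast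
    have "\<psi> ` D \<subseteq> F ` UH" using full[OF D(1,2) z(1)] D(3) z(2) by simp
    then show "\<exists>T. openin (top_of_set N) T \<and> x \<in> T \<and> T \<subseteq> F ` UH" using D(3,4) by (intro exI[of _ "\<psi> ` D"] conjI)
  qed
  moreover have "closedin (top_of_set N) (F ` UH)"
  proof -
    have "openin (top_of_set N) (N - F ` UH)"
      unfolding openin_subopen[of _ "N - F ` UH"]
    proof
      fix x assume x: "x \<in> N - F ` UH"
      then have xN: "x \<in> N" by blast
      obtain D \<psi> where D: "locisom \<psi> D" "connected D" "x \<in> \<psi> ` D" "openin (top_of_set N) (\<psi> ` D)" using chart[OF xN] by blast
      have "\<psi> ` D \<inter> F ` UH = {}"
      proof (rule ccontr)
        assume "\<psi> ` D \<inter> F ` UH \<noteq> {}"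
        then obtain y where y: "y \<in> \<psi> ` D" "y \<in> F ` UH" by (meson disjoint_iff)
        then obtain z where z: "z \<in> UH" "y = F z" by (meson imageE)
        have "\<psi> ` D \<subseteq> F ` UH" using full[OF D(1,2) z(1)] y(1) z(2) by simp
        then show False using D(3) x by (meson DiffD2 subsetD)
      qed
      moreover have "\<psi> ` D \<subseteq> N" using D(4) openin_imp_subset by blast
      ultimately show "\<exists>T. openin (top_of_set N) T \<and> x \<in> T \<and> T \<subseteq> N - F ` UH" using D by blast
    qed
    then show ?thesis using FN by (simp add: closedin_def)
  qed
  moreover have "F ` UH \<noteq> {}" using iy_UH by blast
  ultimately have surj: "F ` UH = N" using conn unfolding connected_clopen by blast
  show ?thesis
    unfolding covering_space_def
  proof (intro conjI contF surj ballI)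
    fix x assume xN: "x \<in> N"
    obtain D \<psi> \<phi> where D: "locisom \<psi> D" "connected D" "inj_on \<psi> D" "homeomorphism D (\<psi> ` D) \<psi> \<phi>" "x \<in> \<psi> ` D" "openin (top_of_set N) (\<psi> ` D)"
      using chart[OF xN] by blast
    define T where "T = \<psi> ` D"
    have DU: "D \<subseteq> UH" "open D" using locisom_subset[OF D(1)] locisom_open[OF D(1)] by auto
    define G where "G = {g\<in>Isom. \<forall>u\<in>UH. g u \<in> D \<longrightarrow> F u = \<psi> (g u)}"
    define S where "S g = {u\<in>UH. g u \<in> D}" for g
    show "\<exists>T. x \<in> T \<and> openin (top_of_set N) T \<and> (\<exists>v. \<Union>v = UH \<inter> F -` T \<and> (\<forall>u\<in>v. openin (top_of_set UH) u) \<and> pairwise disjnt v \<and> (\<forall>u\<in>v. \<exists>q. homeomorphism u T F q))"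
    proof (intro exI[of _ T] exI[of _ "S ` G"] conjI)
      show "x \<in> T" "openin (top_of_set N) T" using D by (auto simp: T_def)
      show "\<Union> (S ` G) = UH \<inter> F -` T"
      proof
        show "\<Union> (S ` G) \<subseteq> UH \<inter> F -` T" by (auto simp: S_def G_def T_def)
        show "UH \<inter> F -` T \<subseteq> \<Union> (S ` G)"
        proof
          fix z assume z: "z \<in> UH \<inter> F -` T"
          then have z1: "z \<in> UH" "F z \<in> \<psi> ` D" by (auto simp: T_def)
          obtain g where g: "g \<in> Isom" "g z \<in> D" "\<And>u. u \<in> UH \<Longrightarrow> g u \<in> D \<Longrightarrow> F u = \<psi> (g u)"
            by (rule sheet[OF F D(1,2) z1], rule that)
          then have "g \<in> G" "z \<in> S g" using z1 by (auto simp: G_def S_def)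
          then show "z \<in> \<Union> (S ` G)" by blast
        qed
      qed
      have oS: "open (S g)" if "g \<in> G" for g
      proof -
        have "S g = UH \<inter> g -` D" by (auto simp: S_def)
        then show ?thesis
          using continuous_open_preimage[OF continuous_on_Isom open_UH DU(2), of g] that by (simp add: G_def)
      qed
      show "\<forall>u\<in>S ` G. openin (top_of_set UH) u"
        using oS by (auto intro!: open_subset) (auto simp: S_def)
      \<comment> \<open>If two sheets meet, injectivity of \<open>\<psi>\<close> makes their
        isometries agree on an open set, so they are the same sheet.\<close>
      show "pairwise disjnt (S ` G)"
      proof (rule pairwiseI)
        fix A B assume AB: "A \<in> S ` G" "B \<in> S ` G" "A \<noteq> B"
        then obtain g h where gh: "g \<in> G" "h \<in> G" "A = S g" "B = S h" by blast
        show "disjnt A B"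
        proof (rule ccontr)
          assume "\<not> disjnt A B"
          then have ne: "S g \<inter> S h \<noteq> {}" using gh by (simp add: disjnt_def)
          have "g u = h u" if "u \<in> UH" for u
          proof (rule Isom_eq[of g h "S g \<inter> S h"])
            show "g \<in> Isom" "h \<in> Isom" using gh by (auto simp: G_def)
            show "open (S g \<inter> S h)" using oS gh by blast
            show "S g \<inter> S h \<subseteq> UH" by (auto simp: S_def)
            fix u assume "u \<in> S g \<inter> S h"
            then have "\<psi> (g u) = \<psi> (h u)" "g u \<in> D" "h u \<in> D" using gh by (auto simp: S_def G_def)
            then show "g u = h u" using D(3) by (meson inj_onD)
          qed (use that ne in auto)
          then have "S g = S h" by (auto simp: S_def)
          then show False using AB gh by simp
        qed
      qed
      show "\<forall>u\<in>S ` G. \<exists>q. homeomorphism u T F q"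
      proof
        fix A assume "A \<in> S ` G"
        then obtain g where g: "g \<in> Isom" "A = S g" "\<And>u. u \<in> UH \<Longrightarrow> g u \<in> D \<Longrightarrow> F u = \<psi> (g u)" by (auto simp: G_def)
        obtain h where h: "h \<in> Isom" "\<And>z. z \<in> UH \<Longrightarrow> h (g z) = z" "\<And>z. z \<in> UH \<Longrightarrow> g (h z) = z"
          by (rule Isom_inv[OF g(1)], rule that)
        have \<phi>: "continuous_on (\<psi> ` D) \<phi>" "\<And>u. u \<in> D \<Longrightarrow> \<phi> (\<psi> u) = u"
          using D(4) by (auto simp: homeomorphism_def)
        have hS: "h v \<in> S g" if "v \<in> D" for v using that DU(1) h Isom_UH[OF h(1)] by (auto simp: S_def)
        have "homeomorphism (S g) T F (\<lambda>x. h (\<phi> x))"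
          unfolding homeomorphism_def
        proof (intro conjI ballI)
          have SU: "S g \<subseteq> UH" by (auto simp: S_def)
          show "continuous_on (S g) F" by (rule continuous_on_subset[OF contF SU])
          show "continuous_on T (\<lambda>x. h (\<phi> x))"
            unfolding T_def by (rule continuous_on_compose2[OF continuous_on_Isom[OF h(1)] \<phi>(1)]) (use \<phi>(2) DU in auto)
          show 1: "h (\<phi> (F u)) = u" if "u \<in> S g" for u using that g(3) \<phi>(2) h(2) by (auto simp: S_def)
          show 2: "F (h (\<phi> y)) = y" if yT: "y \<in> T" for y
          proof -
            obtain v where v: "v \<in> D" "y = \<psi> v" using yT by (auto simp: T_def)
            then show ?thesis using g(3)[of "h v"] hS[OF v(1)] \<phi>(2) h(3) DU(1) by (auto simp: S_def)
          qed
          show 3: "F ` S g = T"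
          proof
            show "F ` S g \<subseteq> T" using g(3) by (auto simp: S_def T_def)
            show "T \<subseteq> F ` S g"
            proof
              fix y assume y: "y \<in> T"
              then obtain v where v: "v \<in> D" "y = \<psi> v" by (auto simp: T_def)
              then have "h (\<phi> y) \<in> S g" using hS \<phi>(2) by simp
              then show "y \<in> F ` S g" using 2[OF y] by (metis imageI)
            qed
          qed
          show "(\<lambda>x. h (\<phi> x)) ` T = S g"
          proof
            show "(\<lambda>x. h (\<phi> x)) ` T \<subseteq> S g" using hS \<phi>(2) by (auto simp: T_def)
            show "S g \<subseteq> (\<lambda>x. h (\<phi> x)) ` T" using 1 3 by (metis (no_types, lifting) image_eqI subsetI)
          qed
        qed
        then show "\<exists>q. homeomorphism A T F q" using g by blast
      qed
    qed
  qed
qed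

end

section \<open>Deck transformations and puncture loops\<close>

text \<open>Kuratowski embedding. The lifting theorems of the library need the base of a covering to lie in
  a normed space; the discrete topology makes every bounded function continuous.\<close>

lemma metric_embedding:
  fixes X :: "'a metric"
  obtains j :: "'a \<Rightarrow> 'a discrete \<Rightarrow>\<^sub>C real"
  where "\<And>x y. x \<in> mspace X \<Longrightarrow> y \<in> mspace X \<Longrightarrow> dist (j x) (j y) = mdist X x y"
proof (cases "mspace X = {}")
  case True
  then show ?thesis using that by simp
next
  case False
  then obtain x0 where x0: "x0 \<in> mspace X" by blast
  \<comment> \<open>Subtracting the distances from the base point \<open>x0\<close> makes the
    function bounded; outside the space the value is 0.\<close>
  define f where "f x = (\<lambda>y. if of_discrete y \<in> mspace X then mdist X x (of_discrete y) - mdist X x0 (of_discrete y) else 0)" for x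
  define j where "j x = Bcontfun (f x)" for x
  have diff: "\<bar>mdist X x y - mdist X x' y\<bar> \<le> mdist X x x'"
    if "x \<in> mspace X" "x' \<in> mspace X" "y \<in> mspace X" for x x' y
    using mdist_triangle[OF that(1,2,3)] mdist_triangle[OF that(2,1,3)] mdist_commute[of X x x'] by linarith
  have ap: "apply_bcontfun (j x) = f x" if "x \<in> mspace X" for x
  proof -
    have "f x \<in> bcontfun"
    proof (rule bcontfun_normI)
      show "continuous_on UNIV (f x)" by (simp add: continuous_on_def tendsto_def eventually_at_topological) (metis open_discrete insertI1 singletonD)
      show "norm (f x y) \<le> mdist X x x0" for y using diff[OF that x0] by (simp add: f_def)
    qed
    then show ?thesis by (simp add: j_def Bcontfun_inverse)
  qed
  show ?thesis
  proof (rule that)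
    fix x y assume xy: "x \<in> mspace X" "y \<in> mspace X"
    show "dist (j x) (j y) = mdist X x y"
    proof (rule antisym)
      show "dist (j x) (j y) \<le> mdist X x y"
      proof (rule dist_bound)
        show "dist (apply_bcontfun (j x) z) (apply_bcontfun (j y) z) \<le> mdist X x y" for z
          using diff[OF xy, of "of_discrete z"] by (simp add: ap xy f_def dist_real_def)
      qed
      have zero: "mdist X y y = 0" using xy by simp
      \<comment> \<open>The supremum of the differences is attained at the argument
        \<open>y\<close>.\<close>
      have "dist (apply_bcontfun (j x) (discrete y)) (apply_bcontfun (j y) (discrete y)) = mdist X x y"
        by (simp add: ap xy f_def discrete_inverse dist_real_def zero)
      then show "mdist X x y \<le> dist (j x) (j y)" by (metis dist_bounded)
    qed
  qed
qed

lemma metric_embedding_homeomorphism: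
  fixes X :: "'a::topological_space metric" and j :: "'a \<Rightarrow> 'b::metric_space"
  assumes N: "mspace X = N" "mtopology_of X = top_of_set N"
    and j: "\<And>x y. x \<in> N \<Longrightarrow> y \<in> N \<Longrightarrow> dist (j x) (j y) = mdist X x y"
  shows "homeomorphism N (j ` N) j (inv_into N j)"
proof -
  have inj: "inj_on j N"
  proof
    fix x y assume "x \<in> N" "y \<in> N" "j x = j y"
    then show "x = y" using j[of x y] N(1) by simp
  qed
  have op: "openin (top_of_set N) U \<longleftrightarrow> U \<subseteq> N \<and> (\<forall>x\<in>U. \<exists>r>0. \<forall>y\<in>N. mdist X x y < r \<longrightarrow> y \<in> U)" for U
  proof -
    interpret Metric_space N "mdist X" using N(1) Metric_space_mspace_mdist[of X] by simp
    have "mtopology = top_of_set N" using N by (simp add: mtopology_of_def)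
    then have "openin (top_of_set N) U \<longleftrightarrow> U \<subseteq> N \<and> (\<forall>x. x \<in> U \<longrightarrow> (\<exists>r>0. mball x r \<subseteq> U))"
      using openin_mtopology by simp
    moreover have "(\<forall>x. x \<in> U \<longrightarrow> (\<exists>r>0. mball x r \<subseteq> U)) \<longleftrightarrow> (\<forall>x\<in>U. \<exists>r>0. \<forall>y\<in>N. mdist X x y < r \<longrightarrow> y \<in> U)"
      if "U \<subseteq> N"
    proof -
      have "mball x r \<subseteq> U \<longleftrightarrow> (\<forall>y\<in>N. mdist X x y < r \<longrightarrow> y \<in> U)" if "x \<in> U" for x r
        using \<open>U \<subseteq> N\<close> that by (auto simp: subset_iff)
      then show ?thesis by (simp add: Ball_def)
    qed
    ultimately show ?thesis by blast
  qed
  have zero: "mdist X x x = 0" if "x \<in> N" for x using that N(1) by simp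
  have tri: "mdist X x z \<le> mdist X x y + mdist X y z" if "x \<in> N" "y \<in> N" "z \<in> N" for x y z
    using mdist_triangle[of x X y z] that N(1) by simp
  have "continuous_on N j"
    unfolding continuous_on_topological
  proof (intro ballI allI impI)
    fix x B assume x: "x \<in> N" and B: "open B" "j x \<in> B"
    then obtain e where e: "e > 0" "ball (j x) e \<subseteq> B" using open_contains_ball by blast
    define U where "U = {y\<in>N. mdist X x y < e}"
    have "openin (top_of_set N) U"
      unfolding op
    proof (intro conjI ballI)
      fix y assume y: "y \<in> U"
      show "\<exists>r>0. \<forall>z\<in>N. mdist X y z < r \<longrightarrow> z \<in> U"
      proof (intro exI[of _ "e - mdist X x y"] conjI ballI impI)
        show "e - mdist X x y > 0" using y by (simp add: U_def)
        fix z assume "z \<in> N" "mdist X y z < e - mdist X x y"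
        then show "z \<in> U" using tri[of x y z] x y by (simp add: U_def)
      qed
    qed (auto simp: U_def)
    then obtain A where A: "open A" "U = N \<inter> A" by (auto simp: openin_open)
    have "x \<in> U" using x e zero[OF x] by (simp add: U_def)
    moreover have "j y \<in> B" if "y \<in> N" "y \<in> A" for y
    proof -
      have "y \<in> U" using that A by blast
      then show ?thesis using e j x by (auto simp: U_def)
    qed
    ultimately show "\<exists>A. open A \<and> x \<in> A \<and> (\<forall>y\<in>N. y \<in> A \<longrightarrow> j y \<in> B)" using A by blast
  qed
  moreover have "continuous_on (j ` N) (inv_into N j)"
    unfolding continuous_on_topological
  proof (intro ballI allI impI)
    fix y B assume y: "y \<in> j ` N" and B: "open B" "inv_into N j y \<in> B"
    then obtain x where x: "x \<in> N" "y = j x" by blast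
    then have xB: "x \<in> B" using B inj by simp
    have "openin (top_of_set N) (N \<inter> B)" using B by (auto simp: openin_open)
    then obtain r where r: "r > 0" "\<forall>y\<in>N. mdist X x y < r \<longrightarrow> y \<in> N \<inter> B" unfolding op using x xB by blast
    show "\<exists>A. open A \<and> y \<in> A \<and> (\<forall>y\<in>j ` N. y \<in> A \<longrightarrow> inv_into N j y \<in> B)"
      by (intro exI[of _ "ball (j x) r"]) (use r x j inj in auto)
  qed
  ultimately show ?thesis using inj by (auto simp: homeomorphism_def)
qed

section \<open>Winding numbers and orientation\<close>

lemma exp_constant_imp_constant:
  fixes d :: "'a::topological_space \<Rightarrow> complex"
  assumes "connected S" "continuous_on S d" "\<And>s. s \<in> S \<Longrightarrow> exp (d s) = c"
  shows "\<exists>v. \<forall>s\<in>S. d s = v"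
proof -
  have "d constant_on S"
  proof (rule continuous_discrete_range_constant[OF assms(1,2)])
    fix x assume x: "x \<in> S"
    show "\<exists>e>0. \<forall>y. y \<in> S \<and> d y \<noteq> d x \<longrightarrow> e \<le> norm (d y - d x)"
    proof (intro exI[of _ "2 * pi"] conjI allI impI)
      fix y assume y: "y \<in> S \<and> d y \<noteq> d x"
      then have "exp (d y) = exp (d x)" using assms(3) x by simp
      then obtain n :: int where n: "d y = d x + (of_int (2 * n) * pi) * \<i>" unfolding exp_eq by blast
      then have "n \<noteq> 0" using y by auto
      then have "\<bar>real_of_int n\<bar> \<ge> 1" by linarith
      then have "2 * pi * 1 \<le> 2 * pi * \<bar>real_of_int n\<bar>" by (intro mult_left_mono) auto
      moreover have "norm (d y - d x) = 2 * pi * \<bar>real_of_int n\<bar>" using n by (simp add: norm_mult)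
      ultimately show "2 * pi \<le> norm (d y - d x)" by simp
    qed simp
  qed
  then show ?thesis by (auto simp: constant_on_def)
qed

text \<open>Winding numbers of small difference loops of a locally injective map: they are odd, and an
  orientation reversing equivariance would negate them.\<close>

lemma equivariant_orientation_preserving:
  fixes f :: "complex \<Rightarrow> complex"
  assumes f: "continuous_on {w. Re w < 0} f" "\<And>w. Re w < 0 \<Longrightarrow> f w \<in> UH"
    and inj: "\<And>w w'. Re w < 0 \<Longrightarrow> Re w' < 0 \<Longrightarrow> cmod (w - w') \<le> 2 \<Longrightarrow> f w = f w' \<Longrightarrow> w = w'"
    and g: "g \<in> Isom" "\<And>w. Re w < 0 \<Longrightarrow> f (w + \<i> * of_real T) = g (f w)"
  shows "g \<in> Isop"
proof (rule ccontr)
  assume "g \<notin> Isop"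
  then obtain h where h: "h \<in> Isop" "\<And>z. g z = h (mirror z)" using g(1) Isom_cases by metis
  obtain a b c d where abcd: "a * d - b * c = 1" "\<And>z. z \<in> UH \<Longrightarrow> h z = mob a b c d z"
    by (rule IsopE[OF h(1)], rule that)
  have det: "a * d - b * c \<noteq> 0" using abcd by simp
  \<comment> \<open>\<open>A\<close> and \<open>B\<close> lie on opposite sides of the centre
    \<open>w0 + \<i> x\<close>, at distances 1 and \<tau>. Their distance \<open>1 + \<tau>\<close>
    is at most 2, the range of injectivity, and -3 keeps both in the left half plane. For \<tau> = 0
    the point \<open>B\<close> is the centre, for \<tau> = 1 the antipode of
    \<open>A\<close>.\<close>
  define w0 :: complex where "w0 = - 3"
  define A where "A = (\<lambda>(x::real, t::real, \<tau>::real). w0 + \<i> * of_real x + cis t :: complex)"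
  define B where "B = (\<lambda>(x::real, t::real, \<tau>::real). w0 + \<i> * of_real x - of_real \<tau> * cis t :: complex)"
  define S :: "(real \<times> real \<times> real) set" where "S = UNIV \<times> UNIV \<times> {0..1}"
  have Sconv: "convex S" unfolding S_def by (intro convex_Times) auto
  have A: "Re (A p) < 0" for p
  proof -
    have "cos (fst (snd p)) < 3" using cos_le_one[of "fst (snd p)"] by linarith
    then show ?thesis by (simp add: A_def w0_def case_prod_unfold)
  qed
  have B: "Re (B p) < 0" if "p \<in> S" for p
  proof -
    obtain x t \<tau> where p: "p = (x, t, \<tau>)" by (cases p)
    have "\<bar>\<tau> * cos t\<bar> \<le> 1" using that p by (simp add: S_def abs_mult mult_le_one)
    then show ?thesis by (simp add: B_def p w0_def)
  qed
  have cA: "continuous_on S A" and cB: "continuous_on S B"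
    unfolding A_def B_def case_prod_unfold by (intro continuous_intros)+
  define G where "G p = f (A p) - f (B p)" for p
  have cG: "continuous_on S G" unfolding G_def
    by (intro continuous_intros continuous_on_compose2[OF f(1) cA] continuous_on_compose2[OF f(1) cB]) (use A B in auto)
  have "G p \<noteq> 0" if p: "p \<in> S" for p
  proof
    assume "G p = 0"
    then have eq: "f (A p) = f (B p)" by (simp add: G_def)
    obtain x t \<tau> where pe: "p = (x, t, \<tau>)" by (cases p)
    have \<tau>: "0 \<le> \<tau>" "\<tau> \<le> 1" using p pe by (auto simp: S_def)
    have AB: "A p - B p = of_real (1 + \<tau>) * cis t" by (simp add: A_def B_def pe algebra_simps)
    then have n: "cmod (A p - B p) = 1 + \<tau>" using \<tau> by (simp only: norm_mult norm_of_real norm_cis) simp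
    have "A p = B p" by (rule inj[OF A B[OF p] _ eq]) (use n \<tau> in simp)
    then show False using n \<tau> by simp
  qed
  \<comment> \<open>\<open>S\<close> is contractible, so the nowhere zero difference has a
    continuous logarithm; its increments in \<open>t\<close> count the winding for all values of
    \<open>x\<close> and \<tau> at once.\<close>
  then obtain L where L: "continuous_on S L" "\<And>p. p \<in> S \<Longrightarrow> G p = exp (L p)"
    using continuous_logarithm_on_contractible[OF cG convex_imp_contractible[OF Sconv]] by metis
  have per: "cis (t + 2 * pi) = cis t" "cis (t + pi) = - cis t" for t
    by (simp_all add: complex_eq_iff)
  have "\<exists>v. \<forall>p\<in>S. L (fst p, fst (snd p) + 2 * pi, snd (snd p)) - L p = v"
  proof (rule exp_constant_imp_constant[where c = 1])
    show "connected S" using Sconv convex_connected by blast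
    show "continuous_on S (\<lambda>p. L (fst p, fst (snd p) + 2 * pi, snd (snd p)) - L p)"
      by (intro continuous_intros L(1) continuous_on_compose2[OF L(1)]) (auto simp: S_def)
    fix p assume p: "p \<in> S"
    then have p': "(fst p, fst (snd p) + 2 * pi, snd (snd p)) \<in> S" by (auto simp: S_def)
    have "G (fst p, fst (snd p) + 2 * pi, snd (snd p)) = G p"
      by (simp add: G_def A_def B_def per case_prod_unfold)
    then have "exp (L (fst p, fst (snd p) + 2 * pi, snd (snd p))) = exp (L p)" using L(2) p p' by metis
    then show "exp (L (fst p, fst (snd p) + 2 * pi, snd (snd p)) - L p) = 1" by (simp add: exp_diff)
  qed
  then obtain C1 where C1: "\<And>x t \<tau>. 0 \<le> \<tau> \<Longrightarrow> \<tau> \<le> 1 \<Longrightarrow> L (x, t + 2 * pi, \<tau>) - L (x, t, \<tau>) = C1"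
    by (auto simp: S_def)
  \<comment> \<open>For \<tau> = 1 a half turn exchanges \<open>A\<close> and \<open>B\<close> and
    negates the difference. So the increment over a half turn is nonzero, and the full increment is
    twice it.\<close>
  have odd: "exp (L (0, t + pi, 1) - L (0, t, 1)) = - 1" for t
  proof -
    have p: "(0, t + pi, 1) \<in> S" "(0, t, 1) \<in> S" by (auto simp: S_def)
    have "G (0, t + pi, 1) = - G (0, t, 1)" by (simp add: G_def A_def B_def per)
    then have "exp (L (0, t + pi, 1)) = - exp (L (0, t, 1))" using L(2) p by metis
    then show ?thesis by (simp add: exp_diff)
  qed
  have "\<exists>v. \<forall>t\<in>UNIV. L (0, t + pi, 1) - L (0, t, 1) = v"
  proof (rule exp_constant_imp_constant[where c = "-1"])
    show "continuous_on UNIV (\<lambda>t. L (0, t + pi, 1) - L (0, t, 1))"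
      by (intro continuous_intros continuous_on_compose2[OF L(1)]) (auto simp: S_def)
    show "exp (L (0, t + pi, 1) - L (0, t, 1)) = - 1" for t by (rule odd)
  qed simp
  then obtain C2 where C2: "\<And>t. L (0, t + pi, 1) - L (0, t, 1) = C2" by auto
  have "exp C2 = -1" unfolding C2[of 0, symmetric] by (rule odd)
  then have "C2 \<noteq> 0" by auto
  moreover have "C1 = 2 * C2"
    using C1[of 1 0 0] C2[of 0] C2[of pi] by (simp add: algebra_simps)
  ultimately have C10: "C1 \<noteq> 0" by simp
  have "exp C1 = 1"
    unfolding \<open>C1 = 2 * C2\<close> mult_2 exp_add \<open>exp C2 = -1\<close> by simp
  \<comment> \<open>By \<open>mob_diff\<close> a reversing \<open>g\<close> conjugates the
    difference and divides it by two factors \<open>q\<close>. These have a logarithm on the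
    contractible \<open>UH\<close>, so they contribute nothing to the increment over a full
    turn.\<close>
  define q where "q z = of_real c * mirror z + of_real d" for z :: complex
  have q0: "q z \<noteq> 0" if "z \<in> UH" for z
    unfolding q_def using mob_denom[OF det, of "mirror z"] that by simp
  have "continuous_on UH q" unfolding q_def mirror_def by (intro continuous_intros)
  then obtain Q where Q: "continuous_on UH Q" "\<And>z. z \<in> UH \<Longrightarrow> q z = exp (Q z)"
    using continuous_logarithm_on_contractible[OF _ convex_imp_contractible[OF convex_UH]] q0 by metis
  have "\<exists>v. \<forall>t\<in>UNIV. L (T, t, 0) - cnj (L (0, t, 0)) + Q (f (A (0, t, 0))) + Q (f (B (0, t, 0))) = v"
  proof (rule exp_constant_imp_constant[where c = "-1"])
    have c1: "continuous_on UNIV (\<lambda>t. A (0, t, 0))" "continuous_on UNIV (\<lambda>t. B (0, t, 0))"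
      unfolding A_def B_def by (auto intro!: continuous_intros)
    have c2: "continuous_on UNIV (\<lambda>t. f (A (0, t, 0)))" "continuous_on UNIV (\<lambda>t. f (B (0, t, 0)))"
      by (intro continuous_on_compose2[OF f(1)] c1; use A B in \<open>auto simp: S_def\<close>)+
    have c3: "continuous_on UNIV (\<lambda>t. Q (f (A (0, t, 0))))" "continuous_on UNIV (\<lambda>t. Q (f (B (0, t, 0))))"
      by (intro continuous_on_compose2[OF Q(1)] c2; use A B f(2) in \<open>auto simp: S_def\<close>)+
    show "continuous_on UNIV (\<lambda>t. L (T, t, 0) - cnj (L (0, t, 0)) + Q (f (A (0, t, 0))) + Q (f (B (0, t, 0))))"
      by (intro continuous_intros c3 continuous_on_compose2[OF L(1)]) (auto simp: S_def)
    fix t :: real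
    have p: "(T, t, 0) \<in> S" "(0, t, 0) \<in> S" by (auto simp: S_def)
    define u v where "u = f (A (0, t, 0))" "v = f (B (0, t, 0))"
    have uv: "u \<in> UH" "v \<in> UH" using f(2) A B[OF p(2)] by (auto simp: u_v_def)
    have sh: "A (T, t, 0) = A (0, t, 0) + \<i> * of_real T" "B (T, t, 0) = B (0, t, 0) + \<i> * of_real T"
      by (simp_all add: A_def B_def algebra_simps)
    have "G (T, t, 0) = g u - g v" using g(2) A B[OF p(2)] by (simp add: G_def sh u_v_def)
    also have "\<dots> = mob a b c d (mirror u) - mob a b c d (mirror v)" using h(2) abcd(2) uv by simp
    also have "\<dots> = (mirror u - mirror v) / (q u * q v)"
      using mob_diff[OF det, of "mirror u" "mirror v"] uv abcd(1) by (simp add: q_def)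
    also have "mirror u - mirror v = - cnj (G (0, t, 0))" by (simp add: mirror_def G_def u_v_def)
    finally have "exp (L (T, t, 0)) * (exp (Q u) * exp (Q v)) = - exp (cnj (L (0, t, 0)))"
      using q0 uv Q(2) L(2) p by (simp add: exp_cnj field_simps)
    then show "exp (L (T, t, 0) - cnj (L (0, t, 0)) + Q (f (A (0, t, 0))) + Q (f (B (0, t, 0)))) = - 1"
      by (simp add: exp_add exp_diff u_v_def field_simps)
  qed simp
  then obtain V where V: "\<And>t. L (T, t, 0) - cnj (L (0, t, 0)) + Q (f (A (0, t, 0))) + Q (f (B (0, t, 0))) = V"
    by auto
  have AB: "A (0, 0 + 2 * pi, 0) = A (0, 0, 0)" "B (0, 0 + 2 * pi, 0) = B (0, 0, 0)"
    unfolding A_def B_def by simp_all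
  define K where "K = Q (f (A (0, 0, 0))) + Q (f (B (0, 0, 0)))"
  have e1: "L (T, 0, 0) - cnj (L (0, 0, 0)) = V - K"
    using V[of 0] by (simp add: K_def eq_diff_eq add.assoc)
  have "L (T, 0 + 2 * pi, 0) - cnj (L (0, 0 + 2 * pi, 0)) + Q (f (A (0, 0, 0))) + Q (f (B (0, 0, 0))) = V"
    using V[of "0 + 2 * pi"] unfolding AB .
  then have e2: "L (T, 0 + 2 * pi, 0) - cnj (L (0, 0 + 2 * pi, 0)) = V - K"
    unfolding K_def by (simp only: eq_diff_eq add.assoc)
  have e3: "L (T, 0 + 2 * pi, 0) - L (T, 0, 0) = C1" "L (0, 0 + 2 * pi, 0) - L (0, 0, 0) = C1"
    by (rule C1; simp)+
  have "L (T, 0 + 2 * pi, 0) - L (T, 0, 0) = cnj (L (0, 0 + 2 * pi, 0)) - cnj (L (0, 0, 0))"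
  proof -
    have "w - u = x - v" if "u - v = y" "w - x = y" for u v w x y :: complex
    proof -
      have "u = y + v" "w = y + x" using that by (simp_all add: diff_eq_eq)
      then show ?thesis by simp
    qed
    then show ?thesis using e1 e2 by blast
  qed
  \<comment> \<open>The increment at \<open>T\<close> equals both \<open>C1\<close> and the
    conjugate of the increment at 0. But \<open>C1\<close> is a nonzero multiple of
    \<open>2 * pi * \<i>\<close>.\<close>
  then have "C1 = cnj C1" unfolding complex_cnj_diff[symmetric] e3 .
  then have "Im C1 = 0" by (simp add: complex_eq_iff)
  moreover obtain n :: int where "C1 = of_int (2 * n) * of_real pi * \<i>"
  proof -
    have "exp C1 = exp 0" using \<open>exp C1 = 1\<close> by simp
    then show ?thesis using that unfolding exp_eq by auto
  qed
  ultimately show False using C10 by simp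
qed

text \<open>Otherwise \<open>mirror\<close> itself would be a fractional linear map with real
  coefficients, which its values at three points exclude.\<close>

lemma mirror_not_Isop:
  assumes "g \<in> Isop" shows "(\<lambda>z. g (mirror z)) \<notin> Isop"
proof
  assume "(\<lambda>z. g (mirror z)) \<in> Isop"
  moreover obtain h where h: "h \<in> Isop" "\<And>z. z \<in> UH \<Longrightarrow> h (g z) = z" "\<And>z. z \<in> UH \<Longrightarrow> g (h z) = z"
    by (rule Isop_inv[OF assms], rule that)
  ultimately have hg: "(\<lambda>z. h (g (mirror z))) \<in> Isop" using Isop_comp by blast
  obtain a b c d where abcd: "a * d - b * c = 1" "\<And>z. z \<in> UH \<Longrightarrow> h (g (mirror z)) = mob a b c d z"
    by (rule IsopE[OF hg], rule that)
  have eq: "mirror z * (of_real c * z + of_real d) = of_real a * z + of_real b" if "z \<in> UH" for z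
  proof -
    have "mirror z = mob a b c d z" using abcd(2)[OF that] h(2) that by simp
    moreover have "of_real c * z + of_real d \<noteq> 0" using mob_denom[of a d b c z] abcd that by simp
    ultimately show ?thesis by (simp add: mob_def eq_divide_eq)
  qed
  have U: "\<i> \<in> UH" "2 * \<i> \<in> UH" "1 + \<i> \<in> UH" by (auto simp: UH_iff)
  have 1: "a = d" "b = - c" using eq[OF U(1)] by (auto simp: complex_eq_iff mirror_def)
  have "b = - 4 * c" using eq[OF U(2)] by (auto simp: complex_eq_iff mirror_def)
  then have "b = 0" "c = 0" using 1 by auto
  then show False using eq[OF U(3)] 1 abcd(1) by (auto simp: complex_eq_iff mirror_def)
qed

text \<open>The surface keeps its own type; only the covering followed by the embedding
  \<open>j\<close> has its base in a normed space. \<open>deck\<close> says that the deck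
  transformations act transitively on the fibres, \<open>free\<close> that they act freely.\<close>

locale hyperbolic_covering =
  fixes N :: "'a::t2_space set" and j :: "'a \<Rightarrow> 'e::real_normed_vector" and k :: "'e \<Rightarrow> 'a"
    and \<pi> :: "complex \<Rightarrow> 'a"
  assumes hom: "homeomorphism N (j ` N) j k"
    and cov: "covering_space UH (\<lambda>z. j (\<pi> z)) (j ` N)"
    and pi_in: "\<And>z. z \<in> UH \<Longrightarrow> \<pi> z \<in> N"
    and deck: "\<And>z z'. z \<in> UH \<Longrightarrow> z' \<in> UH \<Longrightarrow> \<pi> z = \<pi> z' \<Longrightarrow> \<exists>g\<in>Isom. g z = z' \<and> (\<forall>u\<in>UH. \<pi> (g u) = \<pi> u)"
    and free: "\<And>g z w. g \<in> Isom \<Longrightarrow> \<forall>u\<in>UH. \<pi> (g u) = \<pi> u \<Longrightarrow> z \<in> UH \<Longrightarrow> g z = z \<Longrightarrow> w \<in> UH \<Longrightarrow> g w = w"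
begin

section \<open>The deck group, lifting, and the fundamental group\<close>

definition Deck :: "(complex \<Rightarrow> complex) set" where
  "Deck = {g\<in>Isom. \<forall>u\<in>UH. \<pi> (g u) = \<pi> u}"

lemma DeckD: "g \<in> Deck \<Longrightarrow> g \<in> Isom" "g \<in> Deck \<Longrightarrow> u \<in> UH \<Longrightarrow> \<pi> (g u) = \<pi> u"
  by (auto simp: Deck_def)

lemma Deck_UH: "g \<in> Deck \<Longrightarrow> u \<in> UH \<Longrightarrow> g u \<in> UH"
  using DeckD Isom_UH by blast

lemma Deck_comp: "g \<in> Deck \<Longrightarrow> h \<in> Deck \<Longrightarrow> (\<lambda>z. g (h z)) \<in> Deck"
  using Isom_comp[of g h] Isom_UH[of h] by (auto simp: Deck_def)

lemma Deck_funpow: "g \<in> Deck \<Longrightarrow> (g ^^ n) \<in> Deck"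
proof (induction n)
  case 0
  have "(\<lambda>z. z) \<in> Deck" using id_Isop Isop_subset by (auto simp: Deck_def)
  then show ?case by (simp add: id_def)
next
  case (Suc n) then show ?case using Deck_comp[of g "g ^^ n"] by (simp add: comp_def)
qed

lemma Deck_fixed: "g \<in> Deck \<Longrightarrow> z \<in> UH \<Longrightarrow> g z = z \<Longrightarrow> w \<in> UH \<Longrightarrow> g w = w"
  using free[of g z w] by (auto simp: Deck_def)

lemma Deck_ex: "z \<in> UH \<Longrightarrow> z' \<in> UH \<Longrightarrow> \<pi> z = \<pi> z' \<Longrightarrow> \<exists>g\<in>Deck. g z = z'"
  using deck[of z z'] by (auto simp: Deck_def)

lemma j_inj: "inj_on j N"
  using hom unfolding homeomorphism_def by (metis inj_onI)

lemma continuous_pi: "continuous_on UH \<pi>"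
proof -
  have kj: "k (j x) = x" if "x \<in> N" for x using hom that by (auto simp: homeomorphism_def)
  have "continuous_on (j ` N) k" using hom by (auto simp: homeomorphism_def)
  moreover have "continuous_on UH (\<lambda>z. j (\<pi> z))" using cov covering_space_imp_continuous by blast
  ultimately have "continuous_on UH (\<lambda>z. k (j (\<pi> z)))"
    by (rule continuous_on_compose2) (use pi_in in auto)
  then show ?thesis using kj pi_in by (simp cong: continuous_on_cong)
qed

lemma lift_unique:
  assumes T: "connected T" "a \<in> T" "x \<in> T"
    and g: "continuous_on T g1" "\<And>x. x \<in> T \<Longrightarrow> g1 x \<in> UH" "continuous_on T g2" "\<And>x. x \<in> T \<Longrightarrow> g2 x \<in> UH"
    and eq: "\<And>x. x \<in> T \<Longrightarrow> \<pi> (g1 x) = \<pi> (g2 x)" "g1 a = g2 a"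
  shows "g1 x = g2 x"
proof (rule covering_space_lift_unique[OF cov, of g1 a g2 T "\<lambda>x. j (\<pi> (g1 x))"])
  have c: "continuous_on UH (\<lambda>z. j (\<pi> z))" using cov covering_space_imp_continuous by blast
  show "continuous_on T (\<lambda>x. j (\<pi> (g1 x)))"
    by (rule continuous_on_compose2[OF c g(1)]) (use g in auto)
qed (use assms pi_in in auto)

lemma lift:
  fixes f :: "'c::real_normed_vector \<Rightarrow> 'a"
  assumes U: "convex U" "u0 \<in> U" and f: "continuous_on U f" "\<And>u. u \<in> U \<Longrightarrow> f u \<in> N"
    and z0: "z0 \<in> UH" "\<pi> z0 = f u0"
  obtains g where "continuous_on U g" "\<And>u. u \<in> U \<Longrightarrow> g u \<in> UH" "\<And>u. u \<in> U \<Longrightarrow> \<pi> (g u) = f u" "g u0 = z0"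
proof -
  have "continuous_on N j" using hom by (simp add: homeomorphism_def)
  then have c: "continuous_on U (\<lambda>u. j (f u))"
    by (rule continuous_on_compose2[OF _ f(1)]) (use f(2) in auto)
  have fj: "(\<lambda>u. j (f u)) \<in> U \<rightarrow> j ` N" using f(2) by auto
  obtain g0 where g0: "continuous_on U g0" "g0 \<in> U \<rightarrow> UH" "\<And>y. y \<in> U \<Longrightarrow> j (\<pi> (g0 y)) = j (f y)"
    by (rule covering_space_lift[OF cov convex_imp_simply_connected[OF U(1)] convex_imp_locally_path_connected[OF U(1)] c fj], rule that)
  have g0U: "g0 u \<in> UH" if "u \<in> U" for u using g0(2) that by auto
  have g0f: "\<pi> (g0 u) = f u" if "u \<in> U" for u
    using inj_onD[OF j_inj g0(3)[OF that]] pi_in[OF g0U[OF that]] f(2)[OF that] by simp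
  \<comment> \<open>The lift \<open>g0\<close> may take any value over \<open>f u0\<close>;
    transitivity on the fibre corrects it to \<open>z0\<close>.\<close>
  obtain h where h: "h \<in> Deck" "h (g0 u0) = z0"
    using Deck_ex[OF g0U[OF U(2)] z0(1)] g0f[OF U(2)] z0(2) by auto
  show ?thesis
  proof (rule that[of "\<lambda>u. h (g0 u)"])
    show "continuous_on U (\<lambda>u. h (g0 u))"
      by (rule continuous_on_compose2[OF continuous_on_Isom[OF DeckD(1)[OF h(1)]] g0(1)]) (use g0U in auto)
    show "h (g0 u) \<in> UH" if "u \<in> U" for u using Deck_UH[OF h(1) g0U[OF that]] .
    show "\<pi> (h (g0 u)) = f u" if "u \<in> U" for u using DeckD(2)[OF h(1) g0U[OF that]] g0f[OF that] by simp
  qed (rule h(2))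
qed

lemma i_UH: "\<i> \<in> UH"
  by (simp add: UH_iff)

lemma path_pi: "path p \<Longrightarrow> path_image p \<subseteq> UH \<Longrightarrow> path (\<pi> \<circ> p) \<and> path_image (\<pi> \<circ> p) \<subseteq> N"
  using path_continuous_image[of p \<pi>] continuous_on_subset[OF continuous_pi, of "path_image p"] pi_in
  by (auto simp: path_image_compose)

text \<open>The passage from deck transformations to based loops at the image of
  \<open>\<i>\<close>. A straight segment serves as path since \<open>UH\<close> is convex, and only
  the value \<open>g \<i>\<close> enters.\<close>

definition cls :: "(complex \<Rightarrow> complex) \<Rightarrow> (real \<Rightarrow> 'a) set" where
  "cls g = based_class N (\<pi> \<circ> linepath \<i> (g \<i>))"

lemma segment_UH: "z \<in> UH \<Longrightarrow> w \<in> UH \<Longrightarrow> path_image (linepath z w) \<subseteq> UH"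
  using convex_UH unfolding convex_contains_segment by simp

lemma cls_eq:
  assumes "g \<in> Deck" "path p" "path_image p \<subseteq> UH" "pathstart p = \<i>" "pathfinish p = g \<i>"
  shows "cls g = based_class N (\<pi> \<circ> p)"
proof -
  have gi: "g \<i> \<in> UH" by (rule Deck_UH[OF assms(1) i_UH])
  have "homotopic_paths UH (linepath \<i> (g \<i>)) p"
    using convex_imp_simply_connected[OF convex_UH] segment_UH[OF i_UH gi] assms
    unfolding simply_connected_eq_homotopic_paths by simp
  then have "homotopic_paths N (\<pi> \<circ> linepath \<i> (g \<i>)) (\<pi> \<circ> p)"
    by (rule homotopic_paths_continuous_image[OF _ continuous_pi]) (use pi_in in auto)
  then show ?thesis unfolding cls_def by (rule based_class_eq)
qed

text \<open>The second loop is lifted from \<open>g \<i>\<close> by applying \<open>g\<close> to its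
  segment, so the joined lift ends at \<open>g (h \<i>)\<close>.\<close>

lemma cls_comp:
  assumes g: "g \<in> Deck" and h: "h \<in> Deck"
  shows "cls g \<otimes>\<^bsub>fundamental_group N (\<pi> \<i>)\<^esub> cls h = cls (\<lambda>z. g (h z))"
proof -
  let ?lg = "linepath \<i> (g \<i>)" and ?lh = "linepath \<i> (h \<i>)"
  have U: "g \<i> \<in> UH" "h \<i> \<in> UH" using Deck_UH g h i_UH by auto
  note pg = path_pi[OF path_linepath segment_UH[OF i_UH U(1)]]
  note ph = path_pi[OF path_linepath segment_UH[OF i_UH U(2)]]
  have lh: "path_image ?lh \<subseteq> UH" by (rule segment_UH[OF i_UH U(2)])
  have gh: "path (g \<circ> ?lh)" "path_image (g \<circ> ?lh) \<subseteq> UH"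
    using path_continuous_image[OF path_linepath continuous_on_subset[OF continuous_on_Isom[OF DeckD(1)[OF g]] lh]]
      lh Deck_UH[OF g] by (auto simp: path_image_compose)
  have q: "path (?lg +++ (g \<circ> ?lh))" "path_image (?lg +++ (g \<circ> ?lh)) \<subseteq> UH"
    using gh(1) subset_path_image_join[OF segment_UH[OF i_UH U(1)] gh(2)] by (simp_all add: pathstart_compose)
  have "cls g \<otimes>\<^bsub>fundamental_group N (\<pi> \<i>)\<^esub> cls h = based_class N ((\<pi> \<circ> ?lg) +++ (\<pi> \<circ> ?lh))"
    unfolding cls_def using pg ph DeckD(2)[OF g i_UH]
    by (intro fundamental_group_mult_based_class) (auto simp: pathstart_compose pathfinish_compose)
  also have "\<dots> = based_class N ((\<pi> \<circ> ?lg) +++ (\<pi> \<circ> (g \<circ> ?lh)))"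
  proof (rule based_class_eq, rule homotopic_paths_join)
    show "homotopic_paths N (\<pi> \<circ> ?lg) (\<pi> \<circ> ?lg)" using pg by simp
    show "homotopic_paths N (\<pi> \<circ> ?lh) (\<pi> \<circ> (g \<circ> ?lh))"
    proof (rule homotopic_paths_eq)
      fix t :: real assume "t \<in> {0..1}"
      then have "?lh t \<in> UH" using lh by (auto simp: path_image_def)
      then show "(\<pi> \<circ> ?lh) t = (\<pi> \<circ> (g \<circ> ?lh)) t" using DeckD(2)[OF g] by simp
    qed (use ph in auto)
    show "pathfinish (\<pi> \<circ> ?lg) = pathstart (\<pi> \<circ> ?lh)"
      using DeckD(2)[OF g i_UH] by (simp add: pathstart_compose pathfinish_compose)
  qed
  also have "\<dots> = based_class N (\<pi> \<circ> (?lg +++ (g \<circ> ?lh)))" by (simp add: path_compose_join)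
  also have "\<dots> = cls (\<lambda>z. g (h z))"
    by (rule cls_eq[OF Deck_comp[OF g h] q, symmetric]) (simp_all add: pathfinish_compose)
  finally show ?thesis .
qed

lemma cls_one:
  assumes "g \<i> = \<i>" shows "cls g = \<one>\<^bsub>fundamental_group N (\<pi> \<i>)\<^esub>"
proof -
  have "\<pi> \<circ> linepath \<i> (g \<i>) = (\<lambda>_. \<pi> \<i>)" using assms by (simp add: fun_eq_iff linepath_refl)
  then show ?thesis by (simp add: cls_def fundamental_group_def)
qed

lemma cls_carrier: "g \<in> Deck \<Longrightarrow> cls g \<in> carrier (fundamental_group N (\<pi> \<i>))"
proof -
  assume g: "g \<in> Deck"
  note p = path_pi[OF path_linepath segment_UH[OF i_UH Deck_UH[OF g i_UH]]]
  have "pathstart (\<pi> \<circ> linepath \<i> (g \<i>)) = \<pi> \<i>" "pathfinish (\<pi> \<circ> linepath \<i> (g \<i>)) = \<pi> \<i>"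
    using DeckD(2)[OF g i_UH] by (simp_all add: pathstart_compose pathfinish_compose)
  then show ?thesis using p unfolding cls_def fundamental_group_def by auto
qed

lemma cls_cong: "g \<i> = h \<i> \<Longrightarrow> cls g = cls h"
  by (simp add: cls_def)

text \<open>Stated for a family indexed by the integers, so that negative powers need no inverse
  map; as \<open>cls\<close> sees only the value at \<open>\<i>\<close>, the power laws are required
  only there.\<close>

lemma cls_int_pow:
  assumes A: "\<And>m::int. A m \<in> Deck" "A 0 \<i> = \<i>" "\<And>m n. A (m + n) \<i> = A m (A n \<i>)"
  shows "cls (A 1) [^]\<^bsub>fundamental_group N (\<pi> \<i>)\<^esub> m = cls (A m)"
proof -
  let ?G = "fundamental_group N (\<pi> \<i>)"
  interpret G: group ?G by (rule group_fundamental_group) (rule pi_in[OF i_UH])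
  have add: "cls (A m) \<otimes>\<^bsub>?G\<^esub> cls (A n) = cls (A (m + n))" for m n
    unfolding cls_comp[OF A(1) A(1)] by (rule cls_cong) (simp add: A(3))
  have one: "cls (A 0) = \<one>\<^bsub>?G\<^esub>" by (rule cls_one) (rule A(2))
  have nat: "cls (A 1) [^]\<^bsub>?G\<^esub> n = cls (A (int n))" for n :: nat
    by (induction n) (simp_all add: one add add.commute)
  show ?thesis
  proof (cases "m \<ge> 0")
    case True
    then show ?thesis using nat[of "nat m"] int_pow_int[of ?G "cls (A 1)" "nat m"] by simp
  next
    case False
    define n where "n = nat (- m)"
    have n: "m = - int n" using False by (simp add: n_def)
    have "cls (A (- int n)) \<otimes>\<^bsub>?G\<^esub> cls (A (int n)) = \<one>\<^bsub>?G\<^esub>" by (simp add: add one)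
    then have "inv\<^bsub>?G\<^esub> (cls (A (int n))) = cls (A (- int n))"
      using cls_carrier A(1) by (intro G.inv_equality) auto
    then show ?thesis using nat[of n] cls_carrier[OF A(1)] by (simp add: n G.int_pow_neg_int)
  qed
qed

text \<open>A free homotopy from the loop of \<open>g\<close> to the core circle is lifted to
  \<open>UH\<close>; its sides show that \<open>g\<close> also joins the ends of the lifted core.
  The map \<open>e (exp w)\<close> on the left half plane is the universal covering of the punctured
  disc, and its lift \<open>f\<close> inherits the equivariance.\<close>

lemma puncture_lift:
  assumes N: "N = S - F" and g: "g \<in> Deck" and punct: "puncture_class S F (unbased N (cls g))"
  obtains e T f where "e 0 \<in> F" "continuous_on (ball (0::complex) 1) e" "inj_on e (ball 0 1)"
    "continuous_on {w. Re w < 0} f" "\<And>w. Re w < 0 \<Longrightarrow> f w \<in> UH"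
    "\<And>w. Re w < 0 \<Longrightarrow> \<pi> (f w) = e (exp w)"
    "\<And>w. Re w < 0 \<Longrightarrow> f (w + \<i> * of_real T) = g (f w)"
proof -
  let ?l = "\<pi> \<circ> linepath \<i> (g \<i>)"
  have gi: "g \<i> \<in> UH" by (rule Deck_UH[OF g i_UH])
  note pl = path_pi[OF path_linepath segment_UH[OF i_UH gi]]
  have lps: "pathfinish ?l = pathstart ?l"
    using DeckD(2)[OF g i_UH] by (simp add: pathstart_compose pathfinish_compose)
  have "unbased N (cls g) = free_class N ?l"
    unfolding cls_def using pl lps by (intro unbased_based_class) auto
  then obtain \<eta> where \<eta>: "homotopic_loops N ?l \<eta>" "puncture_loop S F \<eta>"
    using punct by (auto simp: puncture_class_def free_class_def)
  obtain p U e e' and k :: int where pU: "p \<in> F" "openin (top_of_set S) U" "U \<inter> F = {p}"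
    "homeomorphism (ball (0::complex) 1) U e e'" "e 0 = p" "k \<noteq> 0"
    "homotopic_loops N \<eta> (\<lambda>t. e (cis (2 * pi * of_int k * t) / 2))"
    using \<eta>(2) unfolding puncture_loop_def N by blast
  define core where "core t = e (cis (2 * pi * of_int k * t) / 2)" for t
  have "homotopic_loops N ?l core" using homotopic_loops_trans[OF \<eta>(1) pU(7)] by (simp add: core_def[abs_def])
  then obtain h where h: "continuous_on ({0..1::real} \<times> {0..1::real}) h" "h \<in> ({0..1} \<times> {0..1}) \<rightarrow> N"
    "\<forall>x\<in>{0..1}. h (0, x) = ?l x" "\<forall>x\<in>{0..1}. h (1, x) = core x"
    "\<forall>t\<in>{0..1}. pathfinish (h \<circ> Pair t) = pathstart (h \<circ> Pair t)"
    unfolding homotopic_loops by blast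
  have h01: "h (t, 1) = h (t, 0)" if "t \<in> {0..1}" for t using h(5) that by (simp add: pathfinish_def pathstart_def)
  have sq: "convex ({0..1::real} \<times> {0..1::real})" by (intro convex_Times) auto
  have hN: "h u \<in> N" if "u \<in> {0..1} \<times> {0..1}" for u using h(2) that by blast
  have h00: "\<pi> \<i> = h (0, 0)" using h(3) by (simp add: linepath_def)
  have in00: "(0, 0) \<in> {0..1::real} \<times> {0..1::real}" by simp
  obtain H where H: "continuous_on ({0..1} \<times> {0..1}) H" "\<And>u. u \<in> {0..1} \<times> {0..1} \<Longrightarrow> H u \<in> UH"
    "\<And>u. u \<in> {0..1} \<times> {0..1} \<Longrightarrow> \<pi> (H u) = h u" "H (0, 0) = \<i>"
    by (rule lift[OF sq in00 h(1) hN i_UH h00], assumption, rule that)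
  have cH: "continuous_on {0..1} (\<lambda>x. H (c x))" if "continuous_on {0..1::real} c" "c ` {0..1} \<subseteq> {0..1} \<times> {0..1}" for c
    using continuous_on_compose2[OF H(1) that] by simp
  have conn01: "connected {0..1::real}" by simp
  \<comment> \<open>The side of the lifted square and the segment are lifts of the same loop with
    the same start.\<close>
  have H0: "H (0, 1) = linepath \<i> (g \<i>) 1"
  proof (rule lift_unique[OF conn01, of 0 1 "\<lambda>x. H (0, x)"])
    show "continuous_on {0..1} (\<lambda>x. H (0, x))" by (rule cH) (auto intro!: continuous_intros)
    show "H (0, x) \<in> UH" if "x \<in> {0..1}" for x using H(2) that by simp
    show "continuous_on {0..1} (linepath \<i> (g \<i>))" using path_linepath path_def by blast
    show "linepath \<i> (g \<i>) x \<in> UH" if "x \<in> {0..1}" for x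
      using segment_UH[OF i_UH gi] that by (auto simp: path_image_def)
    show "\<pi> (H (0, x)) = \<pi> (linepath \<i> (g \<i>) x)" if "x \<in> {0..1}" for x using H(3)[of "(0, x)"] h(3) that by simp
  qed (use H(4) in \<open>auto simp: linepath_def\<close>)
  then have H01: "H (0, 1) = g \<i>" by (simp add: linepath_def)
  \<comment> \<open>Both ends of the moving loop trace the same curve in the surface, so the lifted
    traces differ by the deck transformation \<open>g\<close> that relates their starting
    points.\<close>
  have H1: "H (1, 1) = g (H (1, 0))"
  proof (rule lift_unique[OF conn01, of 0 1 "\<lambda>t. H (t, 1)" "\<lambda>t. g (H (t, 0))"])
    show "continuous_on {0..1} (\<lambda>t. H (t, 1))" by (rule cH) (auto intro!: continuous_intros)
    have "continuous_on {0..1} (\<lambda>t. H (t, 0))" by (rule cH) (auto intro!: continuous_intros)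
    then show "continuous_on {0..1} (\<lambda>t. g (H (t, 0)))"
      by (rule continuous_on_compose2[OF continuous_on_Isom[OF DeckD(1)[OF g]]]) (use H(2) in auto)
    show "H (t, 1) \<in> UH" if "t \<in> {0..1}" for t using H(2) that by simp
    show "g (H (t, 0)) \<in> UH" if "t \<in> {0..1}" for t using Deck_UH[OF g H(2)] that by simp
    show "\<pi> (H (t, 1)) = \<pi> (g (H (t, 0)))" if "t \<in> {0..1}" for t
      using H(2,3)[of "(t, 0)"] H(3)[of "(t, 1)"] DeckD(2)[OF g] h01 that by simp
  qed (use H(4) H01 in auto)
  have e: "continuous_on (ball 0 1) e" "e ` ball 0 1 = U" "inj_on e (ball 0 1)"
    using pU(4) by (auto simp: homeomorphism_def intro: inj_on_inverseI[where g = e'])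
  define HP where "HP = {w::complex. Re w < 0}"
  have HP: "convex HP" unfolding HP_def by (rule convex_halfspace_Re_lt)
  have expb: "exp w \<in> ball 0 1" if "w \<in> HP" for w using that by (simp add: HP_def)
  \<comment> \<open>The core circle has radius \<open>1 / 2\<close>, the exponential of
    \<open>- ln 2\<close>.\<close>
  define w0 where "w0 = complex_of_real (- ln 2)"
  have w0: "w0 \<in> HP" by (simp add: HP_def w0_def)
  have ew0: "exp w0 = 1 / 2"
  proof -
    have "exp w0 = of_real (exp (- ln 2))" unfolding w0_def by (rule exp_of_real)
    also have "exp (- ln 2) = (1 / 2 :: real)" by (simp add: exp_minus)
    finally show ?thesis by simp
  qed
  have e0: "exp (w0 + \<i> * of_real \<theta>) = cis \<theta> / 2" for \<theta>
    by (simp add: exp_add ew0 cis_conv_exp)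
  have eN: "e (exp w) \<in> N" if "w \<in> HP" for w
  proof -
    have "e (exp w) \<in> U" using expb[OF that] e(2) by blast
    moreover have "e (exp w) \<noteq> p"
    proof
      assume "e (exp w) = p"
      then have "exp w = 0" using inj_onD[OF e(3), of "exp w" 0] expb[OF that] pU(5) by simp
      then show False by simp
    qed
    ultimately show ?thesis using pU(2,3) openin_imp_subset unfolding N by blast
  qed
  have cE: "continuous_on HP (\<lambda>w. e (exp w))"
    by (rule continuous_on_compose2[OF e(1)]) (use expb in \<open>auto intro!: continuous_intros\<close>)
  have start: "\<pi> (H (1, 0)) = e (exp w0)"
    using H(3)[of "(1, 0)"] h(4) by (simp add: core_def ew0)
  have H10: "H (1, 0) \<in> UH" using H(2) by simp
  obtain f where f: "continuous_on HP f" "\<And>w. w \<in> HP \<Longrightarrow> f w \<in> UH" "\<And>w. w \<in> HP \<Longrightarrow> \<pi> (f w) = e (exp w)" "f w0 = H (1, 0)"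
    by (rule lift[OF HP w0 cE eN H10 start], assumption, rule that)
  define T where "T = 2 * pi * of_int k"
  have shift: "w + \<i> * of_real x \<in> HP" if "w \<in> HP" for w x using that by (simp add: HP_def)
  have fT: "f (w0 + \<i> * of_real T) = g (f w0)"
  proof -
    have "f (w0 + \<i> * of_real (T * 1)) = H (1, 1)"
    proof (rule lift_unique[OF conn01, of 0 1 "\<lambda>x. f (w0 + \<i> * of_real (T * x))" "\<lambda>x. H (1, x)"])
      show "continuous_on {0..1} (\<lambda>x. f (w0 + \<i> * of_real (T * x)))"
        by (rule continuous_on_compose2[OF f(1)]) (use shift[OF w0] in \<open>auto simp del: of_real_mult intro!: continuous_intros\<close>)
      show "f (w0 + \<i> * of_real (T * x)) \<in> UH" for x by (rule f(2)[OF shift[OF w0]])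
      show "continuous_on {0..1} (\<lambda>x. H (1, x))" by (rule cH) (auto intro!: continuous_intros)
      show "H (1, x) \<in> UH" if "x \<in> {0..1}" for x using H(2) that by simp
      show "\<pi> (f (w0 + \<i> * of_real (T * x))) = \<pi> (H (1, x))" if "x \<in> {0..1}" for x
        unfolding f(3)[OF shift[OF w0]] e0 using H(3)[of "(1, x)"] h(4) that by (simp add: core_def T_def mult.assoc)
    qed (use f(4) in auto)
    then show ?thesis using H1 f(4) by simp
  qed
  have equi: "f (w + \<i> * of_real T) = g (f w)" if w: "w \<in> HP" for w
  proof (rule lift_unique[of HP w0 w "\<lambda>w. f (w + \<i> * of_real T)" "\<lambda>w. g (f w)"])
    show "connected HP" using HP convex_connected by blast
    show "continuous_on HP (\<lambda>w. f (w + \<i> * of_real T))"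
      by (rule continuous_on_compose2[OF f(1)]) (use shift in \<open>auto intro!: continuous_intros\<close>)
    show "continuous_on HP (\<lambda>w. g (f w))"
      by (rule continuous_on_compose2[OF continuous_on_Isom[OF DeckD(1)[OF g]] f(1)]) (use f(2) in auto)
    show "f (w + \<i> * of_real T) \<in> UH" if "w \<in> HP" for w by (rule f(2)[OF shift[OF that]])
    show "g (f w) \<in> UH" if "w \<in> HP" for w by (rule Deck_UH[OF g f(2)[OF that]])
    show "\<pi> (f (w + \<i> * of_real T)) = \<pi> (g (f w))" if "w \<in> HP" for w
    proof -
      have "exp (w + \<i> * of_real T) = exp w"
        unfolding exp_eq by (rule exI[of _ k]) (simp add: T_def mult_ac)
      then show ?thesis using f(3)[OF shift[OF that], of T] f(3)[OF that] DeckD(2)[OF g f(2)[OF that]] by simp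
    qed
  qed (use w w0 fT in auto)
  show ?thesis
    by (rule that[of e f T]) (use pU e f equi in \<open>auto simp: HP_def\<close>)
qed

text \<open>\<delta> lifts a circle around the puncture so small that it misses \<open>K\<close>.
  For the orientation, points at distance at most 2 with equal exponentials coincide because
  \<open>2 < 2 * pi\<close>; this is the injectivity asked for in
  \<open>equivariant_orientation_preserving\<close>.\<close>

lemma puncture_deck:
  assumes N: "N = S - F" and g: "g \<in> Deck" and punct: "puncture_class S F (unbased N (cls g))"
    and K: "compact K" "K \<subseteq> N"
  obtains \<delta> where "g \<in> Isop" "continuous_on UNIV \<delta>" "\<And>x::real. \<delta> x \<in> UH" "\<And>x. \<delta> (x + 1) = g (\<delta> x)"
    "\<And>x. \<pi> (\<delta> x) \<notin> K"
proof -
  obtain e T f where e: "e 0 \<in> F" "continuous_on (ball (0::complex) 1) e" "inj_on e (ball 0 1)"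
    and f: "continuous_on {w. Re w < 0} f" "\<And>w. Re w < 0 \<Longrightarrow> f w \<in> UH"
    "\<And>w. Re w < 0 \<Longrightarrow> \<pi> (f w) = e (exp w)"
    "\<And>w. Re w < 0 \<Longrightarrow> f (w + \<i> * of_real T) = g (f w)"
    by (rule puncture_lift[OF N g punct], rule that)
  have gI: "g \<in> Isop"
  proof (rule equivariant_orientation_preserving[OF f(1) f(2) _ DeckD(1)[OF g] f(4)])
    fix w w' assume w: "Re w < 0" "Re w' < 0" "cmod (w - w') \<le> 2" "f w = f w'"
    have "e (exp w) = e (exp w')" using f(3) w by metis
    then have "exp w = exp w'" using inj_onD[OF e(3), of "exp w" "exp w'"] w by simp
    then obtain n :: int where n: "w = w' + (of_int (2 * n) * pi) * \<i>" unfolding exp_eq by blast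
    have "2 * pi * \<bar>real_of_int n\<bar> \<le> 2" using w(3) n by (simp add: norm_mult mult_ac)
    then have "n = 0"
    proof -
      have False if "\<bar>real_of_int n\<bar> \<ge> 1"
      proof -
        have "2 * pi * 1 \<le> 2 * pi * \<bar>real_of_int n\<bar>" using that by (intro mult_left_mono) auto
        then show False using \<open>2 * pi * \<bar>real_of_int n\<bar> \<le> 2\<close> pi_gt3 by linarith
      qed
      then show ?thesis by (metis int_one_le_iff_zero_less of_int_1_le_iff of_int_abs zero_less_abs_iff)
    qed
    then show "w = w'" using n by simp
  qed
  have "\<exists>\<rho>>0. \<forall>u\<in>ball 0 1. cmod u < \<rho> \<longrightarrow> e u \<notin> K"
  proof -
    have "open (- K)" using K(1) compact_imp_closed by blast
    then have "open (ball 0 1 \<inter> e -` (- K))" using continuous_open_preimage[OF e(2) open_ball] by blast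
    moreover have "0 \<in> ball 0 1 \<inter> e -` (- K)" using e(1) K(2) N by auto
    ultimately obtain \<rho> where "\<rho> > 0" "ball 0 \<rho> \<subseteq> ball 0 1 \<inter> e -` (- K)"
      using open_contains_ball by blast
    then show ?thesis by (intro exI[of _ \<rho>]) (auto simp: subset_iff)
  qed
  then obtain \<rho> where \<rho>: "\<rho> > 0" "\<forall>u\<in>ball 0 1. cmod u < \<rho> \<longrightarrow> e u \<notin> K" by blast
  \<comment> \<open>The vertical line with real part \<open>r\<close> is mapped by
    \<open>exp\<close> to a circle whose radius is below both \<rho> and 1.\<close>
  define r where "r = ln (min \<rho> 1 / 2)"
  have m: "0 < min \<rho> 1 / 2" "min \<rho> 1 / 2 < 1" "min \<rho> 1 / 2 < \<rho>" using \<rho>(1) by auto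
  have r: "r < 0" using m by (simp add: r_def)
  have er: "exp r = min \<rho> 1 / 2" using m by (simp add: r_def)
  define \<delta> where "\<delta> x = f (of_real r + \<i> * of_real (T * x))" for x
  show ?thesis
  proof (rule that[OF gI])
    show "continuous_on UNIV \<delta>"
      unfolding \<delta>_def by (rule continuous_on_compose2[OF f(1)]) (use r in \<open>auto intro!: continuous_intros\<close>)
    show "\<delta> x \<in> UH" for x unfolding \<delta>_def using r by (intro f(2)) simp
    show "\<delta> (x + 1) = g (\<delta> x)" for x
    proof -
      have "of_real r + \<i> * of_real (T * (x + 1)) = (of_real r + \<i> * of_real (T * x)) + \<i> * of_real T"
        by (simp add: algebra_simps)
      then show ?thesis unfolding \<delta>_def using r by (simp only:) (rule f(4), simp)
    qed
    show "\<pi> (\<delta> x) \<notin> K" for x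
    proof -
      have n: "cmod (exp (of_real r + \<i> * of_real (T * x))) = min \<rho> 1 / 2"
        using er by simp
      have "\<pi> (\<delta> x) = e (exp (of_real r + \<i> * of_real (T * x)))" unfolding \<delta>_def using r by (intro f(3)) simp
      moreover have "exp (of_real r + \<i> * of_real (T * x)) \<in> ball 0 1"
        unfolding mem_ball_0 n by (rule m(2))
      ultimately show ?thesis using \<rho>(2) n m(3) by (metis)
    qed
  qed
qed

end

section \<open>Peripheral products\<close>

lemma scale_Isop: "r > 0 \<Longrightarrow> (\<lambda>z. of_real r * z) \<in> Isop"
  by (rule mob_normalise[of r 1 0 0]) (auto simp: mob_def)

lemma UH_scale: "r > 0 \<Longrightarrow> z \<in> UH \<Longrightarrow> of_real r * z \<in> UH"
  by (simp add: UH_iff)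

lemma mirror_scale: "mirror (of_real r * z) = of_real r * mirror z"
  by (simp add: mirror_def)

lemma mirror_axis: "mirror (\<i> * of_real y) = \<i> * of_real y"
  by (simp add: mirror_def)

lemma mob_cancel: "t \<noteq> 0 \<Longrightarrow> mob (t * a) (t * b) (t * c) (t * d) z = mob a b c d z"
proof -
  assume "t \<noteq> 0"
  moreover have "mob (t * a) (t * b) (t * c) (t * d) z =
      (of_real t * (of_real a * z + of_real b)) / (of_real t * (of_real c * z + of_real d))"
    by (simp add: mob_def algebra_simps)
  ultimately show ?thesis by (simp add: mob_def)
qed

context hyperbolic_covering
begin

text \<open>The lifted geodesic and its shift by one period lie over the same curve, so a deck
  transformation realises the shift; off the axis only a reflection remains undetermined.\<close>

lemma period_deck:
  assumes h: "h \<in> Isop" and c: "\<And>u. c u = \<pi> (h (\<i> * of_real (exp (v * u))))" "\<And>u::real. c (u + 1) = c u" and v: "v > 0"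
  obtains g where "g \<in> Deck"
    "(\<forall>z\<in>UH. g (h z) = h (of_real (exp v) * z)) \<or> (\<forall>z\<in>UH. g (h z) = h (of_real (exp v) * mirror z))"
proof -
  define p where "p u = h (\<i> * of_real (exp (v * u)))" for u :: real
  have pU: "p u \<in> UH" for u unfolding p_def using h iy_UH by (rule Isop_UH)
  have cp: "\<pi> (p u) = c u" for u using c(1) by (simp add: p_def)
  have "\<pi> (p 0) = \<pi> (p (0 + 1))" unfolding cp c(2) ..
  then obtain g where g: "g \<in> Deck" "g (p 0) = p (0 + 1)" using Deck_ex[OF pU pU] by blast
  have hc: "continuous_on UH h" using h Isop_subset continuous_on_Isom by blast
  have pc: "continuous_on UNIV p" unfolding p_def
    by (rule continuous_on_compose2[OF hc]) (auto intro!: continuous_intros)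
  have along: "g (p u) = p (u + 1)" for u
  proof (rule lift_unique[OF connected_UNIV UNIV_I UNIV_I, of "\<lambda>u. g (p u)" "\<lambda>u. p (u + 1)" 0])
    show "continuous_on UNIV (\<lambda>u. g (p u))"
      by (rule continuous_on_compose2[OF continuous_on_Isom[OF DeckD(1)[OF g(1)]] pc]) (use pU in auto)
    show "continuous_on UNIV (\<lambda>u. p (u + 1))"
      by (rule continuous_on_compose2[OF pc]) (auto intro!: continuous_intros)
    show "\<pi> (g (p x)) = \<pi> (p (x + 1))" for x
      unfolding DeckD(2)[OF g(1) pU] cp c(2) ..
  qed (use pU Deck_UH[OF g(1)] g(2) in auto)
  obtain hi where hi: "hi \<in> Isop" "\<And>z. z \<in> UH \<Longrightarrow> hi (h z) = z" "\<And>z. z \<in> UH \<Longrightarrow> h (hi z) = z"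
    by (rule Isop_inv[OF h], rule that)
  note sub = subsetD[OF Isop_subset]
  \<comment> \<open>\<open>g\<close> read in the coordinate of \<open>h\<close> with the shift
    undone; it fixes the axis pointwise.\<close>
  define D where "D z = of_real (exp (- v)) * hi (g (h z))" for z
  have D: "D \<in> Isom"
    unfolding D_def by (intro Isom_comp[OF sub[OF scale_Isop]] Isom_comp[OF sub[OF hi(1)]] Isom_comp[OF DeckD(1)[OF g(1)] sub[OF h]]) simp
  have D1: "D (\<i> * of_real (exp (v * u))) = \<i> * of_real (exp (v * u))" for u
  proof -
    have "hi (g (p u)) = \<i> * of_real (exp (v * (u + 1)))" unfolding along unfolding p_def by (rule hi(2)[OF iy_UH])
    then have "D (\<i> * of_real (exp (v * u))) = \<i> * of_real (exp (- v) * exp (v * (u + 1)))"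
      by (simp add: D_def p_def)
    also have "exp (- v) * exp (v * (u + 1)) = exp (v * u)" by (simp add: algebra_simps flip: exp_add)
    finally show ?thesis .
  qed
  have vne: "v * 0 \<noteq> v * 1" using v by simp
  have "(\<forall>z\<in>UH. g (h z) = h (of_real (exp v) * z)) \<or> (\<forall>z\<in>UH. g (h z) = h (of_real (exp v) * mirror z))"
  proof -
    have gD: "g (h z) = h (of_real (exp v) * D z)" if "z \<in> UH" for z
    proof -
      have "of_real (exp v) * D z = (of_real (exp v) * of_real (exp (- v))) * hi (g (h z))"
        by (simp only: D_def mult.assoc)
      also have "(of_real (exp v) * of_real (exp (- v)) :: complex) = of_real (exp v * exp (- v))" by (simp only: of_real_mult)
      also have "exp v * exp (- v) = (1::real)" by (simp add: exp_minus)
      finally show ?thesis using hi(3) Deck_UH[OF g(1) Isop_UH[OF h that]] by simp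
    qed
    then show ?thesis using Isom_fix_axis[OF D vne D1 D1] by auto
  qed
  then show ?thesis using that g(1) by blast
qed

text \<open>The problem in normal form: \<open>\<i>\<close> lies over the crossing point, the first
  geodesic lifts to the imaginary axis, the second to its image under the rotation \<open>h\<close>
  about \<open>\<i>\<close>, and \<open>c1 * s1 \<noteq> 0\<close> says that the two axes are
  different.\<close>

theorem peripheral_powers:
  fixes pa pb :: "real \<Rightarrow> 'a" and M :: "int set"
  assumes N: "N = S - F" and v: "v > 0" and w: "w > 0"
    and pa: "\<And>u. pa u = \<pi> (\<i> * of_real (exp (v * u)))" "\<And>u. pa (u + 1) = pa u"
    and c1: "c1\<^sup>2 + s1\<^sup>2 = 1" "c1 * s1 \<noteq> 0" and h: "\<And>z. z \<in> UH \<Longrightarrow> h z = mob c1 s1 (- s1) c1 z"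
    and pb: "\<And>u. pb u = \<pi> (h (\<i> * of_real (exp (w * u))))" "\<And>u. pb (u + 1) = pb u"
    and K: "compact K" "K \<subseteq> N" "\<And>u. pa u \<in> K" "\<And>u. pb u \<in> K"
    and M: "M = {m. m \<noteq> 0 \<and> puncture_class S F (unbased N
        (based_class N pa [^]\<^bsub>fundamental_group N (\<pi> \<i>)\<^esub> m \<otimes>\<^bsub>fundamental_group N (\<pi> \<i>)\<^esub> based_class N pb))}"
  shows "(\<forall>m\<in>M. odd m) \<and> (\<forall>m\<in>M. \<forall>n\<in>M. m < n \<longrightarrow> n = m + 2)"
proof -
  have hI: "h \<in> Isop"
    by (rule mob_normalise[OF _ h]) (use c1 in \<open>simp_all add: power2_eq_square\<close>)
  have hi: "h \<i> = \<i>"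
  proof -
    have "of_real (- s1) * \<i> + of_real c1 \<noteq> (0::complex)"
      by (rule mob_denom[OF _ i_UH, of c1 _ s1]) (use c1(1) in \<open>simp add: power2_eq_square\<close>)
    then show ?thesis unfolding h[OF i_UH] mob_def by (simp add: divide_eq_eq algebra_simps)
  qed
  define h' where "h' = mob c1 (- s1) s1 c1"
  have h'I: "h' \<in> Isop"
    by (rule mob_normalise[of c1 c1 "- s1" s1]) (use c1 in \<open>simp_all add: power2_eq_square h'_def\<close>)
  have det: "c1 * c1 - s1 * - s1 \<noteq> 0" "c1 * c1 - - s1 * s1 \<noteq> 0" using c1(1) by (simp_all add: power2_eq_square)
  have hh': "h (h' z) = z" if "z \<in> UH" for z
  proof -
    have "h (h' z) = mob (c1 * c1 + s1 * s1) (c1 * - s1 + s1 * c1) (- s1 * c1 + c1 * s1) (- s1 * - s1 + c1 * c1) z"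
      unfolding h[OF Isop_UH[OF h'I that]] unfolding h'_def by (rule mob_comp[OF det(2) that])
    also have "\<dots> = z" using c1(1) by (simp add: mob_def power2_eq_square add.commute mult.commute flip: of_real_mult of_real_add)
    finally show ?thesis .
  qed
  obtain gA where gA: "gA \<in> Deck" "(\<forall>z\<in>UH. gA z = of_real (exp v) * z) \<or> (\<forall>z\<in>UH. gA z = of_real (exp v) * mirror z)"
    by (rule period_deck[OF id_Isop pa v], rule that)
  then obtain ra :: bool where ra: "\<And>z. z \<in> UH \<Longrightarrow> gA z = of_real (exp v) * (if ra then mirror z else z)"
    by (metis (full_types))
  obtain gB where gB: "gB \<in> Deck" "(\<forall>z\<in>UH. gB (h z) = h (of_real (exp w) * z)) \<or> (\<forall>z\<in>UH. gB (h z) = h (of_real (exp w) * mirror z))"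
    by (rule period_deck[OF hI pb w], rule that)
  then obtain rb :: bool where rb: "\<And>z. z \<in> UH \<Longrightarrow> gB (h z) = h (of_real (exp w) * (if rb then mirror z else z))"
    by (metis (full_types))
  \<comment> \<open>The powers of \<open>gA\<close> in closed form, for negative exponents as
    well.\<close>
  define A :: "int \<Rightarrow> complex \<Rightarrow> complex"
    where "A m z = of_real (exp (v * of_int m)) * (if ra \<and> odd m then mirror z else z)" for m z
  have Aadd: "A (m + n) z = A m (A n z)" for m n z
  proof -
    have "exp (v * of_int (m + n)) = exp (v * of_int m) * exp (v * of_int n)" by (simp add: algebra_simps exp_add)
    then show ?thesis by (simp add: A_def mirror_scale del: of_int_add)
  qed
  have AU: "A m z \<in> UH" if "z \<in> UH" for m z using that by (simp add: A_def UH_scale)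
  have A1: "A 1 z = gA z" if "z \<in> UH" for z using ra[OF that] by (simp add: A_def)
  have A0: "A 0 z = z" for z by (simp add: A_def)
  have AD: "A m \<in> Deck" for m
  proof -
    have "A m \<in> Isom"
    proof (cases "ra \<and> odd m")
      case True
      then have "A m = (\<lambda>z. of_real (exp (v * of_int m)) * mirror z)" by (auto simp: A_def)
      then show ?thesis using Isom_comp[OF subsetD[OF Isop_subset scale_Isop] mirror_Isom, of "exp (v * of_int m)"] by simp
    next
      case False
      then have "A m = (\<lambda>z. of_real (exp (v * of_int m)) * z)" by (auto simp: A_def)
      then show ?thesis using subsetD[OF Isop_subset scale_Isop, of "exp (v * of_int m)"] by simp
    qed
    moreover have "\<pi> (A m z) = \<pi> z" if z: "z \<in> UH" for z
    proof -
      have step: "\<pi> (A (n + 1) z) = \<pi> (A n z)" for n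
        using DeckD(2)[OF gA(1) AU[OF z]] Aadd[of 1 n z] A1[OF AU[OF z]] by (simp add: add.commute)
      show ?thesis
      proof (induction m rule: int_induct[of _ 0])
        case base show ?case by (simp add: A0)
      next
        case (step1 i) then show ?case using step[of i] by simp
      next
        case (step2 i) then show ?case using step[of "i - 1"] by simp
      qed
    qed
    ultimately show ?thesis by (simp add: Deck_def)
  qed
  define \<gamma> where "\<gamma> m z = A m (gB z)" for m z
  have \<gamma>D: "\<gamma> m \<in> Deck" for m unfolding \<gamma>_def by (rule Deck_comp[OF AD gB(1)])
  have clsA: "based_class N pa = cls (A 1)"
  proof -
    define p where "p u = \<i> * of_real (exp (v * u))" for u :: real
    have "path p" unfolding path_def p_def by (intro continuous_intros)
    moreover have "path_image p \<subseteq> UH" using iy_UH by (auto simp: p_def path_image_def)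
    ultimately have "cls (A 1) = based_class N (\<pi> \<circ> p)"
      by (intro cls_eq[OF AD]) (auto simp: p_def pathstart_def pathfinish_def A_def mirror_def)
    moreover have "\<pi> \<circ> p = pa" using pa(1) by (auto simp: p_def)
    ultimately show ?thesis by simp
  qed
  have clsB: "based_class N pb = cls gB"
  proof -
    define p where "p u = h (\<i> * of_real (exp (w * u)))" for u :: real
    have "continuous_on UH h" using hI Isop_subset continuous_on_Isom by blast
    then have "path p" unfolding path_def p_def by (rule continuous_on_compose2) (auto intro!: continuous_intros)
    moreover have "path_image p \<subseteq> UH" using Isop_UH[OF hI iy_UH] by (auto simp: p_def path_image_def)
    moreover have "gB \<i> = h (\<i> * of_real (exp w))" using rb[OF i_UH] hi by (simp add: mirror_def mult.commute)
    ultimately have "cls gB = based_class N (\<pi> \<circ> p)"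
      by (intro cls_eq[OF gB(1)]) (auto simp: p_def pathstart_def pathfinish_def hi)
    moreover have "\<pi> \<circ> p = pb" using pb(1) by (auto simp: p_def)
    ultimately show ?thesis by simp
  qed
  have "based_class N pa [^]\<^bsub>fundamental_group N (\<pi> \<i>)\<^esub> m \<otimes>\<^bsub>fundamental_group N (\<pi> \<i>)\<^esub> based_class N pb = cls (\<gamma> m)" for m
    unfolding clsA clsB \<gamma>_def cls_comp[OF AD gB(1), symmetric]
    by (subst cls_int_pow[of A m]) (auto simp: AD A0 Aadd)
  then have Mcls: "puncture_class S F (unbased N (cls (\<gamma> m)))" "m \<noteq> 0" if "m \<in> M" for m
    using that M by auto
  \<comment> \<open>This is everything that a puncture exponent contributes to the rest of the
    argument.\<close>
  have peri: "\<gamma> m \<in> Isop \<and> (\<exists>\<delta>. continuous_on UNIV \<delta> \<and> (\<forall>x::real. \<delta> x \<in> UH) \<and> (\<forall>x. \<delta> (x + 1) = \<gamma> m (\<delta> x)) \<and>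
      (\<forall>x y. \<forall>g\<in>Deck. y > 0 \<longrightarrow> \<delta> x \<noteq> g (\<i> * of_real y) \<and> \<delta> x \<noteq> g (h (\<i> * of_real y))))"
    if m: "m \<in> M" for m :: int
  proof -
    obtain \<delta> where \<delta>: "\<gamma> m \<in> Isop" "continuous_on UNIV \<delta>" "\<And>x::real. \<delta> x \<in> UH" "\<And>x. \<delta> (x + 1) = \<gamma> m (\<delta> x)"
      "\<And>x. \<pi> (\<delta> x) \<notin> K"
      by (rule puncture_deck[OF N \<gamma>D Mcls(1)[OF m] K(1,2)], rule that)
    have "\<delta> x \<noteq> g (\<i> * of_real y) \<and> \<delta> x \<noteq> g (h (\<i> * of_real y))" if g: "g \<in> Deck" and y: "y > 0" for g x y
    proof -
      have yU: "\<i> * of_real y \<in> UH" using y by (simp add: UH_iff)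
      have "exp (v * (ln y / v)) = y" "exp (w * (ln y / w)) = y" using y v w by simp_all
      then have "\<pi> (\<i> * of_real y) \<in> K" "\<pi> (h (\<i> * of_real y)) \<in> K"
        using pa(1)[of "ln y / v"] pb(1)[of "ln y / w"] K(3)[of "ln y / v"] K(4)[of "ln y / w"] by simp_all
      then have "\<pi> (g (\<i> * of_real y)) \<in> K" "\<pi> (g (h (\<i> * of_real y))) \<in> K"
        using DeckD(2)[OF g yU] DeckD(2)[OF g Isop_UH[OF hI yU]] by simp_all
      then show ?thesis using \<delta>(5)[of x] by auto
    qed
    then show ?thesis using \<delta> by blast
  qed
  have gB: "gB z = h (of_real (exp w) * (if rb then mirror (h' z) else h' z))" if "z \<in> UH" for z
    using rb[OF Isop_UH[OF h'I that]] hh'[OF that] by simp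
  \<comment> \<open>The product preserves orientation, so its two factors reverse it together or not
    at all.\<close>
  have types: "(ra \<and> odd m) = rb" if m: "m \<in> M" for m :: int
  proof (rule ccontr)
    assume ne: "(ra \<and> odd m) \<noteq> rb"
    have \<gamma>I: "\<gamma> m \<in> Isop" using peri[OF m] by blast
    have sI: "(\<lambda>z. of_real (exp (v * of_int m)) * z) \<in> Isop" "(\<lambda>z. of_real (exp w) * z) \<in> Isop"
      by (simp_all add: scale_Isop)
    have "(\<lambda>z. \<gamma> m (mirror z)) \<in> Isop"
    proof (cases rb)
      case True
      have "(\<lambda>z. of_real (exp (v * of_int m)) * h (of_real (exp w) * mirror (h' (mirror z)))) \<in> Isop"
        by (intro Isop_comp[OF sI(1)] Isop_comp[OF hI] Isop_comp[OF sI(2)] Isop_mirror h'I)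
      then show ?thesis
      proof (rule Isop_cong)
        fix z assume "z \<in> UH"
        then have "mirror z \<in> UH" by simp
        moreover have nr: "\<not> (ra \<and> odd m)" using ne True by blast
        ultimately show "\<gamma> m (mirror z) = of_real (exp (v * of_int m)) * h (of_real (exp w) * mirror (h' (mirror z)))"
          using gB[of "mirror z"] True unfolding \<gamma>_def A_def if_not_P[OF nr] by simp
      qed
    next
      case False
      have W: "(\<lambda>z. h (of_real (exp w) * h' z)) \<in> Isop"
        by (intro Isop_comp[OF hI] Isop_comp[OF sI(2)] h'I)
      have "(\<lambda>z. of_real (exp (v * of_int m)) * mirror (h (of_real (exp w) * h' (mirror z)))) \<in> Isop"
        by (rule Isop_comp[OF sI(1) Isop_mirror[OF W]])
      then show ?thesis
      proof (rule Isop_cong)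
        fix z assume "z \<in> UH"
        then have "mirror z \<in> UH" by simp
        then show "\<gamma> m (mirror z) = of_real (exp (v * of_int m)) * mirror (h (of_real (exp w) * h' (mirror z)))"
          using gB[of "mirror z"] ne False by (simp add: \<gamma>_def A_def)
      qed
    qed
    then show False using mirror_not_Isop[OF \<gamma>I] by blast
  qed
  \<comment> \<open>Stretching by \<open>exp w\<close> is the map of the diagonal matrix with
    entries \<open>E\<close> and \<open>1 / E\<close>, which has determinant 1.\<close>
  define E where "E = exp (w / 2)"
  have E: "E > 0" "exp w = E * E" "E \<noteq> 1" using w by (simp_all add: E_def flip: exp_add)
  \<comment> \<open>The stretch by \<open>A m\<close> is absorbed into the lower row of the matrix,
    so that the exponent enters only through the factor \<open>\<kappa> m\<close>.\<close>
  define \<kappa> where "\<kappa> m = exp (- v * of_int m)" for m :: int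
  have \<kappa>: "\<kappa> m > 0" "exp (v * of_int m) * \<kappa> m = 1" for m
    by (simp_all add: \<kappa>_def flip: exp_add)
  have \<kappa>mono: "\<kappa> n < \<kappa> m \<longleftrightarrow> m < n" for m n using v by (simp add: \<kappa>_def)
  have scale_mob: "of_real (exp (v * of_int m)) * mob a b c d z = mob a b (\<kappa> m * c) (\<kappa> m * d) z" for a b c d m z
  proof -
    have "(of_real (exp (v * of_int m)) :: complex) = 1 / of_real (\<kappa> m)"
      using \<kappa>(2)[of m] \<kappa>(1)[of m] by (metis less_irrefl nonzero_eq_divide_eq of_real_1 of_real_divide)
    moreover have "mob a b (\<kappa> m * c) (\<kappa> m * d) z = (of_real a * z + of_real b) / (of_real (\<kappa> m) * (of_real c * z + of_real d))"
      by (simp add: mob_def algebra_simps)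
    ultimately show ?thesis by (simp only: mob_def[of a b c d] times_divide_times_eq mult_1_left)
  qed
  have mob_E: "of_real (exp w) * mob a b c d z = mob (E * a) (E * b) (c / E) (d / E) z" for a b c d z
  proof -
    have "mob (E * a) (E * b) (c / E) (d / E) z = (of_real E * (of_real a * z + of_real b)) / ((of_real c * z + of_real d) / of_real E)"
      by (simp add: mob_def algebra_simps add_divide_distrib)
    then show ?thesis using E(1,2) by (simp add: mob_def)
  qed
  \<comment> \<open>Without reflections the product would be one of two translations along crossing
    axes, whose equivariant curve would have to meet the imaginary axis.\<close>
  have glide: "rb \<and> ra" if ne: "M \<noteq> {}"
  proof (rule ccontr)
    assume n: "\<not> (rb \<and> ra)"
    obtain m where m: "m \<in> M" using ne by blast
    then have rb: "\<not> rb" "\<not> (ra \<and> odd m)" using types[OF m] n by auto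
    \<comment> \<open>The entries of the symmetric matrix of \<open>gB\<close>, the diagonal matrix
      conjugated by the rotation; \<open>q\<close> is nonzero because \<open>E \<noteq> 1\<close>
      and the axes differ.\<close>
    define p q s where "p = c1\<^sup>2 * E + s1\<^sup>2 / E" and "q = c1 * s1 * (1 / E - E)" and "s = s1\<^sup>2 * E + c1\<^sup>2 / E"
    have \<gamma>: "\<gamma> m z = mob p q (\<kappa> m * q) (\<kappa> m * s) z" if z: "z \<in> UH" for z
    proof -
      have U: "mob (E * c1) (E * - s1) (s1 / E) (c1 / E) z \<in> UH"
        using UH_scale[OF _ Isop_UH[OF h'I z], of "exp w"] by (simp add: h'_def mob_E)
      have d: "E * c1 * (c1 / E) - E * - s1 * (s1 / E) \<noteq> 0"
      proof -
        have "E * c1 * (c1 / E) - E * - s1 * (s1 / E) = c1\<^sup>2 + s1\<^sup>2" using E(1) by (simp add: power2_eq_square)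
        then show ?thesis using c1(1) by simp
      qed
      have "gB z = mob c1 s1 (- s1) c1 (mob (E * c1) (E * - s1) (s1 / E) (c1 / E) z)"
        using gB[OF z] rb(1) h[OF U] by (simp add: h'_def mob_E)
      also have "\<dots> = mob p q q s z"
        unfolding mob_comp[OF d z] by (simp add: p_def q_def s_def power2_eq_square algebra_simps)
      finally show ?thesis using rb(2) by (auto simp: \<gamma>_def A_def scale_mob)
    qed
    obtain \<delta> where \<delta>: "continuous_on UNIV \<delta>" "\<And>x::real. \<delta> x \<in> UH" "\<And>x. \<delta> (x + 1) = \<gamma> m (\<delta> x)"
      "\<And>x y g. g \<in> Deck \<Longrightarrow> y > 0 \<Longrightarrow> \<delta> x \<noteq> g (\<i> * of_real y)"
      using peri[OF m] by blast
    show False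
    proof (rule crossing_translations_False[of q p s "\<kappa> m" \<delta>])
      have "1 / E - E \<noteq> 0"
      proof
        assume "1 / E - E = 0"
        then have "E * E = 1" using E(1) by (simp add: field_simps)
        then show False using E by (simp add: square_eq_1_iff)
      qed
      then show "q \<noteq> 0" using c1(2) by (simp add: q_def)
      have "p * s - q\<^sup>2 = (c1\<^sup>2 + s1\<^sup>2)\<^sup>2"
        unfolding p_def q_def s_def using E(1) by (simp add: field_simps power2_eq_square)
      then show "p * s = q\<^sup>2 + 1" using c1(1) by simp
      show "\<delta> (x + 1) = mob p q (\<kappa> m * q) (\<kappa> m * s) (\<delta> x)" for x using \<delta>(3) \<gamma>[OF \<delta>(2)] by simp
      show "\<delta> x \<noteq> \<i> * of_real y" if "y > 0" for x y using \<delta>(4)[OF AD that, of x 0] by (simp add: A0)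
    qed (use \<delta> \<kappa> in auto)
  qed
  have oddM: "odd m" if "m \<in> M" for m using types[OF that] glide that by auto
  \<comment> \<open>Up to sign these are the entries of \<open>gB\<close> followed by
    \<open>mirror\<close> when \<open>gB\<close> is a glide reflection. The off-diagonal entries now
    have opposite signs, and the determinant is \<open>q^2 - p * s = 1\<close>.\<close>
  define p q s where "p = s1\<^sup>2 / E - c1\<^sup>2 * E" and "q = c1 * s1 * (E + 1 / E)" and "s = c1\<^sup>2 / E - s1\<^sup>2 * E"
  have q0: "q \<noteq> 0"
  proof -
    have "E + 1 / E > 0" using E(1) by (simp add: add_pos_pos)
    then show ?thesis using c1(2) by (simp add: q_def)
  qed
  have ps: "p * s = q\<^sup>2 - 1"
  proof -
    have "p * s - q\<^sup>2 = - (c1\<^sup>2 + s1\<^sup>2)\<^sup>2"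
      unfolding p_def q_def s_def using E(1) by (simp add: field_simps power2_eq_square)
    then show ?thesis using c1(1) by simp
  qed
  have main: "n = m + 2" if mn: "m \<in> M" "n \<in> M" "m < n" for m n
  proof -
    have r: "ra" "rb" using glide mn by auto
    \<comment> \<open>For odd \<open>m\<close> the reflection in \<open>A m\<close> cancels that in
      \<open>gB\<close>, which leaves a fractional linear map.\<close>
    have \<gamma>: "\<gamma> m z = mob (- p) (- q) (\<kappa> m * q) (\<kappa> m * s) z" if z: "z \<in> UH" and m: "odd m" for z and m :: int
    proof -
      have mz: "mirror z \<in> UH" using z by simp
      have U: "mob (E * c1) (E * s1) (- s1 / E) (c1 / E) (mirror z) \<in> UH"
      proof -
        have eq: "mirror (h' z) = mob c1 s1 (- s1) c1 (mirror z)" by (simp add: h'_def mirror_mob)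
        have "of_real (exp w) * mirror (h' z) \<in> UH" by (rule UH_scale) (use Isop_UH[OF h'I z] in auto)
        then show ?thesis unfolding eq mob_E .
      qed
      have d: "E * c1 * (c1 / E) - E * - s1 * (s1 / E) \<noteq> 0"
      proof -
        have "E * c1 * (c1 / E) - E * - s1 * (s1 / E) = c1\<^sup>2 + s1\<^sup>2" using E(1) by (simp add: power2_eq_square)
        then show ?thesis using c1(1) by simp
      qed
      have "gB z = mob c1 s1 (- s1) c1 (mob (E * c1) (E * s1) (- s1 / E) (c1 / E) (mirror z))"
        using gB[OF z] r(2) h[OF U] by (simp add: h'_def mirror_mob mob_E)
      then have "mirror (gB z) = mob c1 (- s1) s1 c1 (mob (E * c1) (E * - s1) (s1 / E) (c1 / E) z)"
        by (simp add: mirror_mob)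
      also have "\<dots> = mob (- p) (- q) q s z"
        unfolding mob_comp[OF d z] by (simp add: p_def q_def s_def power2_eq_square algebra_simps)
      finally show ?thesis using r(1) m by (auto simp: \<gamma>_def A_def scale_mob)
    qed
    \<comment> \<open>A fixed point would make the deck transformation the identity on
      \<open>UH\<close>; comparing real parts at \<open>\<i>\<close> and at \<open>2 * \<i>\<close>
      would then force \<open>q = 0\<close>.\<close>
    have nofix: "\<gamma> m z \<noteq> z" if z: "z \<in> UH" and m: "odd m" for z and m :: int
    proof
      assume "\<gamma> m z = z"
      then have id: "\<gamma> m u = u" if "u \<in> UH" for u using Deck_fixed[OF \<gamma>D z _ that] by blast
      have dm: "(- p) * (\<kappa> m * s) - (- q) * (\<kappa> m * q) \<noteq> 0"
      proof -
        have "(- p) * (\<kappa> m * s) - (- q) * (\<kappa> m * q) = \<kappa> m * (q\<^sup>2 - p * s)" by (simp add: power2_eq_square algebra_simps)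
        then show ?thesis using ps \<kappa>(1)[of m] by simp
      qed
      have eq: "of_real (- p) * u + of_real (- q) = u * (of_real (\<kappa> m * q) * u + of_real (\<kappa> m * s))" if "u \<in> UH" for u
      proof -
        have "mob (- p) (- q) (\<kappa> m * q) (\<kappa> m * s) u = u" using id[OF that] \<gamma>[OF that m] by simp
        then show ?thesis using mob_denom[OF dm that] by (simp add: mob_def divide_eq_eq)
      qed
      have "2 * \<i> \<in> UH" by (simp add: UH_iff)
      then have "q = 4 * (\<kappa> m * q)" using eq[of "2 * \<i>"] by (simp add: complex_eq_iff)
      moreover have "q = \<kappa> m * q" using eq[OF i_UH] by (simp add: complex_eq_iff)
      ultimately show False using q0 by simp
    qed
    \<comment> \<open>The absence of fixed points in \<open>UH\<close> gives a real root, that is a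
      real \<open>y\<close> with \<open>(k * y + p) * (y + s) = - 1\<close>. In the borderline case
      the left side is \<open>k * (y + s)^2\<close>, or the equation reads
      \<open>k * y^2 = - q^2\<close>; both are impossible.\<close>
    have type: "\<kappa> m * \<bar>s\<bar> \<noteq> \<bar>p\<bar>" if m: "odd m" for m :: int
    proof
      assume eq: "\<kappa> m * \<bar>s\<bar> = \<bar>p\<bar>"
      have d: "(- p) * (\<kappa> m * s) - (- q) * (\<kappa> m * q) > 0"
      proof -
        have "(- p) * (\<kappa> m * s) - (- q) * (\<kappa> m * q) = \<kappa> m * (q\<^sup>2 - p * s)" by (simp add: power2_eq_square algebra_simps)
        then show ?thesis using ps \<kappa>(1)[of m] by simp
      qed
      have r: "\<kappa> m * q \<noteq> 0" using \<kappa>(1)[of m] q0 by simp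
      have "\<exists>x. (\<kappa> m * q) * x\<^sup>2 + (\<kappa> m * s - - p) * x - - q = 0"
      proof (rule no_fixed_point_limit[OF d r, where g = "\<gamma> m" and z = \<i>])
        show "mob (- p) (- q) (\<kappa> m * q) (\<kappa> m * s) z \<noteq> z" if "z \<in> UH" for z
          using nofix[OF that m] \<gamma>[OF that m] by simp
        show "\<gamma> m z = mob (- p) (- q) (\<kappa> m * q) (\<kappa> m * s) z" if "z \<in> UH" for z by (rule \<gamma>[OF that m])
        show "\<i> \<in> UH" by (rule i_UH)
        fix x assume "(\<kappa> m * q) * x\<^sup>2 + (\<kappa> m * s - - p) * x - - q = 0"
        then show "\<exists>x. (\<kappa> m * q) * x\<^sup>2 + (\<kappa> m * s - - p) * x - - q = 0" by blast
      qed
      then obtain x where x: "(\<kappa> m * q) * x\<^sup>2 + (\<kappa> m * s + p) * x + q = 0" by auto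
      define k y where "k = \<kappa> m" and "y = q * x"
      have k: "k > 0" by (simp add: k_def \<kappa>)
      have "(k * y + p) * (y + s) + 1 = q * ((k * q) * x\<^sup>2 + (k * s + p) * x + q) + (p * s - (q\<^sup>2 - 1))"
        by (simp add: y_def power2_eq_square algebra_simps)
      then have e: "(k * y + p) * (y + s) = - 1" using x ps by (simp add: k_def)
      have "\<bar>p\<bar> = \<bar>k * s\<bar>" using eq k by (simp add: k_def abs_mult)
      then consider "p = k * s" | "p = - (k * s)" by (auto simp: abs_eq_iff)
      then show False
      proof cases
        case 1
        then have "(k * y + p) * (y + s) = k * (y + s)\<^sup>2" by (simp add: power2_eq_square algebra_simps)
        moreover have "k * (y + s)\<^sup>2 \<ge> 0" using k by simp
        ultimately show False using e by linarith
      next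
        case 2
        then have "k * y\<^sup>2 = - q\<^sup>2"
          using e ps by (simp add: power2_eq_square algebra_simps)
        moreover have "k * y\<^sup>2 \<ge> 0" "q\<^sup>2 > 0" using k q0 by auto
        ultimately show False by linarith
      qed
    qed
    \<comment> \<open>\<open>gB\<close> advances the \<beta>-axis by \<open>w\<close>, so the point
      at \<open>exp (- w)\<close> comes to the crossing point \<open>\<i>\<close>, which
      \<open>A m\<close> then moves along the \<alpha>-axis.\<close>
    have link: "\<gamma> m (h (\<i> * of_real (exp (- w)))) = \<i> * of_real (exp (v * of_int m))" for m
    proof -
      have "gB (h (\<i> * of_real (exp (- w)))) = \<i>"
      proof -
        have "of_real (exp w) * (\<i> * of_real (exp (- w))) = \<i> * of_real (exp w * exp (- w))"
          by (simp only: of_real_mult mult_ac)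
        also have "exp w * exp (- w) = 1" by (simp add: exp_minus)
        finally have "of_real (exp w) * (\<i> * of_real (exp (- w))) = \<i>" by simp
        moreover have "gB (h (\<i> * of_real (exp (- w)))) = h (of_real (exp w) * (\<i> * of_real (exp (- w))))"
          using rb[OF iy_UH, of "- w"] by (simp only: mirror_axis if_cancel)
        ultimately show ?thesis using hi by (simp only:)
      qed
      then show ?thesis by (simp add: \<gamma>_def A_def mirror_def mult.commute)
    qed
    \<comment> \<open>Only \<open>l\<close> has to be a puncture exponent, as it supplies the curve;
      the chain is made of powers of \<open>\<gamma> m'\<close> for any odd
      \<open>m'\<close>.\<close>
    have S: False if m': "odd m'" "m' < l" "l \<in> M" "\<kappa> m' * \<bar>s\<bar> < \<bar>p\<bar>" for m' l :: int
    proof -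
      obtain \<delta> where \<delta>: "continuous_on UNIV \<delta>" "\<And>x::real. \<delta> x \<in> UH" "\<And>x. \<delta> (x + 1) = \<gamma> l (\<delta> x)"
        "\<And>x y g. g \<in> Deck \<Longrightarrow> y > 0 \<Longrightarrow> \<delta> x \<noteq> g (\<i> * of_real y) \<and> \<delta> x \<noteq> g (h (\<i> * of_real y))"
        using peri[OF m'(3)] by blast
      show False
      proof (rule nested_peripheral_False[OF ps q0 \<kappa>(1)[of l] _ m'(4), of "\<gamma> m'" h "exp (- w)" "exp (v * of_int m')" \<delta>])
        show "\<kappa> l < \<kappa> m'" using m'(2) \<kappa>mono by simp
        show "\<gamma> m' z = mob (- p) (- q) (\<kappa> m' * q) (\<kappa> m' * s) z" if "z \<in> UH" for z by (rule \<gamma>[OF that m'(1)])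
        show "\<gamma> m' z \<noteq> z" if "z \<in> UH" for z by (rule nofix[OF that m'(1)])
        show "\<delta> (x + 1) = mob (- p) (- q) (\<kappa> l * q) (\<kappa> l * s) (\<delta> x)" for x
          using \<delta>(3) \<gamma>[OF \<delta>(2) oddM[OF m'(3)]] by simp
        show "\<delta> x \<noteq> (\<gamma> m' ^^ n) (\<i> * of_real y)" if "y > 0" for n x y
          using \<delta>(4)[OF Deck_funpow[OF \<gamma>D] that] by blast
        show "\<delta> x \<noteq> (\<gamma> m' ^^ n) (h (\<i> * of_real y))" if "y > 0" for n x y
          using \<delta>(4)[OF Deck_funpow[OF \<gamma>D] that] by blast
      qed (use hI hi link \<delta> in auto)
    qed
    \<comment> \<open>Conjugation by \<open>J\<close> exchanges \<open>p\<close> with \<open>s\<close> and \<open>\<kappa>\<close> with \<open>1 / \<kappa>\<close>, hence the two types.\<close>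
    define J where "J z = inverse (cnj z)" for z
    have JU: "J z \<in> UH" if "z \<in> UH" for z
    proof -
      have "Im (J z) = Im z / ((Re z)\<^sup>2 + (Im z)\<^sup>2)" by (simp add: J_def)
      moreover have "Im z > 0" using that by (simp add: UH_iff)
      ultimately show ?thesis unfolding UH_iff by (simp add: sum_power2_gt_zero_iff)
    qed
    have JJ: "J (J z) = z" for z by (simp add: J_def)
    have Jmob: "J (mob a b c d (J z)) = mob d c b a z" if "z \<in> UH" for a b c d z
    proof -
      have z: "z \<noteq> 0" using that by (auto simp: UH_iff)
      have "J (mob a b c d (J z)) = (of_real c * inverse z + of_real d) / (of_real a * inverse z + of_real b)"
        by (simp add: J_def mob_def)
      also have "\<dots> = mob d c b a z"
      proof -
        have "of_real c * inverse z + of_real d = (of_real d * z + of_real c) * inverse z"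
          "of_real a * inverse z + of_real b = (of_real b * z + of_real a) * inverse z"
          using z by (simp_all add: algebra_simps)
        then show ?thesis using z by (simp add: mob_def)
      qed
      finally show ?thesis .
    qed
    have Jaxis: "J (\<i> * of_real y) = \<i> * of_real (1 / y)" for y
      unfolding J_def by (simp add: divide_inverse inverse_mult_distrib)
    have Jc: "continuous_on UH J" unfolding J_def by (intro continuous_intros) (auto simp: UH_iff)
    \<comment> \<open>The conjugated situation of \<open>S\<close>: as \<kappa> is replaced by its
      reciprocal, \<open>l\<close> is now the smaller exponent.\<close>
    have L: False if m': "odd m'" "l < m'" "l \<in> M" "\<bar>p\<bar> < \<kappa> m' * \<bar>s\<bar>" for m' l :: int
    proof -
      obtain \<delta> where \<delta>: "continuous_on UNIV \<delta>" "\<And>x::real. \<delta> x \<in> UH" "\<And>x. \<delta> (x + 1) = \<gamma> l (\<delta> x)"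
        "\<And>x y g. g \<in> Deck \<Longrightarrow> y > 0 \<Longrightarrow> \<delta> x \<noteq> g (\<i> * of_real y) \<and> \<delta> x \<noteq> g (h (\<i> * of_real y))"
        using peri[OF m'(3)] by blast
      define g' h2 where "g' z = J (\<gamma> m' (J z))" and "h2 z = J (h (J z))" for z
      have conj: "J (\<gamma> m (J z)) = mob (- s) (- q) (1 / \<kappa> m * q) (1 / \<kappa> m * p) z" if z: "z \<in> UH" and m: "odd m" for z and m :: int
      proof -
        have k0: "\<kappa> m \<noteq> 0" using \<kappa>(1)[of m] by simp
        have "J (\<gamma> m (J z)) = mob (\<kappa> m * s) (\<kappa> m * q) (- q) (- p) z"
          unfolding \<gamma>[OF JU[OF z] m] by (rule Jmob[OF z])
        also have "\<dots> = mob ((- \<kappa> m) * (- s)) ((- \<kappa> m) * (- q)) ((- \<kappa> m) * (1 / \<kappa> m * q)) ((- \<kappa> m) * (1 / \<kappa> m * p)) z"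
          using k0 by simp
        also have "\<dots> = mob (- s) (- q) (1 / \<kappa> m * q) (1 / \<kappa> m * p) z"
          by (rule mob_cancel) (use k0 in simp)
        finally show ?thesis .
      qed
      have pow: "(g' ^^ n) z = J ((\<gamma> m' ^^ n) (J z))" for n z
        by (induction n) (simp_all add: g'_def JJ)
      show False
      proof (rule nested_peripheral_False[of s p q "1 / \<kappa> l" "1 / \<kappa> m'" g' h2 "exp w" "exp (- (v * of_int m'))" "\<lambda>x. J (\<delta> x)"])
        show "s * p = q\<^sup>2 - 1" using ps by (simp add: mult.commute)
        show "0 < 1 / \<kappa> l" using \<kappa> by simp
        show "1 / \<kappa> l < 1 / \<kappa> m'" using m'(2) \<kappa>mono[of m' l] \<kappa>(1)[of l] \<kappa>(1)[of m'] by (simp add: frac_less2)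
        show "1 / \<kappa> m' * \<bar>p\<bar> < \<bar>s\<bar>" using m'(4) \<kappa>(1)[of m'] by (simp add: divide_less_eq mult.commute)
        show "g' z = mob (- s) (- q) (1 / \<kappa> m' * q) (1 / \<kappa> m' * p) z" if "z \<in> UH" for z
          unfolding g'_def by (rule conj[OF that m'(1)])
        show "g' z \<noteq> z" if "z \<in> UH" for z
          unfolding g'_def using nofix[OF JU[OF that] m'(1)] JJ by metis
        have "h2 z = mob c1 (- s1) s1 c1 z" if "z \<in> UH" for z
          unfolding h2_def h[OF JU[OF that]] by (rule Jmob[OF that])
        then show "h2 \<in> Isop" by (intro Isop_cong[OF h'I]) (simp add: h'_def)
        show "h2 \<i> = \<i>" using Jaxis[of 1] hi by (simp add: h2_def)
        show "g' (h2 (\<i> * of_real (exp w))) = \<i> * of_real (exp (- (v * of_int m')))"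
        proof -
          have "J (\<i> * of_real (exp w)) = \<i> * of_real (exp (- w))" unfolding Jaxis by (simp add: exp_minus inverse_eq_divide)
          then have "g' (h2 (\<i> * of_real (exp w))) = J (\<i> * of_real (exp (v * of_int m')))"
            by (simp only: g'_def h2_def JJ link)
          then show ?thesis unfolding Jaxis by (simp add: exp_minus inverse_eq_divide)
        qed
        show "continuous_on UNIV (\<lambda>x. J (\<delta> x))" by (rule continuous_on_compose2[OF Jc \<delta>(1)]) (use \<delta>(2) in auto)
        show "J (\<delta> x) \<in> UH" for x by (rule JU[OF \<delta>(2)])
        show "J (\<delta> (x + 1)) = mob (- s) (- q) (1 / \<kappa> l * q) (1 / \<kappa> l * p) (J (\<delta> x))" for x
          using conj[OF JU[OF \<delta>(2)] oddM[OF m'(3)], of x] \<delta>(3)[of x] by (simp add: JJ)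
        show "J (\<delta> x) \<noteq> (g' ^^ n) (\<i> * of_real y)" if y: "y > 0" for n x y
        proof
          assume "J (\<delta> x) = (g' ^^ n) (\<i> * of_real y)"
          then have "\<delta> x = (\<gamma> m' ^^ n) (\<i> * of_real (1 / y))" unfolding pow Jaxis by (metis JJ)
          then show False using \<delta>(4)[OF Deck_funpow[OF \<gamma>D], of "1 / y" x n m'] y by simp
        qed
        show "J (\<delta> x) \<noteq> (g' ^^ n) (h2 (\<i> * of_real y))" if y: "y > 0" for n x y
        proof
          assume "J (\<delta> x) = (g' ^^ n) (h2 (\<i> * of_real y))"
          then have "\<delta> x = (\<gamma> m' ^^ n) (h (\<i> * of_real (1 / y)))" unfolding pow h2_def Jaxis JJ by (metis JJ)
          then show False using \<delta>(4)[OF Deck_funpow[OF \<gamma>D], of "1 / y" x n m'] y by simp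
        qed
      qed (use q0 in auto)
    qed
    have odd: "odd m" "odd n" using oddM mn by auto
    have nS: "\<kappa> n * \<bar>s\<bar> < \<bar>p\<bar>" using L[OF odd(2) mn(3,1)] type[OF odd(2)] by (meson linorder_neqE)
    have mL: "\<bar>p\<bar> < \<kappa> m * \<bar>s\<bar>" using S[OF odd(1) mn(3,2)] type[OF odd(1)] by (meson linorder_neqE)
    show "n = m + 2"
    proof (rule ccontr)
      assume ne: "n \<noteq> m + 2"
      have "n \<noteq> m + 1" using odd by auto
      then have lt: "m < m + 2" "m + 2 < n" using ne mn(3) by auto
      \<comment> \<open>\<open>m + 2\<close> would lie strictly between two puncture exponents.
        Either type contradicts one of them, whether or not \<open>m + 2\<close> is a puncture
        exponent itself.\<close>
      have o: "odd (m + 2)" using odd by simp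
      show False
        using L[OF o lt(1) mn(1)] S[OF o lt(2) mn(2)] type[OF o] by (meson linorder_neqE)
    qed
  qed
  show ?thesis using oddM main by blast
qed

end

section \<open>Lifting the closed geodesics\<close>

text \<open>Put the start of the curve on the imaginary axis. Distances to two points of the axis
  decide the position of a third (\<open>geodesic_point_unique\<close>), so agreement with the axis
  spreads over every interval on which the curve is isometric, and over the whole line by
  connectedness.\<close>

lemma local_geodesic:
  fixes c :: "real \<Rightarrow> complex"
  assumes v: "v > 0" and c: "\<And>u. c u \<in> UH"
    and loc: "\<And>u. \<exists>\<epsilon>>0. \<forall>x y. \<bar>x - u\<bar> < \<epsilon> \<longrightarrow> \<bar>y - u\<bar> < \<epsilon> \<longrightarrow> hyp_dist (c x) (c y) = v * \<bar>x - y\<bar>"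
  obtains h where "h \<in> Isop" "\<And>u. c u = h (\<i> * of_real (exp (v * u)))"
proof -
  obtain \<epsilon> where \<epsilon>: "\<epsilon> > 0" "\<And>x y. \<bar>x - 0\<bar> < \<epsilon> \<Longrightarrow> \<bar>y - 0\<bar> < \<epsilon> \<Longrightarrow> hyp_dist (c x) (c y) = v * \<bar>x - y\<bar>"
    using loc[of 0] by blast
  define l where "l = \<epsilon> / 2"
  have l: "l > 0" "l < \<epsilon>" using \<epsilon>(1) by (auto simp: l_def)
  obtain g where g: "g \<in> Isop" "g (c 0) = \<i>" "g (c l) = \<i> * of_real (exp (hyp_dist (c 0) (c l)))"
    using Isop_to_axis[OF c c] by metis
  have "hyp_dist (c 0) (c l) = v * l" using \<epsilon>(2)[of 0 l] \<epsilon>(1) l by simp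
  define d where "d u = g (c u)" for u
  have dU: "d u \<in> UH" for u unfolding d_def by (rule Isop_UH[OF g(1) c])
  have dist_d: "hyp_dist (d x) (d y) = hyp_dist (c x) (c y)" for x y
    unfolding d_def by (rule hyp_dist_Isom[OF subsetD[OF Isop_subset g(1)] c c])
  define ok where "ok u \<longleftrightarrow> d u = \<i> * of_real (exp (v * u))" for u
  have ok0: "ok 0" "ok l" using g \<open>hyp_dist (c 0) (c l) = v * l\<close> by (auto simp: ok_def d_def)
  have extend: "ok u" if "ok x" "ok y" "x \<noteq> y" "hyp_dist (c x) (c u) = v * \<bar>x - u\<bar>" "hyp_dist (c y) (c u) = v * \<bar>y - u\<bar>" for x y u
  proof -
    have ax: "hq (d z) (d u) = hq (d z) (\<i> * of_real (exp (v * u)))"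
      if z: "ok z" "hyp_dist (c z) (c u) = v * \<bar>z - u\<bar>" for z
    proof -
      have "hyp_dist (d z) (\<i> * of_real (exp (v * u))) = \<bar>v * z - v * u\<bar>"
        using z(1) hyp_dist_axis by (simp add: ok_def)
      also have "\<dots> = v * \<bar>z - u\<bar>" using v by (simp add: abs_mult flip: right_diff_distrib)
      finally show ?thesis using z(2) dist_d[of z u] hyp_dist_eq_iff[of "d z" "d u" "d z" "\<i> * of_real (exp (v * u))"] dU by simp
    qed
    show ?thesis unfolding ok_def
    proof (rule geodesic_point_unique[OF dU, of "v * x" "v * y"])
      show "v * x \<noteq> v * y" using that(3) v by simp
    qed (use ax that ok_def in metis)+
  qed
  define B where "B = {u. \<exists>r>0. \<forall>x. \<bar>x - u\<bar> < r \<longrightarrow> ok x}"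
  \<comment> \<open>Two distinct good parameters inside an interval of isometry make the whole
    interval good; an open piece of good parameters supplies the second one.\<close>
  have dich: "(\<forall>x. \<bar>x - u\<bar> < r \<longrightarrow> x \<notin> B) \<or> (\<forall>x. \<bar>x - u\<bar> < r \<longrightarrow> x \<in> B)"
    if r: "r > 0" "\<forall>x y. \<bar>x - u\<bar> < r \<longrightarrow> \<bar>y - u\<bar> < r \<longrightarrow> hyp_dist (c x) (c y) = v * \<bar>x - y\<bar>" for u r
  proof (cases "\<forall>x. \<bar>x - u\<bar> < r \<longrightarrow> x \<notin> B")
    case False
    then obtain x s where x: "\<bar>x - u\<bar> < r" "s > 0" "\<forall>y. \<bar>y - x\<bar> < s \<longrightarrow> ok y" by (auto simp: B_def)
    obtain dl where "0 < dl" "dl < s" "dl < r - \<bar>x - u\<bar>"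
      using field_lbound_gt_zero[of s "r - \<bar>x - u\<bar>"] x(1,2) by auto
    moreover define y where "y = x + dl"
    ultimately have "0 < y - x" "y - x < s" "y - x < r - \<bar>x - u\<bar>" by simp_all
    then have y: "y \<noteq> x" "\<bar>y - x\<bar> < s" "\<bar>y - u\<bar> < r" by linarith+
    have all: "ok z" if "\<bar>z - u\<bar> < r" for z
      by (rule extend[of x y]) (use x y r that in auto)
    have "z \<in> B" if "\<bar>z - u\<bar> < r" for z
      unfolding B_def using that all by (intro CollectI exI[of _ "r - \<bar>z - u\<bar>"]) auto
    then show ?thesis by blast
  qed simp
  have cover: "\<exists>e>0. ball u e \<subseteq> B \<or> ball u e \<subseteq> - B" for u
  proof -
    obtain r where r: "r > 0" "\<forall>x y. \<bar>x - u\<bar> < r \<longrightarrow> \<bar>y - u\<bar> < r \<longrightarrow> hyp_dist (c x) (c y) = v * \<bar>x - y\<bar>"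
      using loc[of u] by blast
    show ?thesis using dich[OF r] r(1) by (intro exI[of _ r]) (auto simp: dist_real_def abs_minus_commute)
  qed
  have "open B" unfolding open_contains_ball
  proof
    fix u assume u: "u \<in> B"
    obtain e where "e > 0" "ball u e \<subseteq> B \<or> ball u e \<subseteq> - B" using cover by blast
    then show "\<exists>e>0. ball u e \<subseteq> B" using u centre_in_ball[of u e] by blast
  qed
  moreover have "open (- B)" unfolding open_contains_ball
  proof
    fix u assume u: "u \<in> - B"
    obtain e where "e > 0" "ball u e \<subseteq> B \<or> ball u e \<subseteq> - B" using cover by blast
    then show "\<exists>e>0. ball u e \<subseteq> - B" using u centre_in_ball[of u e] by blast
  qed
  moreover have "0 \<in> B"
    unfolding B_def
  proof (intro CollectI exI[of _ \<epsilon>] conjI allI impI)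
    fix x assume x: "\<bar>x - 0\<bar> < \<epsilon>"
    show "ok x"
    proof (rule extend[of 0 l])
      show "hyp_dist (c 0) (c x) = v * \<bar>0 - x\<bar>" "hyp_dist (c l) (c x) = v * \<bar>l - x\<bar>"
        using \<epsilon>(2)[of 0 x] \<epsilon>(2)[of l x] x l \<epsilon>(1) by simp_all
    qed (use ok0 l in simp_all)
  qed (rule \<epsilon>(1))
  ultimately have "B = UNIV"
    using connectedD[OF connected_UNIV, of B "- B"] by auto
  then have ok: "ok u" for u
  proof -
    have "u \<in> B" using \<open>B = UNIV\<close> by simp
    then obtain r where "r > 0" "\<forall>x. \<bar>x - u\<bar> < r \<longrightarrow> ok x" by (auto simp: B_def)
    then show ?thesis by simp
  qed
  obtain gi where gi: "gi \<in> Isop" "\<And>z. z \<in> UH \<Longrightarrow> gi (g z) = z" "\<And>z. z \<in> UH \<Longrightarrow> g (gi z) = z"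
    by (rule Isop_inv[OF g(1)], rule that)
  have "c u = gi (\<i> * of_real (exp (v * u)))" for u
    using ok[of u] gi(2)[OF c, of u] by (simp add: ok_def d_def)
  then show ?thesis using that gi(1) by blast
qed

text \<open>Carries completeness and the hyperbolic charts over to the isometric image in the space
  of bounded functions.\<close>

lemma surface_embedding:
  fixes X :: "'a::t2_space metric"
  assumes X: "complete_hyperbolic_metric_on N X" and N: "connected N"
  obtains j :: "'a \<Rightarrow> 'a discrete \<Rightarrow>\<^sub>C real"
  where "homeomorphism N (j ` N) j (inv_into N j)"
    "\<And>x y. x \<in> N \<Longrightarrow> y \<in> N \<Longrightarrow> dist (j x) (j y) = mdist X x y" "hyperbolic_surface (j ` N)"
proof -
  have m: "mspace X = N" "mtopology_of X = top_of_set N" "mcomplete_of X"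
    and ch: "\<And>p. p \<in> N \<Longrightarrow> \<exists>r \<phi>. hyperbolic_chart X p r \<phi>"
    using X by (auto simp: complete_hyperbolic_metric_on_def hyperbolic_metric_on_def)
  obtain j :: "'a \<Rightarrow> 'a discrete \<Rightarrow>\<^sub>C real" where j0: "\<And>x y. x \<in> mspace X \<Longrightarrow> y \<in> mspace X \<Longrightarrow> dist (j x) (j y) = mdist X x y"
    by (rule metric_embedding[of X], rule that)
  have j: "dist (j x) (j y) = mdist X x y" if "x \<in> N" "y \<in> N" for x y using j0 m(1) that by simp
  have hom: "homeomorphism N (j ` N) j (inv_into N j)" by (rule metric_embedding_homeomorphism[OF m(1,2) j])
  have k: "inv_into N j (j x) = x" if "x \<in> N" for x using hom that by (auto simp: homeomorphism_def)
  have "complete (j ` N)"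
    unfolding complete_def
  proof (intro allI impI, elim conjE)
    fix f assume f: "\<forall>n. f n \<in> j ` N" "Cauchy f"
    define x where "x n = inv_into N j (f n)" for n :: nat
    have x: "x n \<in> N" "j (x n) = f n" for n
      using f(1) unfolding x_def by (auto intro: inv_into_into f_inv_into_f)
    interpret Metric_space N "mdist X" using m(1) Metric_space_mspace_mdist[of X] by simp
    have "MCauchy x"
      unfolding MCauchy_def
    proof (intro conjI allI impI)
      fix e :: real assume "e > 0"
      then obtain M where "\<forall>m\<ge>M. \<forall>n\<ge>M. dist (f m) (f n) < e" using metric_CauchyD[OF f(2)] by blast
      then show "\<exists>M. \<forall>n n'. M \<le> n \<longrightarrow> M \<le> n' \<longrightarrow> mdist X (x n) (x n') < e"
        using j[OF x(1) x(1)] x(2) by (intro exI[of _ M]) simp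
    qed (use x in auto)
    moreover have "mcomplete" using m(1,3) by (simp add: mcomplete_of_def)
    ultimately obtain y where "limitin mtopology x y sequentially" unfolding mcomplete_def by blast
    then have y: "y \<in> N" "\<And>e. e > 0 \<Longrightarrow> eventually (\<lambda>n. x n \<in> N \<and> mdist X (x n) y < e) sequentially"
      unfolding limitin_metric by auto
    have "f \<longlonglongrightarrow> j y"
    proof (rule tendstoI)
      fix e :: real assume e: "e > 0"
      show "eventually (\<lambda>n. dist (f n) (j y) < e) sequentially"
        using y(2)[OF e] by eventually_elim (use j[OF x(1) y(1)] x(2) in auto)
    qed
    then show "\<exists>l\<in>j ` N. f \<longlonglongrightarrow> l" using y(1) by blast
  qed
  moreover have "connected (j ` N)"
    using hom N connected_continuous_image by (auto simp: homeomorphism_def)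
  moreover have "\<exists>r>0. \<exists>\<phi>. \<phi> ` (j ` N \<inter> ball p r) = {w\<in>UH. hyp_dist (\<phi> p) w < r} \<and>
        (\<forall>x\<in>j ` N \<inter> ball p r. \<forall>y\<in>j ` N \<inter> ball p r. hyp_dist (\<phi> x) (\<phi> y) = dist x y)"
    if p: "p \<in> j ` N" for p
  proof -
    obtain p0 where p0: "p0 \<in> N" "p = j p0" using p by blast
    obtain r \<phi> where r: "hyperbolic_chart X p0 r \<phi>" using ch[OF p0(1)] by blast
    have b: "j ` N \<inter> ball p r = j ` {x\<in>N. mdist X p0 x < r}"
      using p0 j by auto
    show ?thesis
    proof (intro exI[of _ r] exI[of _ "\<lambda>x. \<phi> (inv_into N j x)"] conjI)
      show "r > 0" using r by (simp add: hyperbolic_chart_def)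
      have "(\<lambda>x. \<phi> (inv_into N j x)) ` (j ` N \<inter> ball p r) = \<phi> ` {x\<in>N. mdist X p0 x < r}"
        unfolding b image_image using k by (intro image_cong) auto
      also have "\<dots> = {w\<in>UH. hyp_dist (\<phi> p0) w < r}"
        using r m(1) by (simp add: hyperbolic_chart_def UH_iff)
      finally show "(\<lambda>x. \<phi> (inv_into N j x)) ` (j ` N \<inter> ball p r) = {w\<in>UH. hyp_dist (\<phi> (inv_into N j p)) w < r}"
        using k p0 by simp
      show "\<forall>x\<in>j ` N \<inter> ball p r. \<forall>y\<in>j ` N \<inter> ball p r. hyp_dist (\<phi> (inv_into N j x)) (\<phi> (inv_into N j y)) = dist x y"
        unfolding b using r m(1) k j by (auto simp: hyperbolic_chart_def)
    qed
  qed
  ultimately have "hyperbolic_surface (j ` N)" by unfold_locales blast+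
  then show ?thesis using that hom j by blast
qed

text \<open>An inverse chart at \<open>p\<close>, recentred at \<open>\<i>\<close> by an isometry,
  is extended to \<open>UH\<close>.\<close>

lemma (in hyperbolic_surface) locisom_through:
  assumes "p \<in> N"
  obtains F where "locisom F UH" "F \<i> = p"
proof -
  obtain c e r \<psi> \<phi> where e: "e > 0" "r > 0" "ball c e \<subseteq> UH" "\<psi> c = p"
    "\<And>u. u \<in> ball c e \<Longrightarrow> \<psi> u \<in> N \<and> \<phi> (\<psi> u) = u"
    "\<And>u v. u \<in> ball c e \<Longrightarrow> v \<in> ball c e \<Longrightarrow> dist (\<psi> u) (\<psi> v) = hyp_dist u v"
    "\<And>x. x \<in> N \<Longrightarrow> dist p x < r \<Longrightarrow> \<phi> x \<in> ball c e \<and> \<psi> (\<phi> x) = x"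
    "openin (top_of_set N) (\<psi> ` ball c e)"
    by (rule chart_inverse[OF assms], rule that)
  have li: "locisom \<psi> (ball c e)" by (rule isometric_locisom) (use e in auto)
  have cU: "c \<in> UH" using e by auto
  obtain g where g: "g \<in> Isop" "g c = \<i>" using Isop_to_axis[OF cU cU] by metis
  obtain gi where gi: "gi \<in> Isop" "\<And>z. z \<in> UH \<Longrightarrow> gi (g z) = z" "\<And>z. z \<in> UH \<Longrightarrow> g (gi z) = z"
    by (rule Isop_inv[OF g(1)], rule that)
  have gii: "gi \<i> = c" using gi(2)[OF cU] g(2) by simp
  have "\<i> \<in> {z\<in>UH. gi z \<in> ball c e}" using gii e by (simp add: UH_iff)
  from extension_from_i[OF locisom_comp[OF li subsetD[OF Isop_subset gi(1)]] this]
  obtain F d where F: "locisom F UH" "d > 0" "\<And>z. z \<in> ball \<i> d \<Longrightarrow> F z = \<psi> (gi z)" by metis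
  have "F \<i> = p" using F(2,3) gii e(4) by simp
  then show ?thesis using that F(1) by blast
qed

lemma (in hyperbolic_surface) covering_from_locisom:
  fixes N0 :: "'a::t2_space set" and j :: "'a \<Rightarrow> 'b" and k
  assumes hom: "homeomorphism N0 N j k" and F: "locisom F UH"
  shows "covering_space UH (\<lambda>z. j (k (F z))) N" "\<And>z. z \<in> UH \<Longrightarrow> k (F z) \<in> N0"
    "\<And>z. z \<in> UH \<Longrightarrow> j (k (F z)) = F z"
    "\<And>z z'. z \<in> UH \<Longrightarrow> z' \<in> UH \<Longrightarrow> k (F z) = k (F z') \<Longrightarrow> \<exists>g\<in>Isom. g z = z' \<and> (\<forall>u\<in>UH. k (F (g u)) = k (F u))"
    "\<And>g z w. g \<in> Isom \<Longrightarrow> \<forall>u\<in>UH. k (F (g u)) = k (F u) \<Longrightarrow> z \<in> UH \<Longrightarrow> g z = z \<Longrightarrow> w \<in> UH \<Longrightarrow> g w = w"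
proof -
  have FN: "F z \<in> N" if "z \<in> UH" for z using locisom_in[OF F that] .
  show kN: "k (F z) \<in> N0" if "z \<in> UH" for z using FN[OF that] hom by (auto simp: homeomorphism_def)
  show jk: "j (k (F z)) = F z" if "z \<in> UH" for z using FN[OF that] hom by (auto simp: homeomorphism_def)
  show "covering_space UH (\<lambda>z. j (k (F z))) N" by (rule locisom_covering[OF locisom_eq[OF F]]) (rule jk)
  show "\<exists>g\<in>Isom. g z = z' \<and> (\<forall>u\<in>UH. k (F (g u)) = k (F u))" if z: "z \<in> UH" "z' \<in> UH" "k (F z) = k (F z')" for z z'
  proof -
    have "F z = F z'" using z jk by metis
    then obtain g where "g \<in> Isom" "g z = z'" "\<And>u. u \<in> UH \<Longrightarrow> F (g u) = F u"
      using deck_transformation[OF F z(1,2)] by metis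
    then show ?thesis by auto
  qed
  show "g w = w" if g: "g \<in> Isom" "\<forall>u\<in>UH. k (F (g u)) = k (F u)" "z \<in> UH" "g z = z" "w \<in> UH" for g z w
  proof (rule deck_fixed_point[OF F g(1) _ g(3,4,5)])
    fix u assume "u \<in> UH"
    then show "F (g u) = F u" using g(2) jk Isom_UH[OF g(1)] by metis
  qed
qed

lemma closed_geodesic_continuous:
  fixes j :: "'a::t2_space \<Rightarrow> 'b::metric_space"
  assumes hom: "homeomorphism N (j ` N) j k" and j: "\<And>x y. x \<in> N \<Longrightarrow> y \<in> N \<Longrightarrow> dist (j x) (j y) = mdist X x y"
    and a: "\<And>u. a u \<in> N" and v: "v > 0"
    and loc: "\<forall>t. \<exists>\<epsilon>>0. \<forall>s \<in> {t-\<epsilon><..<t+\<epsilon>}. \<forall>s' \<in> {t-\<epsilon><..<t+\<epsilon>}. mdist X (a s) (a s') = v * \<bar>s - s'\<bar>"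
  shows "continuous_on UNIV a"
proof -
  have ja: "continuous_on UNIV (\<lambda>t. j (a t))"
    unfolding continuous_on_iff
  proof (intro ballI allI impI)
    fix t e :: real assume e: "e > 0"
    obtain \<epsilon> where \<epsilon>: "\<epsilon> > 0" "\<forall>s \<in> {t-\<epsilon><..<t+\<epsilon>}. \<forall>s' \<in> {t-\<epsilon><..<t+\<epsilon>}. mdist X (a s) (a s') = v * \<bar>s - s'\<bar>"
      using loc by blast
    show "\<exists>d>0. \<forall>x'\<in>UNIV. dist x' t < d \<longrightarrow> dist (j (a x')) (j (a t)) < e"
    proof (intro exI[of _ "min \<epsilon> (e / v)"] conjI ballI impI)
      show "min \<epsilon> (e / v) > 0" using \<epsilon> e v by simp
      fix x assume x: "dist x t < min \<epsilon> (e / v)"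
      then have "dist (j (a x)) (j (a t)) = v * \<bar>x - t\<bar>"
        using j[OF a a] \<epsilon> by (simp add: dist_real_def abs_less_iff)
      also have "\<dots> < v * (e / v)" using x v by (intro mult_strict_left_mono) (auto simp: dist_real_def)
      finally show "dist (j (a x)) (j (a t)) < e" using v by simp
    qed
  qed
  have "continuous_on (j ` N) k" using hom by (simp add: homeomorphism_def)
  then have "continuous_on UNIV (\<lambda>t. k (j (a t)))"
    by (rule continuous_on_compose2[OF _ ja]) (use a in auto)
  moreover have "k (j (a t)) = a t" for t using hom a by (simp add: homeomorphism_def)
  ultimately show ?thesis by simp
qed

text \<open>The lift that starts at \<open>\<i>\<close> is locally isometric up to speed, so
  \<open>local_geodesic\<close> makes it the image of the imaginary axis under an isometry, which
  fixes \<open>\<i>\<close> because of the start.\<close>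

lemma geodesic_lift:
  fixes j :: "'a::t2_space \<Rightarrow> 'e::real_normed_vector"
  assumes cov: "hyperbolic_covering N j k (\<lambda>z. k (F z))" and sur: "hyperbolic_surface (j ` N)"
    and F: "hyperbolic_surface.locisom (j ` N) F UH"
    and j: "\<And>x y. x \<in> N \<Longrightarrow> y \<in> N \<Longrightarrow> dist (j x) (j y) = mdist X x y"
    and a: "\<And>u. a u \<in> N" and v: "v > 0" and start: "k (F \<i>) = a s"
    and loc: "\<forall>t. \<exists>\<epsilon>>0. \<forall>s \<in> {t-\<epsilon><..<t+\<epsilon>}. \<forall>s' \<in> {t-\<epsilon><..<t+\<epsilon>}. mdist X (a s) (a s') = v * \<bar>s - s'\<bar>"
  obtains h where "h \<in> Isop" "h \<i> = \<i>" "\<And>u. a (s + u) = k (F (h (\<i> * of_real (exp (v * u)))))"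
proof -
  interpret C: hyperbolic_covering N j k "\<lambda>z. k (F z)" by (rule cov)
  interpret S: hyperbolic_surface "j ` N" by (rule sur)
  have ca: "continuous_on UNIV a" by (rule closed_geodesic_continuous[OF C.hom j a v loc])
  have cs: "continuous_on UNIV (\<lambda>u. a (s + u))"
    by (rule continuous_on_compose2[OF ca]) (auto intro!: continuous_intros)
  obtain c where c: "continuous_on UNIV c" "\<And>u. c u \<in> UH" "\<And>u. k (F (c u)) = a (s + u)" "c 0 = \<i>"
    using C.lift[OF convex_UNIV UNIV_I cs a C.i_UH, of 0] start by auto
  have kF: "F z = j (k (F z))" if "z \<in> UH" for z
    using S.locisom_in[OF F that] C.hom by (auto simp: homeomorphism_def)
  have "\<exists>\<epsilon>>0. \<forall>x y. \<bar>x - u\<bar> < \<epsilon> \<longrightarrow> \<bar>y - u\<bar> < \<epsilon> \<longrightarrow> hyp_dist (c x) (c y) = v * \<bar>x - y\<bar>" for u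
  proof -
    obtain e where e: "e > 0" "ball (c u) e \<subseteq> UH" "\<And>x. x \<in> ball (c u) e \<Longrightarrow> F x \<in> j ` N"
      "\<And>x y. x \<in> ball (c u) e \<Longrightarrow> y \<in> ball (c u) e \<Longrightarrow> dist (F x) (F y) = hyp_dist x y"
      by (rule S.locisomE[OF F c(2)], rule that)
    obtain d where d: "d > 0" "\<And>x. dist x u < d \<Longrightarrow> dist (c x) (c u) < e"
      using c(1) e(1) unfolding continuous_on_iff by (metis UNIV_I)
    obtain \<epsilon> where \<epsilon>: "\<epsilon> > 0" "\<forall>x \<in> {s+u-\<epsilon><..<s+u+\<epsilon>}. \<forall>y \<in> {s+u-\<epsilon><..<s+u+\<epsilon>}. mdist X (a x) (a y) = v * \<bar>x - y\<bar>"
      using loc by blast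
    show ?thesis
    proof (intro exI[of _ "min d \<epsilon>"] conjI allI impI)
      fix x y assume xy: "\<bar>x - u\<bar> < min d \<epsilon>" "\<bar>y - u\<bar> < min d \<epsilon>"
      have "c x \<in> ball (c u) e" "c y \<in> ball (c u) e"
        using d(2)[of x] d(2)[of y] xy by (auto simp: dist_real_def dist_commute)
      then have "hyp_dist (c x) (c y) = dist (F (c x)) (F (c y))" using e(4) by simp
      also have "\<dots> = mdist X (a (s + x)) (a (s + y))"
        using kF[OF c(2)] c(3) j[OF a a] by metis
      also have "\<dots> = v * \<bar>(s + x) - (s + y)\<bar>" using \<epsilon>(2) xy by (auto simp: abs_less_iff)
      finally show "hyp_dist (c x) (c y) = v * \<bar>x - y\<bar>" by simp
    qed (use d \<epsilon> in auto)
  qed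
  then obtain h where h: "h \<in> Isop" "\<And>u. c u = h (\<i> * of_real (exp (v * u)))"
    using local_geodesic[of v c] v c(2) by metis
  have "h \<i> = \<i>" using h(2)[of 0] c(4) by simp
  then show ?thesis using that[OF h(1)] c(3) h(2) by simp
qed

section \<open>Periodicity, transversality and counting\<close>

lemma periodic_int:
  fixes a :: "real \<Rightarrow> 'a"
  assumes "\<And>t. a (t + 1) = a t"
  shows "a (t + of_int n) = a t"
proof (induction n rule: int_induct[of _ 0])
  case (step1 i)
  then show ?case using assms[of "t + of_int i"] by (simp add: add.assoc)
next
  case (step2 i)
  then show ?case using assms[of "t + of_int (i - 1)"] by (simp add: algebra_simps)
qed simp

lemma periodic_image:
  fixes a :: "real \<Rightarrow> 'a"
  assumes "\<And>t. a (t + 1) = a t"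
  shows "a t \<in> a ` {0..1}"
proof -
  have "a t = a (frac t)" using periodic_int[of a "frac t" "\<lfloor>t\<rfloor>", OF assms] by (simp add: frac_def)
  moreover have "frac t \<in> {0..1}" using frac_lt_1[of t] frac_ge_0[of t] by simp
  ultimately show ?thesis by blast
qed

text \<open>By the chain rule the two tangent vectors are proportional.\<close>

lemma not_transverse_reparametrised:
  assumes b: "\<And>x. b x = a (s + r * (x - t))"
    and tr: "transverse_at X a s b t"
  shows False
proof -
  obtain \<rho> \<phi> u v where d: "((\<lambda>x. \<phi> (a x)) has_vector_derivative u) (at s)"
      "((\<lambda>x. \<phi> (b x)) has_vector_derivative v) (at t)" "u \<noteq> v" "independent {u, v}"
      "hyperbolic_chart X (a s) \<rho> \<phi>"
    using tr unfolding transverse_at_def by (elim conjE exE) (rule that; assumption)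
  have "((\<lambda>x. s + r * (x - t)) has_vector_derivative r) (at t)"
    by (auto intro!: derivative_eq_intros simp: has_real_derivative_iff_has_vector_derivative[symmetric])
  moreover have "((\<lambda>x. \<phi> (a x)) has_vector_derivative u) (at (s + r * (t - t)))" using d(1) by simp
  ultimately have "(((\<lambda>x. \<phi> (a x)) \<circ> (\<lambda>x. s + r * (x - t))) has_vector_derivative r *\<^sub>R u) (at t)"
    by (rule vector_diff_chain_at)
  then have "((\<lambda>x. \<phi> (b x)) has_vector_derivative r *\<^sub>R u) (at t)" by (simp add: b comp_def)
  then have "v = r *\<^sub>R u" using d(2) vector_derivative_unique_at by blast
  then have "v \<in> span ({u, v} - {v})" using d(3) by (auto intro: span_scale span_base)
  then show False using d(4) unfolding dependent_def by blast
qed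

text \<open>Any two elements differ by exactly 2, and three integers cannot do so pairwise.\<close>

lemma two_consecutive:
  fixes M :: "int set"
  assumes odd: "\<forall>m\<in>M. odd m" and cons: "\<forall>m\<in>M. \<forall>n\<in>M. m < n \<longrightarrow> n = m + 2"
  shows "finite M \<and> card M \<le> 2 \<and> (card M = 2 \<longrightarrow> (\<exists>m. odd m \<and> M = {m, m + 2}))"
proof -
  consider "M = {}" | m where "M = {m}" | m where "m \<in> M" "M = {m, m + 2}"
  proof (cases "M = {}")
    case False
    then obtain x where x: "x \<in> M" by blast
    show ?thesis
    proof (cases "M = {x}")
      case False
      then obtain y where y: "y \<in> M" "y \<noteq> x" using x by blast
      define m n where "m = min x y" and "n = max x y"
      have mn: "m \<in> M" "n \<in> M" "m < n" using x y by (auto simp: m_def n_def min_def max_def)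
      then have n: "n = m + 2" using cons by blast
      have "z = m \<or> z = n" if z: "z \<in> M" for z
      proof -
        have "m < z \<Longrightarrow> z = m + 2" "z < m \<Longrightarrow> m = z + 2" "z < n \<Longrightarrow> n = z + 2"
          using cons z mn by blast+
        then show ?thesis using n by linarith
      qed
      then have "M = {m, m + 2}" using mn n by blast
      then show ?thesis using that(3) mn by blast
    qed (use that in blast)
  qed (use that in blast)
  then show ?thesis using odd by cases auto
qed

theorem theorem3p2:
  fixes S F N :: "'a::t2_space set" and X :: "'a metric"
    and \<alpha> \<beta> :: "(real \<Rightarrow> 'a) set" and a b :: "real \<Rightarrow> 'a" and P :: 'a and s t :: real
    and \<alpha>\<^sub>P \<beta>\<^sub>P :: "(real \<Rightarrow> 'a) set" and M :: "int set"
  assumes "closed_surface S" and "finite F" and "F \<subseteq> S" and N: "N = S - F"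
    and "connected N" and "\<not> orientable_surface N"
    and "euler_characteristic (top_of_set N) < 0"
    and "complete_hyperbolic_metric_on N X"
    and "essential_class S F \<alpha>" and "essential_class S F \<beta>"
    and "geodesic_representative X \<alpha> a" and "geodesic_representative X \<beta> b"
    and "a s = P" and "b t = P" and "transverse_at X a s b t"
    and \<alpha>\<^sub>P: "\<alpha>\<^sub>P = based_class N (\<lambda>u. a (s + u))"
    and \<beta>\<^sub>P: "\<beta>\<^sub>P = based_class N (\<lambda>u. b (t + u))"
    and M: "M = {m. m \<noteq> 0 \<and> puncture_class S F
              (unbased N (\<alpha>\<^sub>P [^]\<^bsub>fundamental_group N P\<^esub> m \<otimes>\<^bsub>fundamental_group N P\<^esub> \<beta>\<^sub>P))}"
    and "M \<noteq> {}"
  shows "(\<forall>m\<in>M. odd m) \<and> finite M \<and> card M \<le> 2 \<and>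
         (card M = 2 \<longrightarrow> (\<exists>m. odd m \<and> M = {m, m + 2}))"
proof -
  note conn = \<open>connected N\<close> and comp = \<open>complete_hyperbolic_metric_on N X\<close> and tr = \<open>transverse_at X a s b t\<close>
  have mN: "mspace X = N" using comp by (simp add: complete_hyperbolic_metric_on_def hyperbolic_metric_on_def)
  have ga: "closed_geodesic X a" and gb: "closed_geodesic X b"
    using \<open>geodesic_representative X \<alpha> a\<close> \<open>geodesic_representative X \<beta> b\<close>
    by (auto simp: geodesic_representative_def)
  have aN: "a u \<in> N" and bN: "b u \<in> N" and per: "a (u + 1) = a u" "b (u + 1) = b u" for u
    using ga gb mN by (auto simp: closed_geodesic_def)
  obtain v where v: "v > 0" "\<forall>t. \<exists>\<epsilon>>0. \<forall>s \<in> {t-\<epsilon><..<t+\<epsilon>}. \<forall>s' \<in> {t-\<epsilon><..<t+\<epsilon>}. mdist X (a s) (a s') = v * \<bar>s - s'\<bar>"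
    using ga unfolding closed_geodesic_def by blast
  obtain w where w: "w > 0" "\<forall>t. \<exists>\<epsilon>>0. \<forall>s \<in> {t-\<epsilon><..<t+\<epsilon>}. \<forall>s' \<in> {t-\<epsilon><..<t+\<epsilon>}. mdist X (b s) (b s') = w * \<bar>s - s'\<bar>"
    using gb unfolding closed_geodesic_def by blast
  obtain j :: "'a \<Rightarrow> 'a discrete \<Rightarrow>\<^sub>C real"
    where hom: "homeomorphism N (j ` N) j (inv_into N j)"
    and j: "\<And>x y. x \<in> N \<Longrightarrow> y \<in> N \<Longrightarrow> dist (j x) (j y) = mdist X x y" and sur: "hyperbolic_surface (j ` N)"
    by (rule surface_embedding[OF comp conn], rule that)
  define k where "k = inv_into N j"
  note hom = hom[folded k_def]
  interpret S: hyperbolic_surface "j ` N" by (rule sur)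
  have cov: "hyperbolic_covering N j k (\<lambda>z. k (F z))" if "S.locisom F UH" for F
    using S.covering_from_locisom[OF hom that] hom by unfold_locales blast+
  have PN: "P \<in> N" using aN \<open>a s = P\<close> by blast
  have kj: "k (j P) = P" using hom PN by (auto simp: homeomorphism_def)
  have "j P \<in> j ` N" using PN by blast
  then obtain F0 where F0: "S.locisom F0 UH" "F0 \<i> = j P" by (rule S.locisom_through)
  have st0: "k (F0 \<i>) = a s" using F0(2) kj \<open>a s = P\<close> by simp
  obtain ha where ha: "ha \<in> Isop" "ha \<i> = \<i>" "\<And>u. a (s + u) = k (F0 (ha (\<i> * of_real (exp (v * u)))))"
    by (rule geodesic_lift[OF cov[OF F0(1)] sur F0(1) j aN v(1) st0 v(2)], assumption+, rule that)
  \<comment> \<open>Composing the covering with \<open>ha\<close> puts the lift of \<open>a\<close>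
    on the imaginary axis itself.\<close>
  define G where "G z = F0 (ha z)" for z
  have "{z\<in>UH. ha z \<in> UH} = UH" using Isop_UH[OF ha(1)] by blast
  then have G: "S.locisom G UH"
    using S.locisom_comp[OF F0(1) subsetD[OF Isop_subset ha(1)]] unfolding G_def by simp
  have stb: "k (G \<i>) = b t" using F0(2) ha(2) kj \<open>b t = P\<close> by (simp add: G_def)
  obtain hb where hb: "hb \<in> Isop" "hb \<i> = \<i>" "\<And>u. b (t + u) = k (G (hb (\<i> * of_real (exp (w * u)))))"
    by (rule geodesic_lift[OF cov[OF G] sur G j bN w(1) stb w(2)], assumption+, rule that)
  obtain A B C D where ABCD: "A * D - B * C = 1" "\<And>z. z \<in> UH \<Longrightarrow> hb z = mob A B C D z"
    by (rule IsopE[OF hb(1)], rule that)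
  have iU: "\<i> \<in> UH" by (simp add: UH_iff)
  have "of_real C * \<i> + of_real D \<noteq> (0::complex)" by (rule mob_denom[of A D B C, OF _ iU]) (use ABCD(1) in simp)
  moreover have "mob A B C D \<i> = \<i>" using ABCD(2)[OF iU] hb(2) by simp
  ultimately have "of_real A * \<i> + of_real B = \<i> * (of_real C * \<i> + of_real D)"
    by (simp add: mob_def divide_eq_eq)
  \<comment> \<open>A real matrix of determinant 1 whose map fixes \<open>\<i>\<close> is a rotation
    matrix.\<close>
  then have AB: "D = A" "C = - B" by (auto simp: complex_eq_iff)
  have hbm: "hb z = mob A B (- B) A z" if "z \<in> UH" for z using ABCD(2)[OF that] AB by simp
  have AB1: "A\<^sup>2 + B\<^sup>2 = 1" using ABCD(1) AB by (simp add: power2_eq_square)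
  have ax: "a (s + u) = k (G (\<i> * of_real (exp (v * u))))" for u using ha(3) by (simp add: G_def)
  \<comment> \<open>\<epsilon> will be 1 or -1: \<open>b\<close> would run along \<open>a\<close>
    forwards or backwards, against transversality.\<close>
  have rep: False if "\<And>u. hb (\<i> * of_real (exp (w * u))) = \<i> * of_real (exp (\<epsilon> * w * u))" for \<epsilon>
  proof (rule not_transverse_reparametrised[OF _ tr])
    fix x
    have "b x = k (G (hb (\<i> * of_real (exp (w * (x - t))))))" using hb(3)[of "x - t"] by simp
    also have "\<dots> = k (G (\<i> * of_real (exp (v * (\<epsilon> * w / v * (x - t))))))" using v(1) by (simp add: that mult.assoc)
    finally show "b x = a (s + \<epsilon> * w / v * (x - t))" unfolding ax .
  qed
  \<comment> \<open>\<open>B = 0\<close> makes \<open>hb\<close> the identity and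
    \<open>A = 0\<close> the half turn about \<open>\<i>\<close>, which reverses the imaginary axis;
    in both cases the two lifts would have the same image.\<close>
  have "A * B \<noteq> 0"
  proof
    assume "A * B = 0"
    then consider "B = 0" | "A = 0" by auto
    then show False
    proof cases
      case 1
      then have "A \<noteq> 0" using AB1 by auto
      then show False using rep[of 1] hbm[OF iy_UH] by (simp add: mob_def 1)
    next
      case 2
      then have "B \<noteq> 0" using AB1 by auto
      have "hb (\<i> * of_real (exp (w * u))) = \<i> * of_real (exp (- 1 * w * u))" for u
      proof -
        have "hb (\<i> * of_real (exp (w * u))) = - 1 / (\<i> * of_real (exp (w * u)))"
          using hbm[OF iy_UH] \<open>B \<noteq> 0\<close> by (simp add: mob_def 2)
        also have "\<dots> = \<i> * inverse (of_real (exp (w * u)))" by (simp add: divide_inverse inverse_mult_distrib)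
        also have "inverse (of_real (exp (w * u))) = (of_real (exp (- 1 * w * u)) :: complex)"
          by (simp only: of_real_inverse[symmetric] exp_minus[symmetric]) simp
        finally show ?thesis .
      qed
      then show False by (rule rep)
    qed
  qed
  interpret C: hyperbolic_covering N j k "\<lambda>z. k (G z)" by (rule cov[OF G])
  have base: "k (G \<i>) = P" using stb \<open>b t = P\<close> by simp
  have ca: "continuous_on UNIV a" by (rule closed_geodesic_continuous[OF hom j aN v]) 
  have cb: "continuous_on UNIV b" by (rule closed_geodesic_continuous[OF hom j bN w]) 
  have "(\<forall>m\<in>M. odd m) \<and> (\<forall>m\<in>M. \<forall>n\<in>M. m < n \<longrightarrow> n = m + 2)"
  \<comment> \<open>By periodicity one period of each geodesic contains all its values, which makes
    the set to be avoided compact.\<close>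
  proof (rule C.peripheral_powers[OF N v(1) w(1) ax _ AB1 \<open>A * B \<noteq> 0\<close> hbm hb(3), of "a ` {0..1} \<union> b ` {0..1}"])
    show "a (s + (u + 1)) = a (s + u)" for u using per(1)[of "s + u"] by (simp add: add.assoc)
    show "b (t + (u + 1)) = b (t + u)" for u using per(2)[of "t + u"] by (simp add: add.assoc)
    show "compact (a ` {0..1} \<union> b ` {0..1})"
      by (intro compact_Un compact_continuous_image continuous_on_subset[OF ca] continuous_on_subset[OF cb]) auto
    show "a ` {0..1} \<union> b ` {0..1} \<subseteq> N" using aN bN by blast
    show "a (s + u) \<in> a ` {0..1} \<union> b ` {0..1}" for u using periodic_image[of a "s + u", OF per(1)] by blast
    show "b (t + u) \<in> a ` {0..1} \<union> b ` {0..1}" for u using periodic_image[of b "t + u", OF per(2)] by blast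
    show "M = {m. m \<noteq> 0 \<and> puncture_class S F (unbased N (based_class N (\<lambda>u. a (s + u)) [^]\<^bsub>fundamental_group N (k (G \<i>))\<^esub> m
        \<otimes>\<^bsub>fundamental_group N (k (G \<i>))\<^esub> based_class N (\<lambda>u. b (t + u))))}"
      unfolding base M \<alpha>\<^sub>P \<beta>\<^sub>P ..
  qed
  then show ?thesis using two_consecutive[of M] by blast
qed

end
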